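(* Let $\{X_n\}_{n\ge 0}$ be a two-type branching process with immigration (with the notation fixed in the context) such that $f(\mathbf 0)=\mathbf 0$, the mean matrix $M$ is positively regular, and its maximal eigenvalue satisfies $\rho>1$. Assume that $h_0>0$ and that there is $0<\gamma<1$ such that $A^n\gamma^{-n}$ converges, as $n\to\infty$, to a matrix $P_0$ which is nonzero and has finite entries. Suppose that $E_i(e^{\theta_0(\mathbf 1\cdot X_1)})<\infty$ for some $\theta_0>0$ and $i=1,2$. Let $\boldsymbol l=(l_1,l_2)\in\mathbb R^2$ be a nonzero vector with $l_1\neq l_2$. Then, for any $\varepsilon>0$ and $i=1,2$, $$\lim_{n\to\infty}(h_0\gamma)^{-n}P_i\Big(\Big|\frac{\boldsymbol l\cdot X_{n+1}}{\mathbf 1\cdot X_n}-\frac{\boldsymbol l\cdot(X_nM)}{\mathbf 1\cdot X_n}\Big|>\varepsilon\Big)=\sum_{\boldsymbol j\in\mathbb N^2\setminus\{\mathbf 0\}}\phi(\boldsymbol j,\varepsilon)\,r_{i,\boldsymbol j}<\infty,$$ and there is a positive integer $k_0$ such that $$\lim_{n\to\infty}(h_0\gamma)^{-n}P_i\Big(\Big|\frac{\boldsymbol l\cdot X_n}{\mathbf 1\cdot X_n}-\frac{\boldsymbol l\cdot\boldsymbol v}{\mathbf 1\cdot\boldsymbol v}\Big|>\varepsilon\Big)=(h_0\gamma)^{-k_0}\sum_{\boldsymbol j\in\mathbb N^2\setminus\{\mathbf 0\}}\hat\phi(\boldsymbol j,k_0,\varepsilon)\,r_{i,\boldsymbol j}<\infty,$$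 where $$\phi(\boldsymbol j,\varepsilon)=P\big(|\boldsymbol l\cdot X_1-\boldsymbol l\cdot(\boldsymbol jM)|>\varepsilon(\mathbf 1\cdot\boldsymbol j)\,\big|\,X_0=\boldsymbol j\big),$$ $$\hat\phi(\boldsymbol j,k_0,\varepsilon)=P\Big(\Big|\frac{\boldsymbol l\cdot X_{k_0}}{\mathbf 1\cdot X_{k_0}}-\frac{\boldsymbol l\cdot\boldsymbol v}{\mathbf 1\cdot\boldsymbol v}\Big|>\varepsilon\,\Big|\,X_0=\boldsymbol j\Big),$$ and $$r_{i,\boldsymbol j}=\lim_{n\to\infty}\frac{P_i(X_n=\boldsymbol j)}{(h_0\gamma)^n}.$$
   Context: $\mathbb N=\{0,1,2,\dots\}$, $\mathbf 1=(1,1)$, $\mathbf 0=(0,0)$, $e_1=(1,0)$, $e_2=(0,1)$; vectors are row vectors and $\cdot$ is the Euclidean inner product; $\boldsymbol s^{\boldsymbol j}=s_1^{j_1}s_2^{j_2}$. $\{Z_n\}_{n\ge0}$, $Z_n=(Z_n^{(1)},Z_n^{(2)})$, is a two-type Galton–Watson branching process: each particle of type $i$ independently produces, in the next generation, a random vector of offspring with law $P_i(j_1,j_2)=P(Z_1=(j_1,j_2)\mid Z_0=e_i)$. Its offspring generating functions are $f^{(i)}(\boldsymbol s)=f_1^{(i)}(\boldsymbol s)=\sum_{\boldsymbol j\in\mathbb N^2}P_i(j_1,j_2)s_1^{j_1}s_2^{j_2}$, $i=1,2$, $\boldsymbol s\in[0,1]^2$, and $f=(f^{(1)},f^{(2)})$.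 $I_1,I_2,\dots$ are i.i.d. $\mathbb N^2$-valued immigration vectors, independent of the reproduction, and $h_0=P(I_1=\mathbf 0)$. The process with immigration is $X_0=Z_0$, $X_n=Z_n+U_n^{(1)}+\cdots+U_n^{(n)}$ for $n\ge1$, where $U_n^{(k)}$ is the vector of numbers of descendants, in generation $n$, of the $k$-th immigration $I_k$ (so $U_n^{(n)}=I_n$); all particles reproduce independently with the same offspring laws. Equivalently, given $X_n=\boldsymbol j$, $X_{n+1}$ is the sum of the offspring vectors of the $j_1$ particles of type 1 and the $j_2$ particles of type 2 plus the independent vector $I_{n+1}$. $P_i$ and $E_i$ denote probability and expectation given $X_0=e_i$; $P(\cdot\mid X_0=\boldsymbol j)$ refers to the process started from $\boldsymbol j$. With $D_{ij}(\boldsymbol s)=\partial f^{(i)}(\boldsymbol s)/\partial s_j$, set $A=(D_{ij}(\mathbf 0))_{i,j}$ and $M=(m_{ij})$, $m_{ij}=D_{ij}(\mathbf 1^-)$ (the mean matrix, with finite entries). Positively regular means that some power of $M$ has all entries strictly positive; $\rho$ is then the maximal (Perron–Frobenius) eigenvalue of $M$, with strictly positive left eigenvector $\boldsymbol v$ and right eigenvector $\boldsymbol u$ normalized by $\boldsymbol v\cdot\boldsymbol u=1$, $\boldsymbol u\cdot\mathbf 1=1$. The limit defining $r_{i,\boldsymbol j}$ exists under the stated assumptions on $h_0$ and $A$. *)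

theory Defs
  imports "HOL-Probability.Probability"
begin

text \<open>
  Particle types are the elements \<open>1\<close>, \<open>2\<close> of the numeral type \<^typ>\<open>2\<close>, so population vectors have
  type \<^typ>\<open>nat ^ 2\<close> and \<open>e\<^sub>i\<close> is \<^term>\<open>axis i 1 :: nat ^ 2\<close>. Vectors are row vectors: \<open>x M\<close> is
  \<open>x v* M\<close>. The vector \<open>(1, 1)\<close> is \<^term>\<open>1 :: real ^ 2\<close>.
\<close>

definition rvec :: "nat ^ 2 \<Rightarrow> real ^ 2" where
  "rvec j = (\<chi> i. real (j $ i))"

text \<open>
  The power \<open>A ^ n\<close> of type class \<open>power\<close> is taken entrywise on \<^typ>\<open>real ^ 2 ^ 2\<close>, hence this
  definition of the usual matrix power.
\<close>

primrec mat_power :: "real ^ 2 ^ 2 \<Rightarrow> nat \<Rightarrow> real ^ 2 ^ 2" where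
  "mat_power A 0 = mat 1"
| "mat_power A (Suc n) = A ** mat_power A n"

text \<open>
  \<open>X j n\<close> is the population in generation \<open>n\<close> of the process started from \<open>j\<close>. The vector
  \<open>\<xi> i n k\<close> is the offspring in generation \<open>n + 1\<close> of the \<open>k\<close>-th particle of type \<open>i\<close> in generation
  \<open>n\<close> (counting from \<open>k = 0\<close>), and \<open>Im n\<close> with \<open>n \<ge> 1\<close> is the immigration vector \<open>I\<^sub>n\<close>. The
  disjoint sum indexes the joint family of offspring and immigration vectors, all mutually
  independent. Probabilities given \<open>X\<^sub>0 = j\<close> are probabilities for \<open>X j\<close>; the processes with different
  starting points share their randomness, but only one of them occurs in any given event.
\<close>

definition two_type_GWI ::
  "'w measure \<Rightarrow> (2 \<Rightarrow> (nat ^ 2) pmf) \<Rightarrow> (nat ^ 2) pmf \<Rightarrow> (nat ^ 2 \<Rightarrow> nat \<Rightarrow> 'w \<Rightarrow> nat ^ 2) \<Rightarrow> bool"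
where
  "two_type_GWI \<Omega> p h X \<longleftrightarrow> prob_space \<Omega> \<and>
     (\<exists>(\<xi> :: 2 \<Rightarrow> nat \<Rightarrow> nat \<Rightarrow> 'w \<Rightarrow> nat ^ 2) (Im :: nat \<Rightarrow> 'w \<Rightarrow> nat ^ 2).
        prob_space.indep_vars \<Omega> (\<lambda>_. count_space UNIV)
          (case_sum (\<lambda>(i, n, k). \<xi> i n k) Im) (UNIV <+> {1..}) \<and>
        (\<forall>i n k. distr \<Omega> (count_space UNIV) (\<xi> i n k) = measure_pmf (p i)) \<and>
        (\<forall>n\<ge>1. distr \<Omega> (count_space UNIV) (Im n) = measure_pmf h) \<and>
        (\<forall>j. \<forall>\<omega>\<in>space \<Omega>.
           X j 0 \<omega> = j \<and>
           (\<forall>n. X j (Suc n) \<omega> =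
             (\<Sum>i\<in>UNIV. \<Sum>k<X j n \<omega> $ i. \<xi> i n k \<omega>) + Im (Suc n) \<omega>)))"

definition offspring_gf :: "(2 \<Rightarrow> (nat ^ 2) pmf) \<Rightarrow> 2 \<Rightarrow> real ^ 2 \<Rightarrow> real" where
  "offspring_gf p i s = (\<Sum>\<^sub>\<infinity>j\<in>UNIV. pmf (p i) j * (\<Prod>k\<in>UNIV. (s $ k) ^ (j $ k)))"

text \<open>
  \<open>D\<^sub>i\<^sub>j\<close>. The generating functions live on the unit square, so the derivative is taken within
  the unit interval; it is one-sided at the end points.
\<close>

definition offspring_gf_partial :: "(2 \<Rightarrow> (nat ^ 2) pmf) \<Rightarrow> 2 \<Rightarrow> 2 \<Rightarrow> real ^ 2 \<Rightarrow> real" where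
  "offspring_gf_partial p i j s =
     vector_derivative (\<lambda>t. offspring_gf p i (\<chi> k. if k = j then t else s $ k))
       (at (s $ j) within {0..1})"

definition deriv_matrix_0 :: "(2 \<Rightarrow> (nat ^ 2) pmf) \<Rightarrow> real ^ 2 ^ 2" where
  "deriv_matrix_0 p = (\<chi> i j. offspring_gf_partial p i j 0)"

text \<open>\<open>m\<^sub>i\<^sub>j = D\<^sub>i\<^sub>j(1\<^sup>-)\<close>; convergence to a real number expresses that the entries are finite.\<close>

definition is_mean_matrix :: "(2 \<Rightarrow> (nat ^ 2) pmf) \<Rightarrow> real ^ 2 ^ 2 \<Rightarrow> bool" where
  "is_mean_matrix p M \<longleftrightarrow>
     (\<forall>i j. (offspring_gf_partial p i j \<longlongrightarrow> M $ i $ j) (at 1 within {s. \<forall>k. 0 \<le> s $ k \<and> s $ k < 1}))"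

definition positively_regular :: "real ^ 2 ^ 2 \<Rightarrow> bool" where
  "positively_regular M \<longleftrightarrow> (\<exists>n\<ge>1. \<forall>i j. mat_power M n $ i $ j > 0)"

definition maximal_eigenvalue :: "real ^ 2 ^ 2 \<Rightarrow> real \<Rightarrow> bool" where
  "maximal_eigenvalue M \<rho> \<longleftrightarrow>
     (\<exists>x. x \<noteq> 0 \<and> M *v x = \<rho> *s x) \<and>
     (\<forall>(\<mu> :: complex) (z :: complex ^ 2).
        z \<noteq> 0 \<and> (\<chi> i j. complex_of_real (M $ i $ j)) *v z = \<mu> *s z \<longrightarrow> cmod \<mu> \<le> \<rho>)"

text \<open>\<open>r\<^sub>i\<^sub>,\<^sub>j\<close>, where \<open>c = h\<^sub>0 \<gamma>\<close>\<close>

definition ratio ::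
  "'w measure \<Rightarrow> (nat ^ 2 \<Rightarrow> nat \<Rightarrow> 'w \<Rightarrow> nat ^ 2) \<Rightarrow> real \<Rightarrow> 2 \<Rightarrow> nat ^ 2 \<Rightarrow> nat \<Rightarrow> real"
where
  "ratio \<Omega> X c i j n = \<P>(\<omega> in \<Omega>. X (axis i 1) n \<omega> = j) / c ^ n"

definition r_lim ::
  "'w measure \<Rightarrow> (nat ^ 2 \<Rightarrow> nat \<Rightarrow> 'w \<Rightarrow> nat ^ 2) \<Rightarrow> real \<Rightarrow> 2 \<Rightarrow> nat ^ 2 \<Rightarrow> real"
where
  "r_lim \<Omega> X c i j = lim (ratio \<Omega> X c i j)"

definition phi ::
  "'w measure \<Rightarrow> (nat ^ 2 \<Rightarrow> nat \<Rightarrow> 'w \<Rightarrow> nat ^ 2) \<Rightarrow> real ^ 2 ^ 2 \<Rightarrow> real ^ 2 \<Rightarrow> nat ^ 2 \<Rightarrow> real \<Rightarrow> real"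
where
  "phi \<Omega> X M l j \<epsilon> =
     \<P>(\<omega> in \<Omega>. \<bar>l \<bullet> rvec (X j 1 \<omega>) - l \<bullet> (rvec j v* M)\<bar> > \<epsilon> * (1 \<bullet> rvec j))"

definition phi_hat ::
  "'w measure \<Rightarrow> (nat ^ 2 \<Rightarrow> nat \<Rightarrow> 'w \<Rightarrow> nat ^ 2) \<Rightarrow> real ^ 2 \<Rightarrow> real ^ 2 \<Rightarrow> nat ^ 2 \<Rightarrow> nat \<Rightarrow> real \<Rightarrow> real"
where
  "phi_hat \<Omega> X v l j k \<epsilon> =
     \<P>(\<omega> in \<Omega>. \<bar>(l \<bullet> rvec (X j k \<omega>)) / (1 \<bullet> rvec (X j k \<omega>)) - (l \<bullet> v) / (1 \<bullet> v)\<bar> > \<epsilon>)"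

end

theory Submission
  imports Defs
begin

text \<open>
  Every particle leaves offspring, so the population size never decreases, and a population that is
  still small after \<open>n\<close> generations had no immigration and almost no branching. Iterating the
  generating functions at \<open>(\<sigma>, \<sigma>)\<close> with \<open>\<sigma> < 1\<close> gives \<open>E (\<sigma> ^ \<bar>X\<^sub>n\<bar>) \<le> C (h\<^sub>0 \<gamma>) ^ n\<close>, with \<open>\<gamma>\<close>
  improved to \<open>\<gamma>\<^sup>2\<close> from at least two particles. Splitting at the first step therefore turns
  \<open>P\<^sub>i (X\<^sub>n = j) / (h\<^sub>0 \<gamma>) ^ n\<close> into a linear recursion with matrix \<open>A / \<gamma>\<close> and a summable perturbation,
  which converges. By Chernoff's bound \<open>\<phi>\<close> decays exponentially in \<open>\<bar>j\<bar>\<close>, and against such weights the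
  limit may be taken termwise. For the second limit, \<open>w = l - (l \<bullet> v / 1 \<bullet> v) 1\<close> is orthogonal to \<open>v\<close>
  and hence, in dimension two, an eigenvector of \<open>M\<close> for the other eigenvalue; the ratio
  \<open>(w \<bullet> X\<^sub>n) / (u \<bullet> X\<^sub>n)\<close> is contracted in each step up to exponentially unlikely deviations, so that a
  fixed number \<open>k\<^sub>0\<close> of steps makes it small uniformly in the starting point.
\<close>

section \<open>The process as a Markov chain\<close>

text \<open>The limits are normalized by exactly \<open>(h\<^sub>0 * \<gamma>) ^ n\<close>, so no
  factor growing with \<open>n\<close> may be lost, while the hypothesis on the powers of A bounds
  them only up to a constant and gives no contraction in a single step. The sharp rate is therefore
  reached in two rounds: a block of several generations contracts by some crude factor, which makes
  the iterates of the generating functions summable; Gronwall's inequality then turns summability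
  into the rate \<open>\<gamma> ^ n\<close>, and the immigration factors stay within a constant of
  \<open>h\<^sub>0 ^ n\<close>. Two initial particles contribute a product of two such iterates,
  hence \<open>\<gamma>\<^sup>2\<close>. The parameter \<sigma> < 1 is free: the limits
  \<open>r\<^sub>i\<^sub>,\<^sub>j\<close> grow more slowly than any exponential in the size of
  \<open>j\<close>, so every exponentially decaying weight is summable against them. The factor in
  front of the second series is an index shift: by the Markov property the probability at time
  \<open>n + k\<^sub>0\<close> is the expectation of a fixed weight at time \<open>n\<close>, and
  one limit statement serves both weights.\<close>

definition litter_index :: "nat ^ 2 \<Rightarrow> (2 \<times> nat) option set" where
  "litter_index x = insert None (Some ` {(i, k). k < x $ i})"

text \<open>\<open>None\<close> stands for the immigration vector and \<open>Some (i, k)\<close> for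
  the litter of the \<open>k\<close>-th particle of type \<open>i\<close>. Having all of them in one
  finite product \<open>Pi_pmf\<close> makes the generating function of a step a single product of
  expectations.\<close>

definition gwi_step :: "(2 \<Rightarrow> (nat ^ 2) pmf) \<Rightarrow> (nat ^ 2) pmf \<Rightarrow> nat ^ 2 \<Rightarrow> (nat ^ 2) pmf" where
  "gwi_step p h x = map_pmf (\<lambda>g. \<Sum>a\<in>litter_index x. g a)
     (Pi_pmf (litter_index x) 0 (case_option h (\<lambda>(i, k). p i)))"

primrec gwi_law ::
  "(2 \<Rightarrow> (nat ^ 2) pmf) \<Rightarrow> (nat ^ 2) pmf \<Rightarrow> nat \<Rightarrow> nat ^ 2 \<Rightarrow> (nat ^ 2) pmf" where
  "gwi_law p h 0 x = return_pmf x"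
| "gwi_law p h (Suc n) x = bind_pmf (gwi_law p h n x) (gwi_step p h)"

lemma finite_litter: "finite {(i :: 2, k). k < (x :: nat ^ 2) $ i}"
proof -
  have "{(i :: 2, k). k < x $ i} = (SIGMA i:UNIV. {..<x $ i})"
    by auto
  then show ?thesis
    by simp
qed

lemma finite_litter_index [simp]: "finite (litter_index x)"
  using finite_litter by (simp add: litter_index_def)

lemma sum_litter_index:
  "(\<Sum>a\<in>litter_index x. g a) = (\<Sum>i\<in>UNIV. \<Sum>k<x $ i. g (Some (i, k))) + (g None :: 'a :: comm_monoid_add)"
proof -
  have "(\<Sum>a\<in>litter_index x. g a) = g None + (\<Sum>a\<in>{(i, k). k < x $ i}. g (Some a))"
    unfolding litter_index_def using finite_litter[of x]
    by (subst sum.insert) (auto simp: sum.reindex)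
  also have "{(i :: 2, k). k < x $ i} = (SIGMA i:UNIV. {..<x $ i})"
    by auto
  also have "(\<Sum>a\<in>(SIGMA i:UNIV. {..<x $ i}). g (Some a)) = (\<Sum>i\<in>UNIV. \<Sum>k<x $ i. g (Some (i, k)))"
    by (subst sum.Sigma) (auto simp: case_prod_unfold)
  finally show ?thesis
    by (simp add: add.commute)
qed

lemma prod_litter_index:
  "(\<Prod>a\<in>litter_index x. g a) = (\<Prod>i\<in>UNIV. \<Prod>k<x $ i. g (Some (i, k))) * (g None :: 'a :: comm_monoid_mult)"
proof -
  have "(\<Prod>a\<in>litter_index x. g a) = g None * (\<Prod>a\<in>{(i, k). k < x $ i}. g (Some a))"
    unfolding litter_index_def using finite_litter[of x]
    by (subst prod.insert) (auto simp: prod.reindex)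
  also have "{(i :: 2, k). k < x $ i} = (SIGMA i:UNIV. {..<x $ i})"
    by auto
  also have "(\<Prod>a\<in>(SIGMA i:UNIV. {..<x $ i}). g (Some a)) = (\<Prod>i\<in>UNIV. \<Prod>k<x $ i. g (Some (i, k)))"
    by (subst prod.Sigma) (auto simp: case_prod_unfold)
  finally show ?thesis
    by (simp add: mult.commute)
qed

text \<open>The Markov property; it serves to split off the first step and, in the theorem, the last
  \<open>k\<^sub>0\<close> steps.\<close>

lemma gwi_law_add: "gwi_law p h (m + n) x = bind_pmf (gwi_law p h m x) (gwi_law p h n)"
  by (induction n) (simp_all add: bind_return_pmf' bind_assoc_pmf)

lemma gwi_law_1: "gwi_law p h 1 x = gwi_step p h x"
  by (simp add: bind_return_pmf)

lemma gwi_law_Suc': "gwi_law p h (Suc n) x = bind_pmf (gwi_step p h x) (gwi_law p h n)"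
  using gwi_law_add[of p h 1 n x] gwi_law_1[of p h x] by simp

section \<open>Countably valued random variables: measurability, independence, joint laws\<close>

lemma measurable_add_count_space [measurable]:
  fixes f g :: "'a \<Rightarrow> 'b :: {countable, plus}"
  assumes f: "f \<in> measurable M (count_space UNIV)" and g: "g \<in> measurable M (count_space UNIV)"
  shows "(\<lambda>x. f x + g x) \<in> measurable M (count_space UNIV)"
proof (rule measurable_compose_countable[OF _ f, where f = "\<lambda>i x. i + g x"])
  show "(\<lambda>x. i + g x) \<in> measurable M (count_space UNIV)" for i
    by (rule measurable_compose[OF g]) simp
qed

lemma measurable_sum_count_space [measurable (raw)]:
  fixes f :: "'i \<Rightarrow> 'a \<Rightarrow> 'b :: {countable, comm_monoid_add}"
  assumes "\<And>i. i \<in> I \<Longrightarrow> f i \<in> measurable M (count_space UNIV)"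
  shows "(\<lambda>x. \<Sum>i\<in>I. f i x) \<in> measurable M (count_space UNIV)"
  using assms by (induction I rule: infinite_finite_induct) simp_all

lemma (in prob_space) indep_var_joint_pmf:
  fixes V :: "'a \<Rightarrow> 'b :: countable" and W :: "'a \<Rightarrow> 'b"
  assumes ind: "indep_var (count_space UNIV) V (count_space UNIV) W"
    and V: "distr M (count_space UNIV) V = measure_pmf a"
    and W: "distr M (count_space UNIV) W = measure_pmf b"
  shows "prob {\<omega>\<in>space M. V \<omega> = x \<and> W \<omega> = y} = pmf a x * pmf b y"
proof -
  have mV: "random_variable (count_space UNIV) V" and mW: "random_variable (count_space UNIV) W"
    using ind by (auto dest: indep_var_rv1 indep_var_rv2)
  have "prob ((\<lambda>\<omega>. (V \<omega>, W \<omega>)) -` ({x} \<times> {y}) \<inter> space M) =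
    prob (V -` {x} \<inter> space M) * prob (W -` {y} \<inter> space M)"
    by (intro indep_varD[OF ind]) auto
  also have "prob (V -` {x} \<inter> space M) = measure (distr M (count_space UNIV) V) {x}"
    by (subst measure_distr[OF mV]) auto
  also have "prob (W -` {y} \<inter> space M) = measure (distr M (count_space UNIV) W) {y}"
    by (subst measure_distr[OF mW]) auto
  also have "(\<lambda>\<omega>. (V \<omega>, W \<omega>)) -` ({x} \<times> {y}) \<inter> space M = {\<omega>\<in>space M. V \<omega> = x \<and> W \<omega> = y}"
    by auto
  finally show ?thesis
    by (simp add: V W pmf.rep_eq)
qed

lemma (in prob_space) distr_eq_pmfI:
  fixes V :: "'a \<Rightarrow> 'b :: countable"
  assumes V: "random_variable (count_space UNIV) V"
    and eq: "\<And>x. prob {\<omega>\<in>space M. V \<omega> = x} = pmf a x"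
  shows "distr M (count_space UNIV) V = measure_pmf a"
proof (rule measure_eqI_countable[of _ UNIV])
  fix x
  have "emeasure (distr M (count_space UNIV) V) {x} = emeasure M {\<omega>\<in>space M. V \<omega> = x}"
    by (subst emeasure_distr[OF V]) (auto intro!: arg_cong[where f = "emeasure M"])
  then show "emeasure (distr M (count_space UNIV) V) {x} = emeasure (measure_pmf a) {x}"
    by (simp add: emeasure_eq_measure eq emeasure_pmf_single)
qed auto

lemma (in prob_space) distr_joint_pmf:
  fixes V :: "'a \<Rightarrow> 'b :: countable" and W :: "'a \<Rightarrow> 'b"
  assumes ind: "indep_var (count_space UNIV) V (count_space UNIV) W"
    and V: "distr M (count_space UNIV) V = measure_pmf a"
    and W: "distr M (count_space UNIV) W = measure_pmf b"
  shows "distr M (count_space UNIV) (\<lambda>\<omega>. (V \<omega>, W \<omega>)) = measure_pmf (pair_pmf a b)"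
proof (rule distr_eq_pmfI)
  have [measurable]: "random_variable (count_space UNIV) V" "random_variable (count_space UNIV) W"
    using ind by (auto dest: indep_var_rv1 indep_var_rv2)
  have "random_variable (count_space UNIV \<Otimes>\<^sub>M count_space UNIV) (\<lambda>\<omega>. (V \<omega>, W \<omega>))"
    by measurable
  then show "random_variable (count_space UNIV) (\<lambda>\<omega>. (V \<omega>, W \<omega>))"
    by (simp add: pair_measure_countable)
  show "prob {\<omega> \<in> space M. (V \<omega>, W \<omega>) = z} = pmf (pair_pmf a b) z" for z
    using indep_var_joint_pmf[OF assms, of "fst z" "snd z"] by (cases z) (simp add: pmf_pair)
qed

text \<open>The singletons \<open>{f a}\<close> are disjoint index blocks because \<open>f\<close>
  is injective on \<open>J\<close>.\<close>

lemma (in prob_space) indep_vars_reindex: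
  assumes ind: "indep_vars (\<lambda>_. N) V I" and f: "f ` J \<subseteq> I" "inj_on f J"
  shows "indep_vars (\<lambda>_. N) (\<lambda>a. V (f a)) J"
proof -
  have "indep_vars (\<lambda>a. PiM {f a} (\<lambda>_. N)) (\<lambda>a \<omega>. restrict (\<lambda>i. V i \<omega>) {f a}) J"
    using f by (intro indep_vars_restrict[OF ind]) (auto simp: disjoint_family_on_def inj_on_def)
  then have "indep_vars (\<lambda>_. N) (\<lambda>a. (\<lambda>g. g (f a)) \<circ> (\<lambda>\<omega>. restrict (\<lambda>i. V i \<omega>) {f a})) J"
    by (rule indep_vars_compose) auto
  then show ?thesis
    by (simp add: o_def)
qed

text \<open>Links the variables on the given space to the product \<open>Pi_pmf\<close>. In the
  induction, \<open>V a\<close> and the sum over \<open>S\<close> are functions of the families over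
  the disjoint index sets \<open>{a}\<close> and \<open>S\<close>.\<close>

lemma (in prob_space) distr_sum_indep_pmf:
  fixes V :: "'i \<Rightarrow> 'a \<Rightarrow> 'b :: {countable, comm_monoid_add}"
  assumes "finite S" "indep_vars (\<lambda>_. count_space UNIV) V S"
    and "\<And>i. i \<in> S \<Longrightarrow> distr M (count_space UNIV) (V i) = measure_pmf (q i)"
  shows "distr M (count_space UNIV) (\<lambda>\<omega>. \<Sum>i\<in>S. V i \<omega>) =
    measure_pmf (map_pmf (\<lambda>g. \<Sum>i\<in>S. g i) (Pi_pmf S 0 q))"
  using assms
proof (induction S rule: finite_induct)
  case empty
  show ?case
    by (rule distr_eq_pmfI) (auto simp: prob_space indicator_def)
next
  case (insert a S)
  have sub: "indep_vars (\<lambda>_. count_space UNIV) V S"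
    using insert.prems(1) by (rule indep_vars_subset) auto
  have IH: "distr M (count_space UNIV) (\<lambda>\<omega>. \<Sum>i\<in>S. V i \<omega>) =
      measure_pmf (map_pmf (\<lambda>g. \<Sum>i\<in>S. g i) (Pi_pmf S 0 q))"
    using sub insert by simp
  have "indep_var (count_space UNIV) ((\<lambda>g. g a) \<circ> (\<lambda>\<omega>. restrict (\<lambda>i. V i \<omega>) {a}))
      (count_space UNIV) ((\<lambda>g. \<Sum>i\<in>S. g i) \<circ> (\<lambda>\<omega>. restrict (\<lambda>i. V i \<omega>) S))"
    using insert.hyps
    by (intro indep_var_compose[OF indep_var_restrict[OF insert.prems(1)]]) auto
  also have "(\<lambda>g. g a) \<circ> (\<lambda>\<omega>. restrict (\<lambda>i. V i \<omega>) {a}) = V a"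
    by auto
  also have "(\<lambda>g. \<Sum>i\<in>S. g i) \<circ> (\<lambda>\<omega>. restrict (\<lambda>i. V i \<omega>) S) = (\<lambda>\<omega>. \<Sum>i\<in>S. V i \<omega>)"
    by (auto cong: rev_conj_cong)
  finally have ind: "indep_var (count_space UNIV) (V a) (count_space UNIV) (\<lambda>\<omega>. \<Sum>i\<in>S. V i \<omega>)" .
  have pair: "distr M (count_space UNIV) (\<lambda>\<omega>. (V a \<omega>, \<Sum>i\<in>S. V i \<omega>)) =
      measure_pmf (pair_pmf (q a) (map_pmf (\<lambda>g. \<Sum>i\<in>S. g i) (Pi_pmf S 0 q)))"
    using distr_joint_pmf[OF ind insert.prems(2) IH] by simp
  have [measurable]: "random_variable (count_space UNIV) (V a)"
      "random_variable (count_space UNIV) (\<lambda>\<omega>. \<Sum>i\<in>S. V i \<omega>)"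
    using ind by (auto dest: indep_var_rv1 indep_var_rv2)
  have "random_variable (count_space UNIV \<Otimes>\<^sub>M count_space UNIV) (\<lambda>\<omega>. (V a \<omega>, \<Sum>i\<in>S. V i \<omega>))"
    by measurable
  then have m: "random_variable (count_space UNIV) (\<lambda>\<omega>. (V a \<omega>, \<Sum>i\<in>S. V i \<omega>))"
    by (simp add: pair_measure_countable)
  have "distr M (count_space UNIV) (\<lambda>\<omega>. \<Sum>i\<in>insert a S. V i \<omega>) =
      distr (distr M (count_space UNIV) (\<lambda>\<omega>. (V a \<omega>, \<Sum>i\<in>S. V i \<omega>))) (count_space UNIV) (\<lambda>(x, y). x + y)"
    using insert.hyps m by (subst distr_distr) (auto simp: o_def)
  also have "\<dots> = measure_pmf (map_pmf (\<lambda>(x, y). x + y) (pair_pmf (q a) (map_pmf (\<lambda>g. \<Sum>i\<in>S. g i) (Pi_pmf S 0 q))))"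
    by (simp add: pair map_pmf_rep_eq)
  also have "map_pmf (\<lambda>(x, y). x + y) (pair_pmf (q a) (map_pmf (\<lambda>g. \<Sum>i\<in>S. g i) (Pi_pmf S 0 q))) =
      map_pmf (\<lambda>g. \<Sum>i\<in>insert a S. g i) (Pi_pmf (insert a S) 0 q)"
    using insert.hyps
    by (subst Pi_pmf_insert)
      (auto simp: pair_map_pmf2 pmf.map_comp o_def case_prod_unfold
        intro!: map_pmf_cong arg_cong2[where f = "(+)"] sum.cong)
  finally show ?case .
qed

text \<open>The population as a function of the offspring and immigration vectors, indexed as in
  \<^const>\<open>two_type_GWI\<close>.\<close>

primrec gwi_path :: "nat ^ 2 \<Rightarrow> nat \<Rightarrow> ((2 \<times> nat \<times> nat) + nat \<Rightarrow> nat ^ 2) \<Rightarrow> nat ^ 2" where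
  "gwi_path j 0 c = j"
| "gwi_path j (Suc n) c =
     (\<Sum>i\<in>UNIV. \<Sum>k<gwi_path j n c $ i. c (Inl (i, n, k))) + c (Inr (Suc n))"

text \<open>The indices of all vectors that can influence generation \<open>n\<close>: litters of
  earlier generations and immigrations up to \<open>n\<close>.\<close>

definition past :: "nat \<Rightarrow> ((2 \<times> nat \<times> nat) + nat) set" where
  "past n = {(i, m, k). m < n} <+> {1..n}"

lemma past_mono: "m \<le> n \<Longrightarrow> past m \<subseteq> past n"
  by (auto simp: past_def)

lemma gwi_path_cong:
  assumes "\<And>a. a \<in> past n \<Longrightarrow> c a = c' a"
  shows "gwi_path j n c = gwi_path j n c'"
  using assms
proof (induction n)
  case (Suc n)
  have "gwi_path j n c = gwi_path j n c'"
    using Suc.prems past_mono[of n "Suc n"] by (intro Suc.IH) auto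
  then show ?case
    by (auto simp: past_def intro!: sum.cong arg_cong2[where f = "(+)"] Suc.prems)
qed simp

lemma measurable_gwi_path:
  assumes "past n \<subseteq> A"
  shows "gwi_path j n \<in> measurable (PiM A (\<lambda>_. count_space UNIV)) (count_space UNIV)"
  using assms
proof (induction n)
  case (Suc n)
  have IH: "gwi_path j n \<in> measurable (PiM A (\<lambda>_. count_space UNIV)) (count_space UNIV)"
    using Suc past_mono[of n "Suc n"] by auto
  \<comment> \<open>The number of summands is random. For a fixed value \<open>x\<close> of
    generation \<open>n\<close> the index set is fixed, and countably many values are glued
    together.\<close>
  have "(\<lambda>c. (\<Sum>i\<in>UNIV. \<Sum>k<x $ i. c (Inl (i, n, k)) :: nat ^ 2) + c (Inr (Suc n)))
      \<in> measurable (PiM A (\<lambda>_. count_space UNIV)) (count_space UNIV)" for x :: "nat ^ 2"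
    using Suc.prems
    by (intro measurable_add_count_space measurable_sum_count_space measurable_component_singleton)
      (auto simp: past_def)
  from measurable_compose_countable[OF this IH] show ?case
    by simp
next
  case 0
  have "gwi_path j 0 = (\<lambda>_. j)"
    by (simp add: fun_eq_iff)
  then show ?case
    by simp
qed

text \<open>On the event that generation \<open>n\<close> equals \<open>x\<close>, the random sum
  for the next generation runs over a fixed index set, which is disjoint from \<open>past n\<close>.
  Hence the joint law is a product.\<close>

lemma two_type_GWI_markov:
  assumes "two_type_GWI \<Omega> p h X"
  shows "prob_space \<Omega>"
    and "X j n \<in> measurable \<Omega> (count_space UNIV)"
    and "distr \<Omega> (count_space UNIV) (X j n) = measure_pmf (gwi_law p h n j)"
    and "measure \<Omega> {\<omega>\<in>space \<Omega>. X j n \<omega> = x \<and> X j (Suc n) \<omega> = y} =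
      pmf (gwi_law p h n j) x * pmf (gwi_step p h x) y"
proof -
  show "prob_space \<Omega>"
    using assms by (simp add: two_type_GWI_def)
  then interpret prob_space \<Omega> .
  obtain \<xi> Im where
    ind: "indep_vars (\<lambda>_. count_space UNIV) (case_sum (\<lambda>(i, n, k). \<xi> i n k) Im) (UNIV <+> {1..})"
    and \<xi>: "\<And>i n k. distr \<Omega> (count_space UNIV) (\<xi> i n k) = measure_pmf (p i)"
    and Im: "\<And>n. n \<ge> 1 \<Longrightarrow> distr \<Omega> (count_space UNIV) (Im n) = measure_pmf h"
    and X0: "\<And>j \<omega>. \<omega> \<in> space \<Omega> \<Longrightarrow> X j 0 \<omega> = j"
    and XS: "\<And>j n \<omega>. \<omega> \<in> space \<Omega> \<Longrightarrow> X j (Suc n) \<omega> =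
        (\<Sum>i\<in>UNIV. \<Sum>k<X j n \<omega> $ i. \<xi> i n k \<omega>) + Im (Suc n) \<omega>"
    using assms unfolding two_type_GWI_def by blast
  define V where "V = case_sum (\<lambda>(i, n, k). \<xi> i n k) Im"
  have indV: "indep_vars (\<lambda>_. count_space UNIV) V (UNIV <+> {1..})"
    using ind by (simp add: V_def)
  have path: "X j n \<omega> = gwi_path j n (\<lambda>a. V a \<omega>)" if "\<omega> \<in> space \<Omega>" for j n \<omega>
    using that by (induction n) (simp_all add: X0 XS V_def)
  \<comment> \<open>The next generation as it would be if generation \<open>n\<close> were
    \<open>x\<close>.\<close>
  define Y where "Y n x \<omega> = (\<Sum>i\<in>UNIV. \<Sum>k<(x :: nat ^ 2) $ i. \<xi> i n k \<omega>) + Im (Suc n) \<omega>" for n x \<omega>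
  \<comment> \<open>Embeds the particles of generation \<open>n\<close> and the immigration with
    number \<open>Suc n\<close> into the index type of the joint family.\<close>
  define T where "T n = case_option (Inr (Suc n)) (\<lambda>(i :: 2, k :: nat). Inl (i, n :: nat, k))"
    for n :: nat
  have T_sub: "T n ` litter_index x \<subseteq> UNIV <+> {1..}" for n x
    by (auto simp: T_def litter_index_def)
  have T_inj: "inj_on (T n) B" for n B
    by (auto simp: T_def inj_on_def split: option.splits)
  have Y_T: "Y n x \<omega> = (\<Sum>a\<in>T n ` litter_index x. V a \<omega>)" for n x \<omega>
    by (subst sum.reindex[OF T_inj]) (simp add: sum_litter_index Y_def T_def V_def)
  define q where "q a = (case a of Inl (i, n, k) \<Rightarrow> p i | Inr n \<Rightarrow> h)"
    for a :: "(2 \<times> nat \<times> nat) + nat"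
  have V_law: "distr \<Omega> (count_space UNIV) (V a) = measure_pmf (q a)" if "a \<in> UNIV <+> {1..}" for a
    using that by (auto simp: V_def q_def \<xi> Im split: sum.splits)
  have Y_law: "distr \<Omega> (count_space UNIV) (Y n x) = measure_pmf (gwi_step p h x)" for n x
  proof -
    have "distr \<Omega> (count_space UNIV) (\<lambda>\<omega>. \<Sum>a\<in>litter_index x. V (T n a) \<omega>) =
      measure_pmf (map_pmf (\<lambda>g. \<Sum>i\<in>litter_index x. g i) (Pi_pmf (litter_index x) 0 (\<lambda>a. q (T n a))))"
    proof (rule distr_sum_indep_pmf)
      show "indep_vars (\<lambda>_. count_space UNIV) (\<lambda>a. V (T n a)) (litter_index x)"
        using indV T_sub[of n x] T_inj by (rule indep_vars_reindex)
    next
      fix a assume "a \<in> litter_index x"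
      then show "distr \<Omega> (count_space UNIV) (V (T n a)) = measure_pmf (q (T n a))"
        using V_law T_sub by blast
    qed simp
    also have "(\<lambda>a. q (T n a)) = case_option h (\<lambda>(i, k). p i)"
      by (auto simp: q_def T_def split: option.splits)
    also have "(\<lambda>\<omega>. \<Sum>a\<in>litter_index x. V (T n a) \<omega>) = Y n x"
      by (auto simp: Y_T sum.reindex[OF T_inj])
    finally show ?thesis
      by (simp add: gwi_step_def)
  qed
  \<comment> \<open>\<open>past n\<close> has only litters of generations below \<open>n\<close> and
    immigrations up to \<open>n\<close>, so the range of \<open>T n\<close> never meets it.\<close>
  have indXY: "indep_var (count_space UNIV) (\<lambda>\<omega>. gwi_path j n (\<lambda>a. V a \<omega>)) (count_space UNIV) (Y n x)" for j n x
  proof -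
    have "indep_var (count_space UNIV) (gwi_path j n \<circ> (\<lambda>\<omega>. restrict (\<lambda>a. V a \<omega>) (past n)))
      (count_space UNIV) ((\<lambda>g. \<Sum>a\<in>T n ` litter_index x. g a) \<circ> (\<lambda>\<omega>. restrict (\<lambda>a. V a \<omega>) (T n ` litter_index x)))"
      by (intro indep_var_compose[OF indep_var_restrict[OF indV]] measurable_gwi_path T_sub
          measurable_sum_count_space measurable_component_singleton)
        (auto simp: past_def T_def split: option.splits)
    also have "gwi_path j n \<circ> (\<lambda>\<omega>. restrict (\<lambda>a. V a \<omega>) (past n)) = (\<lambda>\<omega>. gwi_path j n (\<lambda>a. V a \<omega>))"
      by (auto simp: fun_eq_iff intro!: gwi_path_cong)
    also have "(\<lambda>g. \<Sum>a\<in>T n ` litter_index x. g a) \<circ> (\<lambda>\<omega>. restrict (\<lambda>a. V a \<omega>) (T n ` litter_index x)) = Y n x"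
      by (auto simp: fun_eq_iff Y_T)
    finally show ?thesis .
  qed
  have mX: "random_variable (count_space UNIV) (X j n)" for j n
  proof -
    have "random_variable (count_space UNIV) (\<lambda>\<omega>. gwi_path j n (\<lambda>a. V a \<omega>))"
      using indXY by (rule indep_var_rv1)
    then show ?thesis
      by (subst measurable_cong[OF path])
  qed
  then show "random_variable (count_space UNIV) (X j n)" .
  \<comment> \<open>Stated for whatever law generation \<open>n\<close> has, so that it can feed the
    induction that identifies this law.\<close>
  have joint: "prob {\<omega>\<in>space \<Omega>. X j n \<omega> = x \<and> X j (Suc n) \<omega> = y} =
      pmf a x * pmf (gwi_step p h x) y"
    if law: "distr \<Omega> (count_space UNIV) (X j n) = measure_pmf a" for a j n x y
  proof -
    have law': "distr \<Omega> (count_space UNIV) (\<lambda>\<omega>. gwi_path j n (\<lambda>a. V a \<omega>)) = measure_pmf a"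
      using law by (subst (asm) distr_cong[OF refl refl path]) auto
    have "{\<omega>\<in>space \<Omega>. X j n \<omega> = x \<and> X j (Suc n) \<omega> = y} =
        {\<omega>\<in>space \<Omega>. gwi_path j n (\<lambda>a. V a \<omega>) = x \<and> Y n x \<omega> = y}"
      by (auto simp: path[symmetric] XS Y_def)
    then show ?thesis
      using indep_var_joint_pmf[OF indXY law' Y_law] by simp
  qed
  have "distr \<Omega> (count_space UNIV) (X j n) = measure_pmf (gwi_law p h n j)" for n
  proof (induction n)
    case 0
    have "{\<omega>\<in>space \<Omega>. X j 0 \<omega> = x} = (if x = j then space \<Omega> else {})" for x
      by (auto simp: X0)
    then show ?case
      by (intro distr_eq_pmfI[OF mX]) (auto simp: prob_space)
  next
    case (Suc n)
    show ?case
    proof (rule distr_eq_pmfI[OF mX])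
      fix y
      have [measurable]: "random_variable (count_space UNIV) (X j n)"
          "random_variable (count_space UNIV) (X j (Suc n))"
        by (rule mX)+
      have "emeasure \<Omega> {\<omega>\<in>space \<Omega>. X j (Suc n) \<omega> = y} =
        (\<integral>\<^sup>+x. emeasure \<Omega> {\<omega>\<in>space \<Omega>. X j n \<omega> = x \<and> X j (Suc n) \<omega> = y} \<partial>count_space UNIV)"
      proof -
        have "{\<omega>\<in>space \<Omega>. X j (Suc n) \<omega> = y} =
            (\<Union>x. {\<omega>\<in>space \<Omega>. X j n \<omega> = x \<and> X j (Suc n) \<omega> = y})"
          by auto
        then show ?thesis
          by (simp only:) (rule emeasure_UN_countable, auto simp: disjoint_family_on_def)
      qed
      also have "\<dots> = (\<integral>\<^sup>+x. ennreal (pmf (gwi_law p h n j) x) * ennreal (pmf (gwi_step p h x) y) \<partial>count_space UNIV)"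
        by (simp add: emeasure_eq_measure joint[OF Suc] ennreal_mult')
      also have "\<dots> = ennreal (pmf (gwi_law p h (Suc n) j) y)"
        by (simp add: ennreal_pmf_bind nn_integral_measure_pmf)
      finally show "prob {\<omega>\<in>space \<Omega>. X j (Suc n) \<omega> = y} = pmf (gwi_law p h (Suc n) j) y"
        by (simp add: emeasure_eq_measure)
    qed
  qed
  then show law: "distr \<Omega> (count_space UNIV) (X j n) = measure_pmf (gwi_law p h n j)" .
  show "prob {\<omega>\<in>space \<Omega>. X j n \<omega> = x \<and> X j (Suc n) \<omega> = y} =
      pmf (gwi_law p h n j) x * pmf (gwi_step p h x) y"
    by (rule joint[OF law])
qed

section \<open>Generating functions\<close>

definition popsize :: "nat ^ 2 \<Rightarrow> nat" where
  "popsize x = (\<Sum>k\<in>UNIV. x $ k)"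

definition monom_at :: "real ^ 2 \<Rightarrow> nat ^ 2 \<Rightarrow> real" where
  "monom_at s y = (\<Prod>k\<in>UNIV. (s $ k) ^ (y $ k))"

text \<open>An expectation instead of a series on the unit square: it is also evaluated at points
  with coordinates above one, where it gives exponential moments. On the unit square it agrees with
  \<open>offspring_gf\<close>.\<close>

definition pgf :: "(nat ^ 2) pmf \<Rightarrow> real ^ 2 \<Rightarrow> real" where
  "pgf q s = measure_pmf.expectation q (monom_at s)"

definition unit_square :: "(real ^ 2) set" where
  "unit_square = {s. \<forall>k. 0 \<le> s $ k \<and> s $ k \<le> 1}"

lemma popsize_add: "popsize (x + y) = popsize x + popsize y"
  by (simp add: popsize_def sum.distrib)

lemma popsize_0 [simp]: "popsize 0 = 0"
  by (simp add: popsize_def)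

lemma popsize_sum: "popsize (\<Sum>a\<in>S. g a) = (\<Sum>a\<in>S. popsize (g a))"
  by (induction S rule: infinite_finite_induct) (auto simp: popsize_add)

lemma popsize_eq_0_iff [simp]: "popsize x = 0 \<longleftrightarrow> x = 0"
  by (auto simp: popsize_def vec_eq_iff)

lemma popsize_axis [simp]: "popsize (axis i n) = n"
  by (simp add: popsize_def axis_def)

lemma popsize_eq_1_iff: "popsize x = 1 \<longleftrightarrow> (\<exists>i. x = axis i 1)"
proof
  assume "popsize x = 1"
  then have "x $ 1 + x $ 2 = 1"
    by (simp add: popsize_def UNIV_2)
  then have "x = axis 1 1 \<or> x = axis 2 1"
    by (auto simp: vec_eq_iff forall_2 axis_def)
  then show "\<exists>i. x = axis i 1"
    by blast
qed auto

lemma monom_at_0 [simp]: "monom_at s 0 = 1"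
  by (simp add: monom_at_def)

lemma monom_at_add: "monom_at s (x + y) = monom_at s x * monom_at s y"
  by (simp add: monom_at_def power_add prod.distrib)

lemma monom_at_sum: "monom_at s (\<Sum>a\<in>S. g a) = (\<Prod>a\<in>S. monom_at s (g a))"
  by (induction S rule: infinite_finite_induct) (auto simp: monom_at_add)

lemma monom_at_nonneg: "(\<And>k. 0 \<le> s $ k) \<Longrightarrow> 0 \<le> monom_at s y"
  by (auto simp: monom_at_def intro!: prod_nonneg)

lemma monom_at_axis [simp]: "monom_at s (axis i n) = s $ i ^ n"
  by (simp add: monom_at_def axis_def if_distrib[of "\<lambda>n. _ ^ n"] cong: if_cong)

lemma monom_at_le_power:
  assumes "\<And>k. 0 \<le> s $ k" "\<And>k. s $ k \<le> Y"
  shows "monom_at s x \<le> Y ^ popsize x"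
  unfolding monom_at_def popsize_def power_sum
  using assms by (intro prod_mono) (auto intro: power_mono)

lemma monom_at_le_1: "s \<in> unit_square \<Longrightarrow> monom_at s x \<le> 1"
  using monom_at_le_power[of s 1 x] by (auto simp: unit_square_def)

lemma monom_at_unit_square: "s \<in> unit_square \<Longrightarrow> 0 \<le> monom_at s x"
  by (auto simp: unit_square_def intro: monom_at_nonneg)

lemma monom_at_const: "monom_at (\<chi> k. \<sigma>) x = \<sigma> ^ popsize x"
  by (simp add: monom_at_def popsize_def power_sum)

lemma integrable_monom_at: "s \<in> unit_square \<Longrightarrow> integrable (measure_pmf q) (monom_at s)"
  by (rule measure_pmf.integrable_const_bound[where B = 1])
    (auto simp: monom_at_le_1 monom_at_unit_square)

lemma pgf_nonneg: "s \<in> unit_square \<Longrightarrow> 0 \<le> pgf q s"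
  by (auto simp: pgf_def monom_at_unit_square intro!: integral_nonneg_AE)

lemma pgf_le_1: "s \<in> unit_square \<Longrightarrow> pgf q s \<le> 1"
  unfolding pgf_def
  by (rule measure_pmf.integral_le_const) (auto simp: monom_at_le_1 integrable_monom_at)

text \<open>The branching property: independence turns the sum of the litters into a product with
  one factor per particle. Integrability is assumed instead of \<open>s\<close> lying in the unit
  square because Chernoff's bound uses coordinates above one.\<close>

lemma
  assumes "\<And>k. 0 \<le> s $ k" "\<And>i. integrable (measure_pmf (p i)) (monom_at s)"
    and "integrable (measure_pmf h) (monom_at s)"
  shows integrable_gwi_step_monom: "integrable (measure_pmf (gwi_step p h x)) (monom_at s)"
    and pgf_gwi_step: "pgf (gwi_step p h x) s = monom_at (\<chi> i. pgf (p i) s) x * pgf h s"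
proof -
  let ?q = "case_option h (\<lambda>(i, k :: nat). p i)"
  have int: "integrable (measure_pmf (?q a)) (monom_at s)" for a
    using assms(2,3) by (auto split: option.split)
  have "integrable (measure_pmf (Pi_pmf (litter_index x) 0 ?q)) (\<lambda>g. \<Prod>a\<in>litter_index x. monom_at s (g a))"
    using int by (intro integrable_prod_Pi_pmf) auto
  then show "integrable (measure_pmf (gwi_step p h x)) (monom_at s)"
    by (simp add: gwi_step_def monom_at_sum)
  have "pgf (gwi_step p h x) s =
      measure_pmf.expectation (Pi_pmf (litter_index x) 0 ?q) (\<lambda>g. \<Prod>a\<in>litter_index x. monom_at s (g a))"
    by (simp add: gwi_step_def monom_at_sum pgf_def)
  also have "\<dots> = (\<Prod>a\<in>litter_index x. pgf (?q a) s)"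
    unfolding pgf_def using int assms(1) by (intro expectation_prod_Pi_pmf) (auto simp: monom_at_nonneg)
  also have "\<dots> = monom_at (\<chi> i. pgf (p i) s) x * pgf h s"
    by (simp add: prod_litter_index monom_at_def)
  finally show "pgf (gwi_step p h x) s = monom_at (\<chi> i. pgf (p i) s) x * pgf h s" .
qed

lemma expectation_bind_bounded:
  fixes g :: "'b \<Rightarrow> real" and q :: "'a pmf" and r :: "'a \<Rightarrow> 'b pmf"
  assumes "\<And>y. \<bar>g y\<bar> \<le> B"
  shows "measure_pmf.expectation (bind_pmf q r) g =
    measure_pmf.expectation q (\<lambda>x. measure_pmf.expectation (r x) g)"
  unfolding measure_pmf_bind using assms
  by (intro integral_bind[where B = B and B' = 1 and K = "count_space UNIV"])
     (auto simp: measure_pmf.emeasure_space_1 subset_iff space_subprob_algebra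
        intro!: measurable_measure_pmf measure_pmf.subprob_space_axioms)

lemma prob_bind_pmf:
  "measure_pmf.prob (bind_pmf q r) S = measure_pmf.expectation q (\<lambda>x. measure_pmf.prob (r x) S)"
  using expectation_bind_bounded[of "indicator S :: _ \<Rightarrow> real" 1 q r] by (simp add: indicator_abs_le_1)

section \<open>Processes in which every particle leaves offspring\<close>

locale growing_gwi =
  fixes p :: "2 \<Rightarrow> (nat ^ 2) pmf" and h :: "(nat ^ 2) pmf"
  assumes p_0: "pmf (p i) 0 = 0"
begin

abbreviation "step \<equiv> gwi_step p h"
abbreviation "law \<equiv> gwi_law p h"

definition pgf_vec :: "real ^ 2 \<Rightarrow> real ^ 2" where
  "pgf_vec s = (\<chi> i. pgf (p i) s)"

lemma popsize_ge_1: "y \<in> set_pmf (p i) \<Longrightarrow> 1 \<le> popsize y"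
  using p_0[of i] popsize_eq_0_iff[of y] by (metis pmf_eq_0_set_pmf less_one not_le)

lemma popsize_step:
  assumes "y \<in> set_pmf (step x)"
  shows "popsize x \<le> popsize y"
proof -
  obtain g where g: "g \<in> set_pmf (Pi_pmf (litter_index x) 0 (case_option h (\<lambda>(i, k). p i)))"
    and y: "y = (\<Sum>a\<in>litter_index x. g a)"
    using assms by (auto simp: gwi_step_def)
  have "g (Some (i, k)) \<in> set_pmf (p i)" if "k < x $ i" for i k
  proof -
    have "Some (i, k) \<in> litter_index x"
      using that by (auto simp: litter_index_def)
    with g have "g (Some (i, k)) \<in> set_pmf (case_option h (\<lambda>(i, k). p i) (Some (i, k)))"
      by (simp add: set_Pi_pmf PiE_dflt_def del: option.case)
    then show ?thesis
      by simp
  qed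
  then have "1 \<le> popsize (g (Some (i, k)))" if "k < x $ i" for i k
    using that popsize_ge_1 by blast
  then have "(\<Sum>i\<in>UNIV. \<Sum>k<x $ i. 1) \<le> (\<Sum>i\<in>UNIV. \<Sum>k<x $ i. popsize (g (Some (i, k))))"
    by (intro sum_mono) auto
  then show ?thesis
    by (simp add: y sum_litter_index popsize_add popsize_sum) (simp add: popsize_def)
qed

lemma popsize_law: "y \<in> set_pmf (law n x) \<Longrightarrow> popsize x \<le> popsize y"
  by (induction n arbitrary: y) (auto dest: popsize_step intro: order_trans)

lemma gwi_step_axis: "step (axis i 1) = map_pmf (\<lambda>(y, x). y + x) (pair_pmf h (p i))"
proof -
  have L: "litter_index (axis i 1) = {None, Some (i, 0)}"
    by (auto simp: litter_index_def axis_def split: if_splits)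
  show ?thesis
    by (simp add: gwi_step_def L Pi_pmf_insert Pi_pmf_singleton pmf.map_comp o_def
        pair_map_pmf2 case_prod_unfold del: One_nat_def)
qed

text \<open>Sizes add up and the litter has size at least one, so a total of one leaves no room for
  an immigrant. This is where the factor \<open>pmf h 0\<close> joins the entries of A.\<close>

lemma pmf_step_axis: "pmf (step (axis i 1)) (axis j 1) = pmf h 0 * pmf (p i) (axis j 1)"
proof -
  let ?e = "axis j 1 :: nat ^ 2"
  have "pmf (step (axis i 1)) ?e = measure_pmf.prob (pair_pmf h (p i)) ((\<lambda>(y, x). y + x) -` {?e})"
    by (simp add: gwi_step_axis pmf_map del: One_nat_def)
  also have "\<dots> = measure_pmf.prob (pair_pmf h (p i)) ((\<lambda>(y, x). y + x) -` {?e} \<inter> set_pmf (pair_pmf h (p i)))"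
    by (rule measure_Int_set_pmf[symmetric])
  also have "(\<lambda>(y, x). y + x) -` {?e} \<inter> set_pmf (pair_pmf h (p i)) = {(0, ?e)} \<inter> set_pmf (pair_pmf h (p i))"
  proof -
    have "y = 0 \<and> x = ?e" if "y + x = ?e" "x \<in> set_pmf (p i)" for x y
    proof -
      have "popsize y + popsize x = 1"
        using arg_cong[OF that(1), of popsize] by (simp add: popsize_add)
      with popsize_ge_1[OF that(2)] have "popsize y = 0"
        by linarith
      then have "y = 0"
        by simp
      with that(1) show ?thesis
        by simp
    qed
    then show ?thesis
      by auto
  qed
  also have "measure_pmf.prob (pair_pmf h (p i)) \<dots> = pmf (pair_pmf h (p i)) (0, ?e)"
    by (subst measure_Int_set_pmf) (simp add: measure_pmf_single)
  finally show ?thesis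
    by (simp add: pmf_pair)
qed

lemma pgf_vec_unit_square: "s \<in> unit_square \<Longrightarrow> pgf_vec s \<in> unit_square"
  by (auto simp: unit_square_def pgf_vec_def intro!: pgf_nonneg pgf_le_1)

lemma pgf_vec_iterate_unit_square: "s \<in> unit_square \<Longrightarrow> (pgf_vec ^^ n) s \<in> unit_square"
  by (induction n) (auto simp: pgf_vec_unit_square)

text \<open>The last step is averaged first: it replaces \<open>s\<close> by
  \<open>pgf_vec s\<close> at the cost of a factor \<open>pgf h s\<close>, which is why the
  induction varies \<open>s\<close>.\<close>

lemma pgf_law:
  assumes "s \<in> unit_square"
  shows "pgf (law n x) s = monom_at ((pgf_vec ^^ n) s) x * (\<Prod>k<n. pgf h ((pgf_vec ^^ k) s))"
  using assms
proof (induction n arbitrary: s)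
  case 0
  show ?case
    by (simp add: pgf_def)
next
  case (Suc n)
  have "pgf (law (Suc n) x) s = measure_pmf.expectation (law n x) (\<lambda>y. pgf (step y) s)"
    unfolding pgf_def gwi_law.simps using Suc.prems
    by (intro expectation_bind_bounded[where B = 1]) (auto simp: monom_at_le_1 monom_at_unit_square)
  also have "\<dots> = measure_pmf.expectation (law n x) (\<lambda>y. monom_at (pgf_vec s) y * pgf h s)"
    using Suc.prems by (subst pgf_gwi_step) (auto simp: unit_square_def pgf_vec_def integrable_monom_at)
  also have "\<dots> = pgf (law n x) (pgf_vec s) * pgf h s"
    by (simp add: pgf_def)
  finally show ?case
    using Suc.IH[OF pgf_vec_unit_square[OF Suc.prems]]
    by (simp add: prod.lessThan_Suc_shift funpow_swap1 o_def mult_ac del: prod.lessThan_Suc gwi_law.simps)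
qed

end

section \<open>Decay of the generating functions\<close>

text \<open>The product satisfies the recursion with equality, so it is enough to insert it as a
  bound for all earlier terms.\<close>

lemma discrete_gronwall:
  fixes z Y :: "nat \<Rightarrow> real"
  assumes z: "\<And>n. z n \<le> C + D * (\<Sum>k<n. Y k * z k)"
    and Y: "\<And>k. 0 \<le> Y k" and D: "0 \<le> D"
  shows "z n \<le> C * (\<Prod>k<n. 1 + D * Y k)"
proof (induction n rule: less_induct)
  case (less n)
  have "z n \<le> C + D * (\<Sum>k<n. Y k * (C * (\<Prod>l<k. 1 + D * Y l)))"
    by (rule order_trans[OF z], intro add_left_mono mult_left_mono sum_mono less Y D) simp
  also have "\<dots> = C * (\<Prod>k<n. 1 + D * Y k)"
    by (induction n) (simp_all add: algebra_simps)
  finally show ?case .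
qed

lemma prod_1_plus_le_exp:
  fixes a :: "'a \<Rightarrow> real"
  assumes "\<And>k. k \<in> S \<Longrightarrow> 0 \<le> a k"
  shows "(\<Prod>k\<in>S. 1 + a k) \<le> exp (\<Sum>k\<in>S. a k)"
proof (cases "finite S")
  case True
  have "(\<Prod>k\<in>S. 1 + a k) \<le> (\<Prod>k\<in>S. exp (a k))"
    using assms by (intro prod_mono) auto
  then show ?thesis
    using True by (simp add: exp_sum)
qed simp

text \<open>The sum S of the first \<open>n\<close> terms satisfies S \<le> m + \<kappa> S: the
  first \<open>m\<close> terms are at most one each, and the terms shifted by \<open>m\<close> are
  bounded by \<kappa> times the original ones.\<close>

lemma sum_bounded_of_geometric_blocks:
  fixes Y :: "nat \<Rightarrow> real"
  assumes Y: "\<And>n. 0 \<le> Y n" "\<And>n. Y n \<le> 1" and step: "\<And>n. Y (n + m) \<le> \<kappa> * Y n"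
    and \<kappa>: "0 \<le> \<kappa>" "\<kappa> < 1"
  shows "(\<Sum>k<n. Y k) \<le> m / (1 - \<kappa>)"
proof -
  have "(\<Sum>k<n. Y k) \<le> (\<Sum>k<m + n. Y k)"
    using Y by (intro sum_mono2) auto
  also have "\<dots> = (\<Sum>k<m. Y k) + (\<Sum>k<n. Y (k + m))"
    by (induction n) (simp_all add: add_ac)
  also have "(\<Sum>k<m. Y k) \<le> real m"
    using sum_bounded_above[of "{..<m}" Y 1] Y by simp
  also have "(\<Sum>k<n. Y (k + m)) \<le> \<kappa> * (\<Sum>k<n. Y k)"
    unfolding sum_distrib_left by (intro sum_mono step)
  finally show ?thesis
    using \<kappa> by (simp add: field_simps)
qed

context growing_gwi
begin

text \<open>The matrix A of the theorem, read as the chances of leaving exactly one child, of a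
  given type; \<open>deriv_matrix_0_eq\<close> identifies the two.\<close>

definition single_matrix :: "real ^ 2 ^ 2" where
  "single_matrix = (\<chi> i j. pmf (p i) (axis j 1))"

text \<open>The chance that a particle of type \<open>i\<close> has exactly one descendant after
  \<open>n\<close> generations without immigration.\<close>

definition row_sum :: "nat \<Rightarrow> 2 \<Rightarrow> real" where
  "row_sum n i = (\<Sum>j\<in>UNIV. mat_power single_matrix n $ i $ j)"

lemma row_sum_0 [simp]: "row_sum 0 i = 1"
  by (simp add: row_sum_def mat_def)

lemma row_sum_Suc: "row_sum (Suc n) i = (\<Sum>k\<in>UNIV. single_matrix $ i $ k * row_sum n k)"
  by (simp add: row_sum_def matrix_matrix_mult_def sum_2 algebra_simps)

lemma single_matrix_nonneg: "0 \<le> single_matrix $ i $ j"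
  by (simp add: single_matrix_def)

lemma single_matrix_row_eq:
  "(\<Sum>j\<in>UNIV. single_matrix $ i $ j) = measure_pmf.prob (p i) {y. popsize y = 1}"
proof -
  have "{y. popsize y = 1} = range (\<lambda>j :: 2. axis j 1)"
    by (auto simp: popsize_eq_1_iff simp del: One_nat_def)
  moreover have "inj (\<lambda>j :: 2. axis j (1 :: nat))"
    by (auto simp: inj_on_def axis_eq_axis)
  ultimately show ?thesis
    by (simp add: measure_measure_pmf_finite sum.reindex single_matrix_def del: One_nat_def)
qed

lemma row_sum_le_1: "row_sum n i \<le> 1"
proof (induction n arbitrary: i)
  case (Suc n)
  have "row_sum (Suc n) i \<le> (\<Sum>k\<in>UNIV. single_matrix $ i $ k * 1)"
    unfolding row_sum_Suc by (intro sum_mono mult_left_mono Suc single_matrix_nonneg)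
  also have "\<dots> \<le> 1"
    by (simp add: single_matrix_row_eq del: One_nat_def)
  finally show ?case .
qed simp

text \<open>A litter of size one contributes the linear part, and a larger litter at most \<open>Y\<^sup>2\<close>.\<close>

lemma pgf_le_linear:
  assumes s: "\<And>k. 0 \<le> s $ k" "\<And>k. s $ k \<le> Y" and Y: "Y \<le> 1"
  shows "pgf (p i) s \<le> (\<Sum>j\<in>UNIV. single_matrix $ i $ j * s $ j) + (1 - (\<Sum>j\<in>UNIV. single_matrix $ i $ j)) * Y\<^sup>2"
proof -
  have sq: "s \<in> unit_square"
    using s Y by (auto simp: unit_square_def intro: order_trans)
  have Y0: "0 \<le> Y"
    using s[of 1] by linarith
  let ?S = "{y :: nat ^ 2. popsize y = 1}"
  \<comment> \<open>On vectors of size one the value \<open>Y\<^sup>2\<close> is corrected to the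
    monomial itself. Writing the correction as a sum over the unit vectors makes its expectation a
    combination of entries of \<open>single_matrix\<close>.\<close>
  have eq: "(\<Sum>j\<in>UNIV. (s $ j - Y\<^sup>2) * indicator {axis j 1} y) = (monom_at s y - Y\<^sup>2) * indicator ?S y" for y
  proof (cases "popsize y = 1")
    case True
    then obtain j where j: "y = axis j 1"
      using popsize_eq_1_iff by blast
    have "(\<Sum>k\<in>UNIV. (s $ k - Y\<^sup>2) * indicator {axis k (1 :: nat)} y) = (\<Sum>k\<in>UNIV. if k = j then s $ k - Y\<^sup>2 else 0)"
      by (intro sum.cong) (auto simp: j axis_eq_axis simp del: One_nat_def)
    then show ?thesis
      by (simp add: j)
  next
    case False
    then have "y \<noteq> axis j 1" for j
      by auto
    then show ?thesis
      using False by simp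
  qed
  have "pgf (p i) s \<le> measure_pmf.expectation (p i) (\<lambda>y. Y\<^sup>2 + (\<Sum>j\<in>UNIV. (s $ j - Y\<^sup>2) * indicator {axis j 1} y))"
    unfolding pgf_def
  proof (rule integral_mono_AE)
    show "AE y in measure_pmf (p i). monom_at s y \<le> Y\<^sup>2 + (\<Sum>j\<in>UNIV. (s $ j - Y\<^sup>2) * indicator {axis j 1} y)"
    proof (rule AE_pmfI)
      fix y assume y: "y \<in> set_pmf (p i)"
      show "monom_at s y \<le> Y\<^sup>2 + (\<Sum>j\<in>UNIV. (s $ j - Y\<^sup>2) * indicator {axis j 1} y)"
      proof (cases "popsize y = 1")
        case False
        with popsize_ge_1[OF y] have "2 \<le> popsize y"
          by simp
        then have "Y ^ popsize y \<le> Y\<^sup>2"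
          using Y Y0 by (intro power_decreasing) auto
        then show ?thesis
          using monom_at_le_power[OF s, of y] False unfolding eq by simp
      next
        case True
        then show ?thesis
          unfolding eq by simp
      qed
    qed
    show "integrable (measure_pmf (p i)) (\<lambda>y. Y\<^sup>2 + (\<Sum>j\<in>UNIV. (s $ j - Y\<^sup>2) * indicator {axis j 1} y))"
      by (intro Bochner_Integration.integrable_add Bochner_Integration.integrable_sum
          integrable_mult_right integrable_real_indicator measure_pmf.integrable_const)
        (simp_all add: measure_pmf.emeasure_eq_measure)
  qed (rule integrable_monom_at[OF sq])
  also have "\<dots> = Y\<^sup>2 + (\<Sum>j\<in>UNIV. (s $ j - Y\<^sup>2) * single_matrix $ i $ j)"
  proof -
    let ?t = "\<lambda>j y. (s $ j - Y\<^sup>2) * indicator {axis j (1 :: nat)} y"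
    have int: "integrable (measure_pmf (p i)) (?t j)" for j
      by (intro integrable_mult_right integrable_real_indicator)
        (simp_all add: measure_pmf.emeasure_eq_measure)
    have "measure_pmf.prob (p i) {axis j 1} = single_matrix $ i $ j" for j
      by (simp add: measure_pmf_single single_matrix_def del: One_nat_def)
    with int show ?thesis
      by (simp only: sum_2) simp
  qed
  also have "\<dots> = (\<Sum>j\<in>UNIV. single_matrix $ i $ j * s $ j) + (1 - (\<Sum>j\<in>UNIV. single_matrix $ i $ j)) * Y\<^sup>2"
    by (simp add: sum_2 algebra_simps)
  finally show ?thesis .
qed

text \<open>The bound is \<open>Y * r + Y\<^sup>2 * (1 - r)\<close> with
  \<open>r = row_sum n i\<close>: with chance \<open>r\<close> a single descendant is left, and
  otherwise at least two are. As it cannot fall below \<open>Y\<^sup>2\<close>, it serves only to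
  contract over blocks of generations.\<close>

lemma pgf_vec_iterate_le:
  assumes s: "\<And>k. 0 \<le> s $ k" "\<And>k. s $ k \<le> Y" and Y: "Y \<le> 1"
  shows "(pgf_vec ^^ n) s $ i \<le> Y * (Y + (1 - Y) * row_sum n i)"
proof (induction n arbitrary: i)
  case 0
  show ?case
    using s by simp
next
  case (Suc n)
  let ?y = "(pgf_vec ^^ n) s"
  have Y0: "0 \<le> Y"
    using s[of 1] by linarith
  have sq: "s \<in> unit_square"
    using s Y by (auto simp: unit_square_def intro: order_trans)
  have y0: "0 \<le> ?y $ k" for k
    using pgf_vec_iterate_unit_square[OF sq] by (auto simp: unit_square_def)
  have yY: "?y $ k \<le> Y" for k
  proof -
    have "Y + (1 - Y) * row_sum n k \<le> 1"
      using mult_left_mono[OF row_sum_le_1, of "1 - Y" n k] Y by simp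
    then have "Y * (Y + (1 - Y) * row_sum n k) \<le> Y * 1"
      using Y0 by (rule mult_left_mono)
    then show ?thesis
      using Suc[of k] by simp
  qed
  have "(pgf_vec ^^ Suc n) s $ i \<le> (\<Sum>j\<in>UNIV. single_matrix $ i $ j * ?y $ j) + (1 - (\<Sum>j\<in>UNIV. single_matrix $ i $ j)) * Y\<^sup>2"
    using pgf_le_linear[OF y0 yY Y, of i] by (simp add: pgf_vec_def)
  also have "(\<Sum>j\<in>UNIV. single_matrix $ i $ j * ?y $ j) \<le>
      (\<Sum>j\<in>UNIV. single_matrix $ i $ j * (Y * (Y + (1 - Y) * row_sum n j)))"
    by (intro sum_mono mult_left_mono Suc single_matrix_nonneg)
  also have "\<dots> = Y\<^sup>2 * (\<Sum>j\<in>UNIV. single_matrix $ i $ j) + Y * (1 - Y) * row_sum (Suc n) i"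
    by (simp add: row_sum_Suc sum_2 algebra_simps power2_eq_square)
  finally show ?case
    by (simp add: algebra_simps power2_eq_square)
qed

text \<open>The linear part is iterated exactly. The quadratic error made at generation
  \<open>k\<close> is carried through the remaining \<open>n - 1 - k\<close> generations by the
  matrix, which gives a convolution fit for \<open>discrete_gronwall\<close>.\<close>

lemma pgf_vec_iterate_le_linear:
  assumes s: "\<And>k. 0 \<le> s $ k" "\<And>k. s $ k \<le> 1"
    and Y: "\<And>n k. (pgf_vec ^^ n) s $ k \<le> Y n" "\<And>n. Y n \<le> 1"
  shows "(pgf_vec ^^ n) s $ i \<le> row_sum n i + (\<Sum>k<n. row_sum (n - 1 - k) i * (Y k)\<^sup>2)"
proof (induction n arbitrary: i)
  case 0
  show ?case
    using s by simp
next
  case (Suc n)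
  let ?y = "(pgf_vec ^^ n) s"
  have sq: "s \<in> unit_square"
    using s by (auto simp: unit_square_def)
  have y0: "0 \<le> ?y $ k" for k
    using pgf_vec_iterate_unit_square[OF sq] by (auto simp: unit_square_def)
  have "(pgf_vec ^^ Suc n) s $ i \<le> (\<Sum>j\<in>UNIV. single_matrix $ i $ j * ?y $ j) + (1 - (\<Sum>j\<in>UNIV. single_matrix $ i $ j)) * (Y n)\<^sup>2"
    using pgf_le_linear[OF y0 Y(1) Y(2), of i] by (simp add: pgf_vec_def)
  also have "(1 - (\<Sum>j\<in>UNIV. single_matrix $ i $ j)) * (Y n)\<^sup>2 \<le> 1 * (Y n)\<^sup>2"
    by (intro mult_right_mono) (auto intro!: sum_nonneg single_matrix_nonneg)
  also have "(\<Sum>j\<in>UNIV. single_matrix $ i $ j * ?y $ j) \<le>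
      (\<Sum>j\<in>UNIV. single_matrix $ i $ j * (row_sum n j + (\<Sum>k<n. row_sum (n - 1 - k) j * (Y k)\<^sup>2)))"
    by (intro sum_mono mult_left_mono Suc single_matrix_nonneg)
  also have "\<dots> = row_sum (Suc n) i + (\<Sum>k<n. row_sum (Suc (n - 1 - k)) i * (Y k)\<^sup>2)"
    by (simp add: row_sum_Suc sum_2 algebra_simps sum.distrib sum_distrib_left)
  also have "(\<Sum>k<n. row_sum (Suc (n - 1 - k)) i * (Y k)\<^sup>2) = (\<Sum>k<n. row_sum (n - k) i * (Y k)\<^sup>2)"
    by (intro sum.cong) (auto simp: Suc_diff_Suc)
  finally show ?case
    by simp
qed

lemma pgf_immigration_le:
  assumes "\<And>k. 0 \<le> s $ k" "\<And>k. s $ k \<le> Y" and Y: "Y \<le> 1"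
  shows "pgf h s \<le> pmf h 0 + Y"
proof -
  have sq: "s \<in> unit_square"
    using assms by (auto simp: unit_square_def intro: order_trans)
  have Y0: "0 \<le> Y"
    using assms(1,2)[of 1] by linarith
  have "pgf h s \<le> measure_pmf.expectation h (\<lambda>y. indicator {0} y + Y)"
    unfolding pgf_def
  proof (rule integral_mono)
    fix y
    show "monom_at s y \<le> indicator {0} y + Y"
    proof (cases "y = 0")
      case False
      then have "Y ^ popsize y \<le> Y ^ 1"
        using Y Y0 by (intro power_decreasing) (auto simp: Suc_le_eq simp flip: neq0_conv)
      then show ?thesis
        using monom_at_le_power[OF assms(1,2), of y] False by simp
    qed (use Y0 in simp)
  qed (auto intro!: integrable_monom_at sq
      simp: measure_pmf.emeasure_eq_measure)
  also have "\<dots> = pmf h 0 + Y"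
    by (subst Bochner_Integration.integral_add)
      (auto simp: measure_pmf_single measure_pmf.emeasure_eq_measure intro!: integrable_real_indicator)
  finally show ?thesis .
qed

proposition pgf_law_bound:
  assumes \<gamma>: "0 < \<gamma>" "\<gamma> < 1" and rows: "\<And>n i. row_sum n i \<le> C\<^sub>0 * \<gamma> ^ n"
    and h0: "pmf h 0 > 0" and \<sigma>: "0 < \<sigma>" "\<sigma> < 1"
  obtains C where "C > 0"
    "\<And>n x. x \<noteq> 0 \<Longrightarrow> pgf (law n x) (\<chi> k. \<sigma>) \<le> C * (pmf h 0 * \<gamma>) ^ n"
    "\<And>n x. 2 \<le> popsize x \<Longrightarrow> pgf (law n x) (\<chi> k. \<sigma>) \<le> C * (pmf h 0 * \<gamma>\<^sup>2) ^ n"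
proof -
  define s :: "real ^ 2" where "s = (\<chi> k. \<sigma>)"
  have s: "0 \<le> s $ k" "s $ k \<le> \<sigma>" for k
    using \<sigma> by (auto simp: s_def)
  have sq: "s \<in> unit_square"
    using \<sigma> by (auto simp: unit_square_def s_def)
  define y where "y n = (pgf_vec ^^ n) s" for n
  have y: "0 \<le> y n $ k" "y n $ k \<le> 1" for n k
    using pgf_vec_iterate_unit_square[OF sq] by (auto simp: unit_square_def y_def)
  define Y where "Y n = max (y n $ 1) (y n $ 2)" for n
  have yY: "y n $ k \<le> Y n" for n k
    using exhaust_2[of k] by (auto simp: Y_def)
  have Y_attained: "\<exists>k. Y n = y n $ k" for n
    by (auto simp: Y_def max_def)
  have Y0: "0 \<le> Y n" for n
    using Y_attained[of n] y by metis
  have Y_le: "Y n \<le> \<sigma>" for n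
  proof -
    have "y n $ k \<le> \<sigma>" for k
    proof -
      have "y n $ k \<le> \<sigma> * (\<sigma> + (1 - \<sigma>) * row_sum n k)"
        unfolding y_def using s \<sigma> by (intro pgf_vec_iterate_le) auto
      also have "\<dots> \<le> \<sigma> * (\<sigma> + (1 - \<sigma>) * 1)"
        using \<sigma> by (intro mult_left_mono add_left_mono row_sum_le_1) auto
      finally show ?thesis
        by simp
    qed
    then show ?thesis
      using Y_attained by metis
  qed
  then have Y1: "Y n \<le> 1" for n
    using \<sigma> by (meson less_imp_le order_trans)
  have C0: "1 \<le> C\<^sub>0"
    using rows[of 0 1] by simp
  \<comment> \<open>After \<open>m\<close> generations each type has more than one descendant with
    probability at least 1/2.\<close>
  obtain m where m: "\<gamma> ^ m < 1 / (2 * C\<^sub>0)"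
    using real_arch_pow_inv[of "1 / (2 * C\<^sub>0)" \<gamma>] \<gamma> C0 by auto
  have q: "row_sum m k \<le> 1 / 2" for k
    using rows[of m k] m C0 by (simp add: field_simps)
  \<comment> \<open>With row sums at most 1/2 the second factor in \<open>pgf_vec_iterate_le\<close>
    is at most \<open>(1 + Y n) / 2\<close>, and \<open>Y n \<le> \<sigma>\<close>.\<close>
  define \<kappa> where "\<kappa> = (1 + \<sigma>) / 2"
  have \<kappa>: "0 \<le> \<kappa>" "\<kappa> < 1"
    using \<sigma> by (auto simp: \<kappa>_def)
  have "Y (n + m) \<le> \<kappa> * Y n" for n
  proof -
    have "y (n + m) $ k \<le> \<kappa> * Y n" for k
    proof -
      have "y (n + m) = (pgf_vec ^^ m) (y n)"
        by (simp add: y_def funpow_add add.commute)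
      then have "y (n + m) $ k \<le> Y n * (Y n + (1 - Y n) * row_sum m k)"
        using y yY Y1 by (simp add: pgf_vec_iterate_le)
      also have "\<dots> \<le> Y n * (Y n + (1 - Y n) * (1 / 2))"
        using Y0 Y1 q by (intro mult_left_mono add_left_mono) auto
      also have "\<dots> \<le> Y n * \<kappa>"
        using Y0 Y_le[of n] by (intro mult_left_mono) (auto simp: \<kappa>_def field_simps)
      finally show ?thesis
        by (simp add: mult.commute)
    qed
    then show ?thesis
      using Y_attained by metis
  qed
  then have sumY: "(\<Sum>k<n. Y k) \<le> m / (1 - \<kappa>)" for n
    using Y0 Y1 \<kappa> by (intro sum_bounded_of_geometric_blocks) auto
  define S where "S = m / (1 - \<kappa>)"
  \<comment> \<open>Dividing by the target rate turns the convolution kernel into the constant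
    \<open>C\<^sub>0 / \<gamma>\<close>, and one of the two factors \<open>Y k\<close> becomes the
    summable coefficient.\<close>
  define z where "z n = Y n / \<gamma> ^ n" for n
  have "z n \<le> C\<^sub>0 + (C\<^sub>0 / \<gamma>) * (\<Sum>k<n. Y k * z k)" for n
  proof -
    have "y n $ i \<le> C\<^sub>0 * \<gamma> ^ n + (\<Sum>k<n. C\<^sub>0 * \<gamma> ^ (n - 1 - k) * (Y k)\<^sup>2)" for i
    proof -
      have "y n $ i \<le> row_sum n i + (\<Sum>k<n. row_sum (n - 1 - k) i * (Y k)\<^sup>2)"
        using pgf_vec_iterate_le_linear[of s Y n i] yY Y1 y[of 0] by (simp add: y_def)
      also have "\<dots> \<le> C\<^sub>0 * \<gamma> ^ n + (\<Sum>k<n. C\<^sub>0 * \<gamma> ^ (n - 1 - k) * (Y k)\<^sup>2)"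
        by (intro add_mono sum_mono mult_right_mono rows) auto
      finally show ?thesis .
    qed
    then have "Y n \<le> C\<^sub>0 * \<gamma> ^ n + (\<Sum>k<n. C\<^sub>0 * \<gamma> ^ (n - 1 - k) * (Y k)\<^sup>2)"
      using Y_attained by metis
    then have "z n \<le> (C\<^sub>0 * \<gamma> ^ n + (\<Sum>k<n. C\<^sub>0 * \<gamma> ^ (n - 1 - k) * (Y k)\<^sup>2)) / \<gamma> ^ n"
      using \<gamma> unfolding z_def by (intro divide_right_mono) auto
    also have "\<dots> = C\<^sub>0 + (\<Sum>k<n. C\<^sub>0 * \<gamma> ^ (n - 1 - k) * (Y k)\<^sup>2 / \<gamma> ^ n)"
      using \<gamma> by (simp add: add_divide_distrib sum_divide_distrib)
    also have "(\<Sum>k<n. C\<^sub>0 * \<gamma> ^ (n - 1 - k) * (Y k)\<^sup>2 / \<gamma> ^ n) = (\<Sum>k<n. C\<^sub>0 / \<gamma> * (Y k * z k))"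
    proof (rule sum.cong)
      fix k assume k: "k \<in> {..<n}"
      have "\<gamma> ^ n = \<gamma> ^ (n - 1 - k) * (\<gamma> * \<gamma> ^ k)"
        using k by (simp flip: power_Suc power_add)
      then show "C\<^sub>0 * \<gamma> ^ (n - 1 - k) * (Y k)\<^sup>2 / \<gamma> ^ n = C\<^sub>0 / \<gamma> * (Y k * z k)"
        using \<gamma> by (simp add: z_def field_simps power2_eq_square)
    qed simp
    finally show ?thesis
      by (simp add: sum_distrib_left)
  qed
  then have "z n \<le> C\<^sub>0 * (\<Prod>k<n. 1 + C\<^sub>0 / \<gamma> * Y k)" for n
    using Y0 C0 \<gamma> by (intro discrete_gronwall) auto
  moreover have "C\<^sub>0 * (\<Prod>k<n. 1 + C\<^sub>0 / \<gamma> * Y k) \<le> C\<^sub>0 * exp (C\<^sub>0 / \<gamma> * S)" for n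
  proof -
    have "(\<Prod>k<n. 1 + C\<^sub>0 / \<gamma> * Y k) \<le> exp (\<Sum>k<n. C\<^sub>0 / \<gamma> * Y k)"
      using Y0 C0 \<gamma> by (intro prod_1_plus_le_exp) auto
    also have "\<dots> \<le> exp (C\<^sub>0 / \<gamma> * S)"
      unfolding exp_le_cancel_iff sum_distrib_left[symmetric] S_def
      using C0 \<gamma> by (intro mult_left_mono sumY) auto
    finally show ?thesis
      using C0 by (intro mult_left_mono) auto
  qed
  ultimately have z_le: "z n \<le> C\<^sub>0 * exp (C\<^sub>0 / \<gamma> * S)" for n
    by (meson order_trans)
  define C\<^sub>1 where "C\<^sub>1 = C\<^sub>0 * exp (C\<^sub>0 / \<gamma> * S)"
  have C1: "C\<^sub>1 > 0"
    using C0 by (simp add: C\<^sub>1_def)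
  have Y_geo: "Y n \<le> C\<^sub>1 * \<gamma> ^ n" for n
    using z_le[of n] \<gamma> by (simp add: z_def C\<^sub>1_def field_simps)
  define C\<^sub>2 where "C\<^sub>2 = exp (S / pmf h 0)"
  \<comment> \<open>The relative excess of \<open>pgf h (y k)\<close> over \<open>pmf h 0\<close> is
    at most \<open>Y k / pmf h 0\<close>, which is summable; hence only a constant is lost against
    the power.\<close>
  have H: "(\<Prod>k<n. pgf h (y k)) \<le> pmf h 0 ^ n * C\<^sub>2" for n
  proof -
    have "(\<Prod>k<n. pgf h (y k)) \<le> (\<Prod>k<n. pmf h 0 * (1 + Y k / pmf h 0))"
    proof (intro prod_mono conjI)
      fix k
      show "0 \<le> pgf h (y k)"
        using y by (intro pgf_nonneg) (auto simp: unit_square_def)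
      show "pgf h (y k) \<le> pmf h 0 * (1 + Y k / pmf h 0)"
        using pgf_immigration_le[OF y(1) yY Y1, of k] h0 by (simp add: distrib_left)
    qed
    also have "\<dots> = pmf h 0 ^ n * (\<Prod>k<n. 1 + Y k / pmf h 0)"
      by (simp add: prod.distrib)
    also have "(\<Prod>k<n. 1 + Y k / pmf h 0) \<le> exp (\<Sum>k<n. Y k / pmf h 0)"
      using Y0 h0 by (intro prod_1_plus_le_exp) auto
    also have "\<dots> \<le> C\<^sub>2"
      unfolding C\<^sub>2_def exp_le_cancel_iff sum_divide_distrib[symmetric] S_def
      using h0 by (intro divide_right_mono sumY) auto
    finally show ?thesis
      using h0 by (simp add: mult_left_mono)
  qed
  \<comment> \<open>Only \<open>d\<close> factors of the monomial are kept, one or two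
    below.\<close>
  have law: "pgf (law n x) (\<chi> k. \<sigma>) \<le> (Y n) ^ d * (pmf h 0 ^ n * C\<^sub>2)" if "d \<le> popsize x" for n x d
  proof -
    have "pgf (law n x) (\<chi> k. \<sigma>) = monom_at (y n) x * (\<Prod>k<n. pgf h (y k))"
      using pgf_law[OF sq] by (simp add: s_def y_def)
    also have "\<dots> \<le> (Y n) ^ d * (pmf h 0 ^ n * C\<^sub>2)"
    proof (rule mult_mono)
      show "monom_at (y n) x \<le> Y n ^ d"
        using monom_at_le_power[OF y(1) yY, of n x] power_decreasing[OF that Y0 Y1, of n] by linarith
    qed (use H Y0 y in \<open>auto intro!: prod_nonneg pgf_nonneg simp: unit_square_def\<close>)
    finally show ?thesis .
  qed
  show ?thesis
  proof (rule that[of "max (C\<^sub>1 * C\<^sub>2) (C\<^sub>1\<^sup>2 * C\<^sub>2)"])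
    show "0 < max (C\<^sub>1 * C\<^sub>2) (C\<^sub>1\<^sup>2 * C\<^sub>2)"
      using C1 by (simp add: C\<^sub>2_def less_max_iff_disj)
    have C2: "0 < C\<^sub>2"
      by (simp add: C\<^sub>2_def)
    fix n and x :: "nat ^ 2"
    {
      assume "x \<noteq> 0"
      then have "1 \<le> popsize x"
        using popsize_eq_0_iff[of x] by linarith
      from law[OF this, of n] have "pgf (law n x) (\<chi> k. \<sigma>) \<le> Y n * (pmf h 0 ^ n * C\<^sub>2)"
        by simp
      also have "\<dots> \<le> C\<^sub>1 * \<gamma> ^ n * (pmf h 0 ^ n * C\<^sub>2)"
        using C2 by (intro mult_right_mono Y_geo) auto
      also have "\<dots> = C\<^sub>1 * C\<^sub>2 * (pmf h 0 * \<gamma>) ^ n"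
        by (simp add: power_mult_distrib)
      also have "\<dots> \<le> max (C\<^sub>1 * C\<^sub>2) (C\<^sub>1\<^sup>2 * C\<^sub>2) * (pmf h 0 * \<gamma>) ^ n"
        using \<gamma> by (intro mult_right_mono) auto
      finally show "pgf (law n x) (\<chi> k. \<sigma>) \<le> max (C\<^sub>1 * C\<^sub>2) (C\<^sub>1\<^sup>2 * C\<^sub>2) * (pmf h 0 * \<gamma>) ^ n" .
    next
      assume "2 \<le> popsize x"
      from law[OF this, of n] have "pgf (law n x) (\<chi> k. \<sigma>) \<le> (Y n)\<^sup>2 * (pmf h 0 ^ n * C\<^sub>2)"
        by simp
      also have "\<dots> \<le> (C\<^sub>1 * \<gamma> ^ n)\<^sup>2 * (pmf h 0 ^ n * C\<^sub>2)"
        using C2 Y0 by (intro mult_right_mono power_mono Y_geo) auto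
      also have "\<dots> = C\<^sub>1\<^sup>2 * C\<^sub>2 * (pmf h 0 * \<gamma>\<^sup>2) ^ n"
        by (simp add: power_mult_distrib power2_eq_square mult_ac)
      also have "\<dots> \<le> max (C\<^sub>1 * C\<^sub>2) (C\<^sub>1\<^sup>2 * C\<^sub>2) * (pmf h 0 * \<gamma>\<^sup>2) ^ n"
        using \<gamma> by (intro mult_right_mono) auto
      finally show "pgf (law n x) (\<chi> k. \<sigma>) \<le> max (C\<^sub>1 * C\<^sub>2) (C\<^sub>1\<^sup>2 * C\<^sub>2) * (pmf h 0 * \<gamma>\<^sup>2) ^ n" .
    }
  qed
qed

end

section \<open>Convergence of the rescaled point probabilities\<close>

text \<open>Tannery's theorem for the terms extended by zero beyond \<open>n\<close>; for fixed
  \<open>k\<close> the factor in front of \<open>b k\<close> tends to \<open>L\<close>.\<close>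

lemma convergent_convolution:
  fixes a b :: "nat \<Rightarrow> real"
  assumes a: "a \<longlonglongrightarrow> L" and b: "summable (\<lambda>k. \<bar>b k\<bar>)"
  shows "convergent (\<lambda>n. \<Sum>k<n. a (n - 1 - k) * b k)"
proof -
  obtain K where K: "\<And>n. \<bar>a n\<bar> \<le> K"
    using convergent_imp_Bseq[of a] a by (auto simp: convergent_def Bseq_def)
  define f where "f k n = (if k < n then a (n - 1 - k) * b k else 0)" for k n
  have "(\<lambda>n. suminf (\<lambda>k. f k n)) \<longlonglongrightarrow> suminf (\<lambda>k. L * b k)"
  proof (rule tannerys_theorem[where M = "\<lambda>k. K * \<bar>b k\<bar>", THEN conjunct2, THEN conjunct2])
    fix k
    \<comment> \<open>From \<open>Suc k\<close> on the cutoff is passed, and the index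
      \<open>n + Suc k - 1 - k\<close> is just \<open>n\<close>.\<close>
    have "(\<lambda>n. f k (n + Suc k)) \<longlonglongrightarrow> L * b k"
      using a by (auto simp: f_def intro!: tendsto_intros)
    then show "f k \<longlonglongrightarrow> L * b k"
      by (rule LIMSEQ_offset)
  next
    have "0 \<le> K"
      using K[of 0] by linarith
    then have "norm (f k n) \<le> K * \<bar>b k\<bar>" for k n
      by (auto simp: f_def abs_mult intro: mult_right_mono K)
    then show "\<forall>\<^sub>F (k, n) in sequentially \<times>\<^sub>F sequentially. norm (f k n) \<le> K * \<bar>b k\<bar>"
      by (intro always_eventually) auto
  qed (auto intro: b)
  moreover have "suminf (\<lambda>k. f k n) = (\<Sum>k<n. a (n - 1 - k) * b k)" for n
    by (subst suminf_finite[of "{..<n}"]) (auto simp: f_def)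
  ultimately show ?thesis
    by (auto simp: convergent_def)
qed

text \<open>Variation of constants with \<open>G\<close> as the powers of the matrix: their
  convergence handles the initial value, and \<open>convergent_convolution\<close> the summable
  forcing.\<close>

lemma convergent_linear_recursion:
  fixes y :: "nat \<Rightarrow> 2 \<Rightarrow> real" and a :: "2 \<Rightarrow> 2 \<Rightarrow> real"
  assumes y: "\<And>n i. y (Suc n) i = (\<Sum>k\<in>UNIV. a i k * y n k) + b n i"
    and G_0: "\<And>i k. G 0 i k = (if i = k then 1 else 0)"
    and G_Suc: "\<And>n i k. G (Suc n) i k = (\<Sum>l\<in>UNIV. a i l * G n l k)"
    and G: "\<And>i k. (\<lambda>n. G n i k) \<longlonglongrightarrow> L i k"
    and b: "\<And>i. summable (\<lambda>n. \<bar>b n i\<bar>)"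
  shows "convergent (\<lambda>n. y n i)"
proof -
  have sol: "y n i = (\<Sum>k\<in>UNIV. G n i k * y 0 k) + (\<Sum>k\<in>UNIV. \<Sum>m<n. G (n - 1 - m) i k * b m k)" for n i
  proof (induction n arbitrary: i)
    case 0
    show ?case
      using exhaust_2[of i] by (auto simp: G_0 sum_2)
  next
    case (Suc n)
    have "(\<Sum>l\<in>UNIV. a i l * y n l) =
      (\<Sum>l\<in>UNIV. a i l * (\<Sum>k\<in>UNIV. G n l k * y 0 k)) +
      (\<Sum>l\<in>UNIV. a i l * (\<Sum>k\<in>UNIV. \<Sum>m<n. G (n - 1 - m) l k * b m k))"
      by (simp add: Suc distrib_left sum.distrib)
    also have "(\<Sum>l\<in>UNIV. a i l * (\<Sum>k\<in>UNIV. G n l k * y 0 k)) = (\<Sum>k\<in>UNIV. G (Suc n) i k * y 0 k)"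
      by (simp add: G_Suc sum_2 algebra_simps)
    also have "(\<Sum>l\<in>UNIV. a i l * (\<Sum>k\<in>UNIV. \<Sum>m<n. G (n - 1 - m) l k * b m k)) =
        (\<Sum>k\<in>UNIV. \<Sum>l\<in>UNIV. \<Sum>m<n. a i l * (G (n - 1 - m) l k * b m k))"
      unfolding sum_distrib_left by (rule sum.swap)
    also have "\<dots> = (\<Sum>k\<in>UNIV. \<Sum>m<n. \<Sum>l\<in>UNIV. a i l * (G (n - 1 - m) l k * b m k))"
      by (intro sum.cong refl sum.swap)
    also have "\<dots> = (\<Sum>k\<in>UNIV. \<Sum>m<n. G (n - m) i k * b m k)"
    proof (intro sum.cong refl)
      fix k :: 2 and m assume "m \<in> {..<n}"
      then have "n - m = Suc (n - 1 - m)"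
        by auto
      then show "(\<Sum>l\<in>UNIV. a i l * (G (n - 1 - m) l k * b m k)) = G (n - m) i k * b m k"
        by (simp only: G_Suc sum_distrib_right mult.assoc)
    qed
    also have "(\<Sum>k\<in>UNIV. \<Sum>m<Suc n. G (Suc n - 1 - m) i k * b m k) =
        (\<Sum>k\<in>UNIV. \<Sum>m<n. G (n - m) i k * b m k) + b n i"
      using exhaust_2[of i] by (auto simp: sum.distrib G_0 sum_2)
    ultimately show ?case
      by (simp only: y add.assoc)
  qed
  have "(\<lambda>n. y n i) = (\<lambda>n. (\<Sum>k\<in>UNIV. G n i k * y 0 k) +
      (\<Sum>k\<in>UNIV. \<Sum>m<n. G (n - 1 - m) i k * b m k))"
    using sol by blast
  moreover have "convergent (\<lambda>n. G n i k * y 0 k)" for k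
    using tendsto_mult_right[OF G] by (auto simp: convergent_def)
  moreover have "convergent (\<lambda>n. \<Sum>m<n. G (n - 1 - m) i k * b m k)" for k
    by (rule convergent_convolution[OF G b])
  ultimately show ?thesis
    by (simp add: sum_2 convergent_add)
qed

lemma pmf_le_pgf:
  assumes "0 < \<sigma>" "\<sigma> < 1"
  shows "pmf q j \<le> pgf q (\<chi> k. \<sigma>) / \<sigma> ^ popsize j"
proof -
  have "pmf q j * \<sigma> ^ popsize j = measure_pmf.expectation q (\<lambda>y. indicator {j} y * \<sigma> ^ popsize j)"
    by (simp add: measure_pmf_single)
  also have "\<dots> \<le> pgf q (\<chi> k. \<sigma>)"
    unfolding pgf_def using assms
    by (intro integral_mono integrable_monom_at integrable_mult_left integrable_real_indicator)
      (auto simp: monom_at_const unit_square_def indicator_def measure_pmf.emeasure_eq_measure)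
  finally show ?thesis
    using assms by (simp add: field_simps)
qed

locale decaying_gwi = growing_gwi +
  fixes \<gamma> :: real and P\<^sub>0 :: "real ^ 2 ^ 2"
  assumes \<gamma>: "0 < \<gamma>" "\<gamma> < 1" and h_0: "pmf h 0 > 0"
    and single_limit: "(\<lambda>n. (1 / \<gamma> ^ n) *\<^sub>R mat_power single_matrix n) \<longlonglongrightarrow> P\<^sub>0"
begin

definition decay :: real where "decay = pmf h 0 * \<gamma>"

lemma decay_pos: "decay > 0"
  using \<gamma> h_0 by (simp add: decay_def)

definition scaled_power :: "2 \<Rightarrow> 2 \<Rightarrow> nat \<Rightarrow> real" where
  "scaled_power i k n = mat_power single_matrix n $ i $ k / \<gamma> ^ n"

lemma scaled_power_limit: "scaled_power i k \<longlonglongrightarrow> P\<^sub>0 $ i $ k"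
  using tendsto_vec_nth[OF tendsto_vec_nth[OF single_limit]] by (simp add: scaled_power_def[abs_def])

lemma row_sum_bound: obtains C where "\<And>n i. row_sum n i \<le> C * \<gamma> ^ n"
proof -
  have "\<exists>K. \<forall>n. \<bar>scaled_power i k n\<bar> \<le> K" for i k
    using convergent_imp_Bseq[of "scaled_power i k"] scaled_power_limit
    by (auto simp: convergent_def Bseq_def)
  then obtain K where K: "\<And>i k n. \<bar>scaled_power i k n\<bar> \<le> K i k"
    by metis
  have "row_sum n i \<le> (\<Sum>i\<in>UNIV. \<Sum>k\<in>UNIV. K i k) * \<gamma> ^ n" for n i
  proof -
    have "row_sum n i = (\<Sum>k\<in>UNIV. scaled_power i k n) * \<gamma> ^ n"
      using \<gamma> by (simp add: row_sum_def scaled_power_def sum_2 field_simps)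
    also have "(\<Sum>k\<in>UNIV. scaled_power i k n) \<le> (\<Sum>k\<in>UNIV. K i k)"
      by (intro sum_mono order_trans[OF abs_ge_self K])
    also have "\<dots> \<le> (\<Sum>i\<in>UNIV. \<Sum>k\<in>UNIV. K i k)"
      by (rule member_le_sum) (auto intro!: sum_nonneg order_trans[OF abs_ge_zero K])
    finally show ?thesis
      using \<gamma> by simp
  qed
  then show ?thesis
    by (rule that)
qed

text \<open>The constant depends on \<sigma> but not on \<open>n\<close>, \<open>x\<close> or
  \<open>j\<close>. With \<sigma> close to one, the growth in \<open>j\<close> becomes slower than a
  prescribed exponential.\<close>

lemma pmf_law_bound:
  assumes "0 < \<sigma>" "\<sigma> < 1"
  obtains C where "C > 0"
    "\<And>n x j. x \<noteq> 0 \<Longrightarrow> pmf (law n x) j \<le> C / \<sigma> ^ popsize j * decay ^ n"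
    "\<And>n x j. 2 \<le> popsize x \<Longrightarrow> pmf (law n x) j \<le> C / \<sigma> ^ popsize j * (decay * \<gamma>) ^ n"
proof -
  obtain C\<^sub>0 where "\<And>n i. row_sum n i \<le> C\<^sub>0 * \<gamma> ^ n"
    using row_sum_bound by blast
  then obtain C where C: "C > 0"
    "\<And>n x. x \<noteq> 0 \<Longrightarrow> pgf (law n x) (\<chi> k. \<sigma>) \<le> C * (pmf h 0 * \<gamma>) ^ n"
    "\<And>n x. 2 \<le> popsize x \<Longrightarrow> pgf (law n x) (\<chi> k. \<sigma>) \<le> C * (pmf h 0 * \<gamma>\<^sup>2) ^ n"
    using pgf_law_bound[OF \<gamma> _ h_0 assms] by blast
  have *: "pmf (law n x) j \<le> C / \<sigma> ^ popsize j * B" if "pgf (law n x) (\<chi> k. \<sigma>) \<le> C * B" for n x j B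
  proof -
    have "pmf (law n x) j \<le> pgf (law n x) (\<chi> k. \<sigma>) / \<sigma> ^ popsize j"
      by (rule pmf_le_pgf[OF assms])
    also have "\<dots> \<le> C * B / \<sigma> ^ popsize j"
      using that assms by (intro divide_right_mono) auto
    finally show ?thesis
      by simp
  qed
  show ?thesis
  proof (rule that[OF C(1)])
    show "pmf (law n x) j \<le> C / \<sigma> ^ popsize j * decay ^ n" if "x \<noteq> 0" for n x j
      using *[OF C(2)[OF that]] by (simp add: decay_def)
    show "pmf (law n x) j \<le> C / \<sigma> ^ popsize j * (decay * \<gamma>) ^ n" if "2 \<le> popsize x" for n x j
      using *[OF C(3)[OF that]] by (simp add: decay_def power2_eq_square mult_ac)
  qed
qed

definition scaled_pmf :: "2 \<Rightarrow> nat ^ 2 \<Rightarrow> nat \<Rightarrow> real" where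
  "scaled_pmf i j n = pmf (law n (axis i 1)) j / decay ^ n"

text \<open>After the first step the population is either a single particle again, or has at least two
  particles and then contributes a term that is negligible by a further factor \<open>\<gamma> ^ n\<close>.\<close>

lemma pmf_law_Suc_axis:
  "pmf (law (Suc n) (axis i 1)) j =
    (\<Sum>k\<in>UNIV. pmf h 0 * single_matrix $ i $ k * pmf (law n (axis k 1)) j) +
    measure_pmf.expectation (step (axis i 1)) (\<lambda>y. indicator {y. 2 \<le> popsize y} y * pmf (law n y) j)"
proof -
  let ?q = "step (axis i 1)"
  let ?g = "\<lambda>y. pmf (law n y) j"
  let ?t = "\<lambda>k y. indicator {axis k 1} y * ?g (axis k 1)"
  let ?r = "\<lambda>y. indicator {y. 2 \<le> popsize y} y * ?g y"
  have int: "integrable (measure_pmf ?q) (?t k)" "integrable (measure_pmf ?q) ?r" for k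
    by (rule measure_pmf.integrable_const_bound[where B = 1], auto simp: indicator_def pmf_le_1)+
  have "pmf (law (Suc n) (axis i 1)) j = measure_pmf.expectation ?q ?g"
    by (simp only: gwi_law_Suc' pmf_bind)
  also have "\<dots> = measure_pmf.expectation ?q (\<lambda>y. (?t 1 y + ?t 2 y) + ?r y)"
  proof (rule integral_cong_AE)
    show "AE y in measure_pmf ?q. ?g y = (?t 1 y + ?t 2 y) + ?r y"
    proof (rule AE_pmfI)
      fix y assume "y \<in> set_pmf ?q"
      then have "1 \<le> popsize y"
        using popsize_step by fastforce
      then consider "y = axis 1 1" | "y = axis 2 1" | "2 \<le> popsize y"
        using popsize_eq_1_iff[of y] exhaust_2 by (metis Suc_1 le_antisym not_less_eq_eq One_nat_def)
      then show "?g y = (?t 1 y + ?t 2 y) + ?r y"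
        by cases (auto simp: axis_eq_axis indicator_def simp del: One_nat_def)
    qed
  qed auto
  also have "\<dots> = (measure_pmf.expectation ?q (?t 1) + measure_pmf.expectation ?q (?t 2)) +
      measure_pmf.expectation ?q ?r"
    using int by (simp del: One_nat_def)
  also have "\<dots> = (\<Sum>k\<in>UNIV. pmf h 0 * single_matrix $ i $ k * ?g (axis k 1)) + measure_pmf.expectation ?q ?r"
  proof -
    have "measure_pmf.expectation ?q (?t k) = pmf h 0 * single_matrix $ i $ k * ?g (axis k 1)" for k
      by (simp add: measure_pmf_single pmf_step_axis single_matrix_def del: One_nat_def)
    then show ?thesis
      by (simp only: sum_2)
  qed
  finally show ?thesis .
qed

text \<open>Dividing the first-step decomposition by \<open>decay ^ Suc n\<close> turns the matrix
  into A / \<gamma>, whose powers converge by hypothesis; the populations of at least two particles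
  leave an error of order \<open>\<gamma> ^ n\<close>.\<close>

lemma convergent_scaled_pmf: "convergent (scaled_pmf i j)"
proof -
  define b where "b k n = measure_pmf.expectation (step (axis k 1))
      (\<lambda>y. indicator {y. 2 \<le> popsize y} y * pmf (law n y) j) / decay ^ Suc n" for k n
  \<comment> \<open>As \<open>j\<close> is fixed here, any \<sigma> between zero and one
    serves.\<close>
  obtain C where C: "C > 0"
    "\<And>n x j. 2 \<le> popsize x \<Longrightarrow> pmf (law n x) j \<le> C / (1/2) ^ popsize j * (decay * \<gamma>) ^ n"
    by (rule pmf_law_bound[of "1/2"]) (simp, simp, rule that)
  define D where "D = C / (1/2) ^ popsize j"
  have D: "0 \<le> D"
    using C by (simp add: D_def)
  have b_le: "\<bar>b k n\<bar> \<le> D / decay * \<gamma> ^ n" for k n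
  proof -
    have "\<bar>measure_pmf.expectation (step (axis k 1)) (\<lambda>y. indicator {y. 2 \<le> popsize y} y * pmf (law n y) j)\<bar>
        \<le> D * (decay * \<gamma>) ^ n"
    proof -
      have "0 \<le> D * (decay * \<gamma>) ^ n"
        using D decay_pos \<gamma> by simp
      moreover have "pmf (law n y) j \<le> D * (decay * \<gamma>) ^ n" if "2 \<le> popsize y" for y
        using C(2)[OF that] by (simp add: D_def)
      ultimately have "measure_pmf.expectation (step (axis k 1)) (\<lambda>y. indicator {y. 2 \<le> popsize y} y * pmf (law n y) j)
          \<le> D * (decay * \<gamma>) ^ n"
        by (intro measure_pmf.integral_le_const measure_pmf.integrable_const_bound[where B = 1])
          (auto simp: indicator_def pmf_le_1)
      moreover have "0 \<le> measure_pmf.expectation (step (axis k 1)) (\<lambda>y. indicator {y. 2 \<le> popsize y} y * pmf (law n y) j)"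
        by (intro integral_nonneg_AE) auto
      ultimately show ?thesis
        by simp
    qed
    then have "\<bar>b k n\<bar> \<le> D * (decay * \<gamma>) ^ n / decay ^ Suc n"
      using decay_pos unfolding b_def abs_divide by (intro divide_mono) auto
    also have "\<dots> = D / decay * \<gamma> ^ n"
      using decay_pos by (simp add: power_mult_distrib)
    finally show ?thesis .
  qed
  have rec: "scaled_pmf i j (Suc n) = (\<Sum>k\<in>UNIV. single_matrix $ i $ k / \<gamma> * scaled_pmf k j n) + b i n" for i n
  proof -
    have "(\<Sum>k\<in>UNIV. pmf h 0 * single_matrix $ i $ k * pmf (law n (axis k 1)) j) / decay ^ Suc n =
        (\<Sum>k\<in>UNIV. single_matrix $ i $ k / \<gamma> * scaled_pmf k j n)"
      using \<gamma> h_0 by (simp add: sum_divide_distrib scaled_pmf_def decay_def)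
    then show ?thesis
      by (simp add: scaled_pmf_def pmf_law_Suc_axis add_divide_distrib b_def
          del: gwi_law.simps One_nat_def power_Suc)
  qed
  show ?thesis
  proof (rule convergent_linear_recursion[where y = "\<lambda>n i. scaled_pmf i j n" and b = "\<lambda>n i. b i n"
        and G = "\<lambda>n i k. scaled_power i k n"])
    show "scaled_pmf i j (Suc n) = (\<Sum>k\<in>UNIV. single_matrix $ i $ k / \<gamma> * scaled_pmf k j n) + b i n" for i n
      by (rule rec)
    show "scaled_power i k 0 = (if i = k then 1 else 0)" for i k
      by (simp add: scaled_power_def mat_def)
    show "scaled_power i k (Suc n) = (\<Sum>l\<in>UNIV. single_matrix $ i $ l / \<gamma> * scaled_power l k n)" for i k n
      by (simp add: scaled_power_def matrix_matrix_mult_def sum_divide_distrib)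
    show "(\<lambda>n. scaled_power i k n) \<longlonglongrightarrow> P\<^sub>0 $ i $ k" for i k
      by (rule scaled_power_limit)
    show "summable (\<lambda>n. \<bar>b k n\<bar>)" for k
    proof (rule summable_comparison_test'[where N = 0])
      show "summable (\<lambda>n. D / decay * \<gamma> ^ n)"
        using \<gamma> by (intro summable_mult summable_geometric) simp
      show "norm \<bar>b k n\<bar> \<le> D / decay * \<gamma> ^ n" for n
        using b_le by simp
    qed
  qed
qed

end

section \<open>Derivatives of the generating functions\<close>

lemma pmf_infsum_eq_expectation:
  fixes f :: "'a \<Rightarrow> real"
  assumes "\<And>x. \<bar>f x\<bar> \<le> B"
  shows "(\<Sum>\<^sub>\<infinity>x\<in>UNIV. pmf q x * f x) = measure_pmf.expectation q f"
proof -
  have "Infinite_Set_Sum.abs_summable_on (\<lambda>x. pmf q x * f x) UNIV"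
  proof (rule abs_summable_on_comparison_test)
    show "Infinite_Set_Sum.abs_summable_on (\<lambda>x. B * pmf q x) UNIV"
      by (intro abs_summable_on_cmult_right pmf_abs_summable)
    show "norm (pmf q x * f x) \<le> norm (B * pmf q x)" for x
      using assms[of x] by (auto simp: abs_mult mult.commute[of "pmf q x"] intro!: mult_right_mono)
  qed
  then show ?thesis
    by (simp add: pmf_expectation_eq_infsetsum infsetsum_infsum)
qed

lemma offspring_gf_eq_pgf: "s \<in> unit_square \<Longrightarrow> offspring_gf p i s = pgf (p i) s"
  unfolding offspring_gf_def pgf_def monom_at_def[symmetric]
  by (rule pmf_infsum_eq_expectation[where B = 1]) (auto simp: monom_at_le_1 monom_at_unit_square)

lemma pgf_0: "pgf q 0 = pmf q 0"
proof -
  have "monom_at 0 y = indicator {0} y" for y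
    by (auto simp: monom_at_def UNIV_2 indicator_def vec_eq_iff forall_2)
  then show ?thesis
    by (simp add: pgf_def measure_pmf_single cong: Bochner_Integration.integral_cong)
qed

text \<open>The constant is quadratic in \<open>m\<close> and uniform over the closed unit interval,
  so that a second moment of the litter size sums the remainders.\<close>

lemma power_second_order_remainder:
  fixes t a :: real
  assumes "0 \<le> t" "t \<le> 1" "0 \<le> a" "a \<le> 1"
  shows "\<bar>t ^ m - a ^ m - m * a ^ (m - 1) * (t - a)\<bar> \<le> (real m)\<^sup>2 * (t - a)\<^sup>2"
proof (induction m)
  case (Suc m)
  let ?R = "\<lambda>m. t ^ m - a ^ m - real m * a ^ (m - 1) * (t - a)"
  have "?R (Suc m) = t * ?R m + real m * a ^ (m - 1) * (t - a)\<^sup>2"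
    by (cases m) (simp_all add: algebra_simps power2_eq_square)
  also have "\<bar>\<dots>\<bar> \<le> \<bar>t * ?R m\<bar> + \<bar>real m * a ^ (m - 1) * (t - a)\<^sup>2\<bar>"
    by (rule abs_triangle_ineq)
  also have "\<bar>t * ?R m\<bar> \<le> 1 * ((real m)\<^sup>2 * (t - a)\<^sup>2)"
    unfolding abs_mult using assms Suc by (intro mult_mono) auto
  also have "\<bar>real m * a ^ (m - 1) * (t - a)\<^sup>2\<bar> \<le> (real m * 1) * (t - a)\<^sup>2"
    unfolding abs_mult using assms by (intro mult_right_mono mult_mono) (auto intro: power_le_one)
  finally have "\<bar>?R (Suc m)\<bar> \<le> ((real m)\<^sup>2 + real m) * (t - a)\<^sup>2"
    by (simp add: algebra_simps)
  also have "\<dots> \<le> (real (Suc m))\<^sup>2 * (t - a)\<^sup>2"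
    by (intro mult_right_mono zero_le_power2) (auto simp: power2_eq_square algebra_simps)
  finally show ?case .
qed simp

text \<open>If \<open>y $ j = 0\<close>, the truncated subtraction is harmless because of the factor \<open>y $ j\<close>.\<close>

definition monom_partial :: "2 \<Rightarrow> real ^ 2 \<Rightarrow> nat ^ 2 \<Rightarrow> real" where
  "monom_partial j s y = y $ j * monom_at s (y - axis j 1)"

lemma nth_le_popsize: "y $ j \<le> popsize y"
  unfolding popsize_def by (rule member_le_sum) auto

lemma monom_partial_bounds:
  assumes "s \<in> unit_square"
  shows "0 \<le> monom_partial j s y" "monom_partial j s y \<le> popsize y"
proof -
  show "0 \<le> monom_partial j s y"
    using assms by (simp add: monom_partial_def monom_at_unit_square)
  have "monom_partial j s y \<le> real (y $ j) * 1"
    unfolding monom_partial_def using assms by (intro mult_left_mono monom_at_le_1) auto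
  then show "monom_partial j s y \<le> popsize y"
    using nth_le_popsize[of y j] by linarith
qed

lemma monom_at_update_remainder:
  fixes s :: "real ^ 2"
  assumes s: "s \<in> unit_square" and t: "t \<in> {0..1}"
  shows "\<bar>monom_at (\<chi> k. if k = j then t else s $ k) y - monom_at s y - monom_partial j s y * (t - s $ j)\<bar>
    \<le> (real (popsize y))\<^sup>2 * (t - s $ j)\<^sup>2"
proof -
  define W where "W = (\<Prod>k\<in>UNIV - {j}. (s $ k) ^ (y $ k))"
  have W: "0 \<le> W" "W \<le> 1"
    using s by (auto simp: W_def unit_square_def intro!: prod_nonneg prod_le_1 power_le_one)
  have 1: "monom_at (\<chi> k. if k = j then t else s $ k) y = t ^ (y $ j) * W"
    unfolding monom_at_def W_def by (subst prod.remove[of _ j]) auto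
  have 2: "monom_at s y = (s $ j) ^ (y $ j) * W"
    unfolding monom_at_def W_def by (subst prod.remove[of _ j]) auto
  have "(\<Prod>k\<in>UNIV - {j}. (s $ k) ^ ((y - axis j 1) $ k)) = W"
    unfolding W_def by (intro prod.cong) (auto simp: axis_def)
  then have 3: "monom_partial j s y = y $ j * (s $ j) ^ (y $ j - 1) * W"
    unfolding monom_partial_def monom_at_def by (subst prod.remove[of _ j]) (auto simp: axis_def)
  let ?R = "t ^ (y $ j) - (s $ j) ^ (y $ j) - y $ j * (s $ j) ^ (y $ j - 1) * (t - s $ j)"
  have "monom_at (\<chi> k. if k = j then t else s $ k) y - monom_at s y - monom_partial j s y * (t - s $ j) = ?R * W"
    unfolding 1 2 3 by (simp add: algebra_simps)
  also have "\<bar>\<dots>\<bar> \<le> ((real (y $ j))\<^sup>2 * (t - s $ j)\<^sup>2) * 1"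
    unfolding abs_mult using s t W
    by (intro mult_mono power_second_order_remainder) (auto simp: unit_square_def)
  also have "\<dots> \<le> (real (popsize y))\<^sup>2 * (t - s $ j)\<^sup>2"
    using nth_le_popsize[of y j] by (auto intro!: mult_right_mono power_mono)
  finally show ?thesis .
qed

lemma integrable_popsize_square:
  assumes "integrable (measure_pmf q) (\<lambda>y. exp (\<theta> * real (popsize y)))" "\<theta> > 0"
  shows "integrable (measure_pmf q) (\<lambda>y. (real (popsize y))\<^sup>2)"
proof (rule Bochner_Integration.integrable_bound)
  show "integrable (measure_pmf q) (\<lambda>y. 2 / \<theta>\<^sup>2 * exp (\<theta> * real (popsize y)))"
    using assms by simp
  have "(real n)\<^sup>2 \<le> 2 / \<theta>\<^sup>2 * exp (\<theta> * real n)" for n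
  proof -
    have "(\<theta> * real n)\<^sup>2 / 2 \<le> exp (\<theta> * real n)"
      using exp_lower_Taylor_quadratic[of "\<theta> * real n"] assms(2)
      by (smt (verit) mult_nonneg_nonneg of_nat_0_le_iff)
    then show ?thesis
      using assms(2) by (simp add: field_simps)
  qed
  then show "AE y in measure_pmf q. norm ((real (popsize y))\<^sup>2) \<le> norm (2 / \<theta>\<^sup>2 * exp (\<theta> * real (popsize y)))"
    by (auto simp: abs_mult)
qed auto

lemma integrable_popsize:
  assumes "integrable (measure_pmf q) (\<lambda>y. (real (popsize y))\<^sup>2)"
  shows "integrable (measure_pmf q) (\<lambda>y. real (popsize y))"
proof (rule Bochner_Integration.integrable_bound[OF assms])
  have "real n \<le> (real n)\<^sup>2" for n
    by (cases n) (auto simp: power2_eq_square)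
  then show "AE y in measure_pmf q. norm (real (popsize y)) \<le> norm ((real (popsize y))\<^sup>2)"
    by auto
qed auto

text \<open>Termwise differentiation at all points of the closed square at once: the summed
  second-order remainder is at most \<open>K * (t - s $ j)\<^sup>2\<close>, which also covers the
  one-sided derivatives at the boundary.\<close>

lemma offspring_gf_partial_eq:
  assumes sq: "integrable (measure_pmf (p i)) (\<lambda>y. (real (popsize y))\<^sup>2)" and s: "s \<in> unit_square"
  shows "offspring_gf_partial p i j s = measure_pmf.expectation (p i) (monom_partial j s)"
proof -
  define g where "g t = offspring_gf p i (\<chi> k. if k = j then t else s $ k)" for t
  define D where "D = measure_pmf.expectation (p i) (monom_partial j s)"
  define K where "K = measure_pmf.expectation (p i) (\<lambda>y. (real (popsize y))\<^sup>2)"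
  have sj: "s $ j \<in> {0..1}"
    using s by (auto simp: unit_square_def)
  have K: "0 \<le> K"
    by (simp add: K_def)
  have int: "integrable (measure_pmf (p i)) (monom_partial j s)"
    using integrable_popsize[OF sq]
    by (rule Bochner_Integration.integrable_bound) (auto simp: monom_partial_bounds[OF s])
  have upd: "(\<chi> k. if k = j then t else s $ k) \<in> unit_square" if "t \<in> {0..1}" for t
    using s that by (auto simp: unit_square_def)
  have g: "g t = pgf (p i) (\<chi> k. if k = j then t else s $ k)" if "t \<in> {0..1}" for t
    unfolding g_def by (rule offspring_gf_eq_pgf[OF upd[OF that]])
  have gs: "g (s $ j) = pgf (p i) s"
    using g[OF sj] by (simp add: if_distrib[symmetric] vec_lambda_eta cong: if_cong)
  have rem: "\<bar>g t - g (s $ j) - D * (t - s $ j)\<bar> \<le> K * (t - s $ j)\<^sup>2" if t: "t \<in> {0..1}" for t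
  proof -
    let ?u = "\<lambda>y. monom_at (\<chi> k. if k = j then t else s $ k) y - monom_at s y - monom_partial j s y * (t - s $ j)"
    have "g t - g (s $ j) - D * (t - s $ j) = measure_pmf.expectation (p i) ?u"
      unfolding g[OF t] gs D_def pgf_def using int integrable_monom_at[OF s] integrable_monom_at[OF upd[OF t]]
      by simp
    also have "\<bar>\<dots>\<bar> \<le> measure_pmf.expectation (p i) (\<lambda>y. \<bar>?u y\<bar>)"
      by (rule integral_abs_bound)
    also have "\<dots> \<le> measure_pmf.expectation (p i) (\<lambda>y. (real (popsize y))\<^sup>2 * (t - s $ j)\<^sup>2)"
      using int integrable_monom_at[OF s] integrable_monom_at[OF upd[OF t]] sq
      by (intro integral_mono monom_at_update_remainder[OF s t] integrable_abs
          Bochner_Integration.integrable_diff integrable_mult_left) auto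
    also have "\<dots> = K * (t - s $ j)\<^sup>2"
      by (simp add: K_def)
    finally show ?thesis .
  qed
  have "(g has_derivative (\<lambda>x. x *\<^sub>R D)) (at (s $ j) within {0..1})"
    unfolding has_derivative_within_alt
  proof (intro conjI allI impI)
    fix e :: real assume e: "e > 0"
    show "\<exists>d>0. \<forall>t\<in>{0..1}. norm (t - s $ j) < d \<longrightarrow>
      norm (g t - g (s $ j) - (t - s $ j) *\<^sub>R D) \<le> e * norm (t - s $ j)"
    \<comment> \<open>The denominator \<open>K + 1\<close> allows for \<open>K = 0\<close>.\<close>
    proof (intro exI[of _ "e / (K + 1)"] conjI ballI impI)
      fix t :: real assume t: "t \<in> {0..1}" and d: "norm (t - s $ j) < e / (K + 1)"
      have "norm (g t - g (s $ j) - (t - s $ j) *\<^sub>R D) \<le> K * \<bar>t - s $ j\<bar> * \<bar>t - s $ j\<bar>"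
        using rem[OF t] by (simp add: power2_eq_square mult_ac flip: abs_mult)
      also have "K * \<bar>t - s $ j\<bar> \<le> (K + 1) * (e / (K + 1))"
        using d K e by (intro mult_mono) auto
      finally show "norm (g t - g (s $ j) - (t - s $ j) *\<^sub>R D) \<le> e * norm (t - s $ j)"
        using K by (simp add: mult_right_mono)
    qed (use e K in auto)
  qed (rule bounded_linear_scaleR_left)
  then have "(g has_vector_derivative D) (at (s $ j) within {0..1})"
    by (simp add: has_vector_derivative_def)
  then show ?thesis
    unfolding offspring_gf_partial_def D_def[symmetric] g_def[symmetric]
    using sj by (intro vector_derivative_within_closed_interval) auto
qed

text \<open>At the origin only the monomial \<open>s $ j\<close> itself has a nonzero
  \<open>j\<close>-th partial derivative.\<close>

lemma deriv_matrix_0_eq: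
  assumes "\<And>i. integrable (measure_pmf (p i)) (\<lambda>y. (real (popsize y))\<^sup>2)"
  shows "deriv_matrix_0 p = (\<chi> i j. pmf (p i) (axis j 1))"
proof -
  have "monom_partial j 0 y = indicator {axis j 1} y" for j y
  proof (cases "y = axis j 1")
    case True
    then show ?thesis
      by (simp add: monom_partial_def axis_def)
  next
    case False
    show ?thesis
    proof (cases "y $ j = 0")
      case False
      have "y - axis j 1 \<noteq> 0"
      proof
        \<comment> \<open>Subtraction truncates, but \<open>y $ j\<close> is positive here, so a
          zero difference forces \<open>y\<close> to be the unit vector.\<close>
        assume eq: "y - axis j 1 = 0"
        have "y $ k = axis j 1 $ k" for k
          using False arg_cong[OF eq, of "\<lambda>z. z $ k"] by (cases "k = j") (auto simp: axis_def)
        with \<open>y \<noteq> axis j 1\<close> show False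
          by (simp add: vec_eq_iff)
      qed
      then obtain k where "(y - axis j 1) $ k \<noteq> 0 $ k"
        by (simp only: vec_eq_iff) blast
      then have "monom_at 0 (y - axis j 1) = 0"
        unfolding monom_at_def by (intro prod_zero bexI[of _ k]) auto
      then show ?thesis
        using \<open>y \<noteq> axis j 1\<close> by (simp add: monom_partial_def)
    qed (use \<open>y \<noteq> axis j 1\<close> in \<open>simp add: monom_partial_def\<close>)
  qed
  then have "measure_pmf.expectation (p i) (monom_partial j 0) = pmf (p i) (axis j 1)" for i j
    by (simp add: measure_pmf_single del: One_nat_def cong: Bochner_Integration.integral_cong)
  moreover have "0 \<in> unit_square"
    by (simp add: unit_square_def)
  ultimately show ?thesis
    using assms by (simp add: deriv_matrix_0_def offspring_gf_partial_eq del: One_nat_def)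
qed

text \<open>The limit is evaluated along a diagonal sequence inside the half-open square, with the
  litter size as dominating function.\<close>

lemma mean_matrix_eq:
  assumes mean: "is_mean_matrix p M"
    and sq: "\<And>i. integrable (measure_pmf (p i)) (\<lambda>y. (real (popsize y))\<^sup>2)"
  shows "M $ i $ j = measure_pmf.expectation (p i) (\<lambda>y. real (y $ j))"
proof -
  define \<sigma> where "\<sigma> n = 1 - inverse (real (Suc n))" for n
  define s :: "nat \<Rightarrow> real ^ 2" where "s n = (\<chi> k. \<sigma> n)" for n
  have \<sigma>: "0 \<le> \<sigma> n" "\<sigma> n < 1" for n
    by (auto simp: \<sigma>_def field_simps)
  have \<sigma>_lim: "\<sigma> \<longlonglongrightarrow> 1"
    unfolding \<sigma>_def using tendsto_diff[OF tendsto_const LIMSEQ_inverse_real_of_nat, of 1] by simp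
  have s: "s n \<in> unit_square" for n
    using \<sigma>[of n] by (auto simp: unit_square_def s_def)
  have "s \<longlonglongrightarrow> (\<chi> k. 1)"
    unfolding s_def by (intro vec_tendstoI) (simp add: \<sigma>_lim)
  moreover have "(\<chi> k. 1) = (1 :: real ^ 2)"
    by (simp add: vec_eq_iff)
  ultimately have "s \<longlonglongrightarrow> 1"
    by simp
  moreover have "s n \<noteq> 1" for n
    using \<sigma>(2)[of n] by (auto simp: s_def vec_eq_iff)
  ultimately have "filterlim s (at 1 within {s. \<forall>k. 0 \<le> s $ k \<and> s $ k < 1}) sequentially"
    using \<sigma> by (auto simp: filterlim_at s_def)
  then have 1: "(\<lambda>n. offspring_gf_partial p i j (s n)) \<longlonglongrightarrow> M $ i $ j"
    using mean unfolding is_mean_matrix_def by (blast intro: filterlim_compose)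
  have "(\<lambda>n. measure_pmf.expectation (p i) (monom_partial j (s n))) \<longlonglongrightarrow>
    measure_pmf.expectation (p i) (\<lambda>y. real (y $ j))"
  proof (rule integral_dominated_convergence)
    show "integrable (measure_pmf (p i)) (\<lambda>y. real (popsize y))"
      by (rule integrable_popsize[OF sq])
    have "(\<lambda>n. monom_partial j (s n) y) \<longlonglongrightarrow> real (y $ j) * 1 ^ popsize (y - axis j 1)" for y
      unfolding monom_partial_def s_def monom_at_const by (intro tendsto_intros \<sigma>_lim)
    then show "AE y in measure_pmf (p i). (\<lambda>n. monom_partial j (s n) y) \<longlonglongrightarrow> real (y $ j)"
      by simp
    show "AE y in measure_pmf (p i). norm (monom_partial j (s n) y) \<le> real (popsize y)" for n
      by (simp add: monom_partial_bounds[OF s])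
  qed auto
  then have "(\<lambda>n. offspring_gf_partial p i j (s n)) \<longlonglongrightarrow> measure_pmf.expectation (p i) (\<lambda>y. real (y $ j))"
    by (simp add: offspring_gf_partial_eq[OF sq s])
  with 1 show ?thesis
    by (rule LIMSEQ_unique)
qed

section \<open>Large deviations\<close>

text \<open>From \<open>1 - x \<le> exp (- x)\<close> one gets
  \<open>exp x - 1 - x \<le> x * (exp x - 1)\<close>, and \<open>\<bar>exp x - 1\<bar>\<close> is at
  most \<open>\<bar>x\<bar> * exp \<bar>x\<bar>\<close>.\<close>

lemma exp_le_second_order: "exp x \<le> 1 + x + x\<^sup>2 * exp \<bar>x\<bar>" for x :: real
proof -
  have "(1 - x) * exp x \<le> exp (- x) * exp x"
    using exp_ge_add_one_self[of "- x"] by (intro mult_right_mono) auto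
  then have 1: "exp x - 1 - x \<le> x * (exp x - 1)"
    by (simp add: exp_minus field_simps)
  have "x * (exp x - 1) \<le> \<bar>x\<bar> * (\<bar>x\<bar> * exp \<bar>x\<bar>)"
  proof -
    have "\<bar>exp x - 1\<bar> \<le> \<bar>x\<bar> * exp \<bar>x\<bar>"
    proof (cases "0 \<le> x")
      case True
      then show ?thesis
        using 1 \<open>(1 - x) * exp x \<le> exp (- x) * exp x\<close> by (simp add: algebra_simps flip: exp_add)
    next
      case False
      have "1 - exp x \<le> - x * 1"
        using exp_ge_add_one_self[of x] by linarith
      also have "\<dots> \<le> - x * exp (- x)"
        using False by (intro mult_left_mono) auto
      finally show ?thesis
        using False by simp
    qed
    then have "\<bar>x * (exp x - 1)\<bar> \<le> \<bar>x\<bar> * (\<bar>x\<bar> * exp \<bar>x\<bar>)"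
      unfolding abs_mult by (intro mult_left_mono) auto
    then show ?thesis
      by linarith
  qed
  with 1 show ?thesis
    by (simp add: power2_eq_square mult.assoc abs_mult_self_eq flip: abs_mult)
qed

lemma inner_rvec: "d \<bullet> rvec y = (\<Sum>k\<in>UNIV. d $ k * real (y $ k))"
  by (simp add: rvec_def inner_vec_def)

lemma inner_1_rvec [simp]: "1 \<bullet> rvec y = real (popsize y)"
  by (simp add: inner_rvec popsize_def)

lemma inner_rvec_le:
  fixes B :: real
  assumes "\<And>k. \<bar>d $ k\<bar> \<le> B"
  shows "\<bar>d \<bullet> rvec y\<bar> \<le> B * popsize y"
proof -
  have "\<bar>d \<bullet> rvec y\<bar> \<le> (\<Sum>k\<in>UNIV. \<bar>d $ k\<bar> * real (y $ k))"
    unfolding inner_rvec by (rule order_trans[OF sum_abs]) (simp add: abs_mult)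
  also have "\<dots> \<le> (\<Sum>k\<in>UNIV. B * real (y $ k))"
    using assms by (intro sum_mono mult_right_mono) auto
  finally show ?thesis
    by (simp add: popsize_def sum_distrib_left)
qed

lemma inner_rvec_ge:
  fixes B :: real
  assumes "\<And>k. B \<le> d $ k"
  shows "B * popsize y \<le> d \<bullet> rvec y"
proof -
  have "(\<Sum>k\<in>UNIV. B * real (y $ k)) \<le> d \<bullet> rvec y"
    unfolding inner_rvec using assms by (intro sum_mono mult_right_mono) auto
  then show ?thesis
    by (simp add: popsize_def sum_distrib_left)
qed

lemma monom_at_exp: "monom_at (\<chi> k. exp (a $ k)) y = exp (a \<bullet> rvec y)"
  by (simp add: monom_at_def inner_rvec exp_sum mult.commute flip: exp_of_nat_mult)

text \<open>The logarithm of the moment generating function has slope \<mu> at zero, so for small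
  \<open>t\<close> it stays below \<open>t * (\<mu> + \<kappa>)\<close>. One half of the exponent
  \<theta> absorbs the square in the second-order term, the other half its exponential.\<close>

lemma exp_moment_bound:
  fixes d :: "real ^ 2"
  assumes exp: "integrable (measure_pmf q) (\<lambda>y. exp (\<theta> * real (popsize y)))" and \<theta>: "\<theta> > 0"
    and \<mu>: "measure_pmf.expectation q (\<lambda>y. d \<bullet> rvec y) = \<mu>" and \<kappa>: "\<kappa> > 0"
  obtains t\<^sub>0 where "t\<^sub>0 > 0"
    "\<And>t. 0 < t \<Longrightarrow> t \<le> t\<^sub>0 \<Longrightarrow> integrable (measure_pmf q) (\<lambda>y. exp (t * (d \<bullet> rvec y)))"
    "\<And>t. 0 < t \<Longrightarrow> t \<le> t\<^sub>0 \<Longrightarrow>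
      measure_pmf.expectation q (\<lambda>y. exp (t * (d \<bullet> rvec y))) \<le> exp (t * (\<mu> + \<kappa>))"
proof -
  \<comment> \<open>The summand 1 keeps \<open>B\<close> positive when \<open>d = 0\<close>.\<close>
  define B where "B = \<bar>d $ 1\<bar> + \<bar>d $ 2\<bar> + 1"
  have B: "B > 0" "\<bar>d \<bullet> rvec y\<bar> \<le> B * popsize y" for y
  proof -
    show "B > 0"
      by (simp add: B_def)
    have "\<bar>d $ k\<bar> \<le> B" for k
      using exhaust_2[of k] by (auto simp: B_def)
    then show "\<bar>d \<bullet> rvec y\<bar> \<le> B * popsize y"
      by (rule inner_rvec_le)
  qed
  define E where "E = measure_pmf.expectation q (\<lambda>y. exp (\<theta> * real (popsize y)))"
  \<comment> \<open>From \<open>x\<^sup>2 / 2 \<le> exp x\<close> at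
    \<open>x = \<theta> / 2 * popsize y\<close>, multiplied by \<open>B\<^sup>2\<close>.\<close>
  define K where "K = 8 * B\<^sup>2 / \<theta>\<^sup>2"
  have E: "0 \<le> E" and K: "0 < K"
    using B \<theta> by (simp_all add: E_def K_def)
  \<comment> \<open>The first bound gives \<open>t * B \<le> \<theta> / 2\<close>; the second keeps
    the quadratic term \<open>t\<^sup>2 * K * E\<close> below \<open>t * \<kappa>\<close>.\<close>
  define t\<^sub>0 where "t\<^sub>0 = min (\<theta> / (2 * B)) (\<kappa> / (K * E + 1))"
  have KE: "0 < K * E + 1"
    using E K by (simp add: add_nonneg_pos)
  have int_pop: "integrable (measure_pmf q) (\<lambda>y. real (popsize y))"
    by (rule integrable_popsize[OF integrable_popsize_square[OF exp \<theta>]])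
  have int_d: "integrable (measure_pmf q) (\<lambda>y. d \<bullet> rvec y)"
    by (rule Bochner_Integration.integrable_bound[OF integrable_mult_right[OF int_pop, of B]])
      (use B in \<open>auto simp: abs_mult\<close>)
  show ?thesis
  proof (rule that)
    show "t\<^sub>0 > 0"
      using \<theta> B \<kappa> KE by (simp add: t\<^sub>0_def)
    fix t assume t: "0 < t" "t \<le> t\<^sub>0"
    have tB: "t * B \<le> \<theta> / 2"
      using t B by (simp add: t\<^sub>0_def field_simps)
    have td: "\<bar>t * (d \<bullet> rvec y)\<bar> \<le> \<theta> / 2 * popsize y" for y
    proof -
      have "\<bar>t * (d \<bullet> rvec y)\<bar> \<le> t * (B * popsize y)"
        unfolding abs_mult using t B by (intro mult_mono) auto
      also have "\<dots> \<le> \<theta> / 2 * popsize y"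
        using mult_right_mono[OF tB, of "popsize y"] by (simp add: mult.assoc)
      finally show ?thesis .
    qed
    have point: "exp (t * (d \<bullet> rvec y)) \<le> 1 + t * (d \<bullet> rvec y) + t\<^sup>2 * K * exp (\<theta> * popsize y)" for y
    proof -
      have "(t * (d \<bullet> rvec y))\<^sup>2 \<le> t\<^sup>2 * B\<^sup>2 * (real (popsize y))\<^sup>2"
        using B(2)[of y] abs_le_square_iff[of "d \<bullet> rvec y" "B * popsize y"] B(1)
        by (auto simp: power_mult_distrib mult.assoc intro!: mult_left_mono)
      also have "\<dots> \<le> t\<^sup>2 * B\<^sup>2 * (8 / \<theta>\<^sup>2 * exp (\<theta> / 2 * popsize y))"
      proof (intro mult_left_mono)
        have "(\<theta> / 2 * popsize y)\<^sup>2 / 2 \<le> exp (\<theta> / 2 * popsize y)"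
          using exp_lower_Taylor_quadratic[of "\<theta> / 2 * popsize y"] \<theta>
          by (smt (verit) divide_nonneg_nonneg mult_nonneg_nonneg of_nat_0_le_iff)
        then show "(real (popsize y))\<^sup>2 \<le> 8 / \<theta>\<^sup>2 * exp (\<theta> / 2 * popsize y)"
          using \<theta> by (simp add: field_simps power2_eq_square)
      qed auto
      finally have sq: "(t * (d \<bullet> rvec y))\<^sup>2 \<le> t\<^sup>2 * K * exp (\<theta> / 2 * popsize y)"
        by (simp add: K_def mult_ac)
      have "(t * (d \<bullet> rvec y))\<^sup>2 * exp \<bar>t * (d \<bullet> rvec y)\<bar> \<le>
          (t\<^sup>2 * K * exp (\<theta> / 2 * popsize y)) * exp (\<theta> / 2 * popsize y)"
        using td[of y] K by (intro mult_mono sq) auto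
      also have "\<dots> = t\<^sup>2 * K * exp (\<theta> * popsize y)"
        by (simp add: mult.assoc flip: exp_add)
      finally show ?thesis
        using exp_le_second_order[of "t * (d \<bullet> rvec y)"] by linarith
    qed
    have int_rhs: "integrable (measure_pmf q) (\<lambda>y. 1 + t * (d \<bullet> rvec y) + t\<^sup>2 * K * exp (\<theta> * popsize y))"
      using int_d exp by simp
    show int: "integrable (measure_pmf q) (\<lambda>y. exp (t * (d \<bullet> rvec y)))"
      using int_rhs by (rule Bochner_Integration.integrable_bound)
        (auto intro!: AE_pmfI order_trans[OF point] abs_ge_self)
    have "measure_pmf.expectation q (\<lambda>y. exp (t * (d \<bullet> rvec y))) \<le>
        measure_pmf.expectation q (\<lambda>y. 1 + t * (d \<bullet> rvec y) + t\<^sup>2 * K * exp (\<theta> * popsize y))"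
      by (intro integral_mono int int_rhs point)
    also have "\<dots> = 1 + (t * \<mu> + t * (t * (K * E)))"
      using int_d exp \<mu> by (simp add: E_def power2_eq_square)
    also have "t * (K * E) \<le> \<kappa>"
    proof -
      have "t * (K * E + 1) \<le> \<kappa>"
        using t KE by (simp add: t\<^sub>0_def field_simps)
      then show ?thesis
        using t by (simp add: algebra_simps)
    qed
    also have "1 + (t * \<mu> + t * \<kappa>) \<le> exp (t * \<mu> + t * \<kappa>)"
      by (rule exp_ge_add_one_self)
    finally show "measure_pmf.expectation q (\<lambda>y. exp (t * (d \<bullet> rvec y))) \<le> exp (t * (\<mu> + \<kappa>))"
      using t by (simp add: distrib_left)
  qed
qed

lemma exponential_bound_add:
  fixes C\<^sub>1 C\<^sub>2 \<delta>\<^sub>1 \<delta>\<^sub>2 :: real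
  assumes "C\<^sub>1 > 0" "C\<^sub>2 > 0"
  shows "C\<^sub>1 * exp (- \<delta>\<^sub>1 * real n) + C\<^sub>2 * exp (- \<delta>\<^sub>2 * real n) \<le> (C\<^sub>1 + C\<^sub>2) * exp (- min \<delta>\<^sub>1 \<delta>\<^sub>2 * real n)"
  unfolding distrib_right using assms by (intro add_mono mult_left_mono) (auto intro!: mult_right_mono)

section \<open>Deviations of one step and contraction of directions\<close>

locale light_tailed_gwi = growing_gwi +
  fixes M :: "real ^ 2 ^ 2" and \<theta> :: real
  assumes \<theta>: "\<theta> > 0"
    and exp_offspring: "\<And>i. integrable (measure_pmf (p i)) (\<lambda>y. exp (\<theta> * real (popsize y)))"
    and exp_immigration: "integrable (measure_pmf h) (\<lambda>y. exp (\<theta> * real (popsize y)))"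
    and mean: "\<And>i j. M $ i $ j = measure_pmf.expectation (p i) (\<lambda>y. real (y $ j))"
begin

lemma expectation_inner_offspring: "measure_pmf.expectation (p i) (\<lambda>y. d \<bullet> rvec y) = (M *v d) $ i"
proof -
  have "integrable (measure_pmf (p i)) (\<lambda>y. real (y $ j))" for j
    by (rule Bochner_Integration.integrable_bound[OF integrable_popsize[OF integrable_popsize_square[OF exp_offspring \<theta>]]])
      (auto simp: nth_le_popsize)
  then show ?thesis
    by (simp add: inner_rvec sum_2 matrix_vector_mult_def mean mult.commute)
qed

text \<open>Chernoff's bound: half of \<eta> is spent on the moment bounds of the litters, the other
  half remains in the rate \<open>t * \<eta> / 2\<close>. Immigration affects only the
  constant.\<close>

lemma step_upper_deviation:
  fixes \<eta> :: real
  assumes \<eta>: "\<eta> > 0"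
  obtains C \<delta> :: real where "C > 0" "\<delta> > 0"
    "\<And>x. measure_pmf.prob (step x) {y. d \<bullet> rvec y - (M *v d) \<bullet> rvec x > \<eta> * popsize x} \<le> C * exp (- \<delta> * popsize x)"
proof -
  have "\<exists>t\<^sub>0>0. \<forall>t. 0 < t \<and> t \<le> t\<^sub>0 \<longrightarrow> integrable (measure_pmf (p i)) (\<lambda>y. exp (t * (d \<bullet> rvec y))) \<and>
      measure_pmf.expectation (p i) (\<lambda>y. exp (t * (d \<bullet> rvec y))) \<le> exp (t * ((M *v d) $ i + \<eta> / 2))" for i
    using \<eta> by (rule_tac exp_moment_bound[OF exp_offspring \<theta> expectation_inner_offspring, of "\<eta> / 2"]) auto
  then obtain T where T: "\<And>i. T i > 0"
    "\<And>i t. 0 < t \<Longrightarrow> t \<le> T i \<Longrightarrow> integrable (measure_pmf (p i)) (\<lambda>y. exp (t * (d \<bullet> rvec y)))"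
    "\<And>i t. 0 < t \<Longrightarrow> t \<le> T i \<Longrightarrow>
      measure_pmf.expectation (p i) (\<lambda>y. exp (t * (d \<bullet> rvec y))) \<le> exp (t * ((M *v d) $ i + \<eta> / 2))"
    by metis
  obtain T' where T': "T' > 0"
    "\<And>t. 0 < t \<Longrightarrow> t \<le> T' \<Longrightarrow> integrable (measure_pmf h) (\<lambda>y. exp (t * (d \<bullet> rvec y)))"
    by (rule exp_moment_bound[OF exp_immigration \<theta> refl, of 1]) auto
  \<comment> \<open>One exponent has to serve both types and the immigration.\<close>
  define t where "t = min T' (min (T 1) (T 2))"
  have t: "0 < t" "t \<le> T'" "t \<le> T i" for i
    using T(1) T'(1) exhaust_2[of i] by (auto simp: t_def)
  define s :: "real ^ 2" where "s = (\<chi> k. exp ((t *\<^sub>R d) $ k))"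
  have monom: "monom_at s y = exp (t * (d \<bullet> rvec y))" for y
    unfolding s_def monom_at_exp by simp
  have s: "0 \<le> s $ k" for k
    by (simp add: s_def)
  define a :: "real ^ 2" where "a = (\<chi> i. t * ((M *v d) $ i + \<eta> / 2))"
  have int: "integrable (measure_pmf (p i)) (monom_at s)" "integrable (measure_pmf h) (monom_at s)" for i
    using T(2) T'(2) t by (auto simp: monom[abs_def])
  have pgf_s: "0 \<le> pgf (p i) s" "pgf (p i) s \<le> exp (a $ i)" for i
    using T(3)[OF t(1,3), of i] by (simp_all add: pgf_def monom[abs_def] a_def)
  have bound: "pgf (step x) s \<le> exp (a \<bullet> rvec x) * pgf h s" for x
  proof -
    have "monom_at (\<chi> i. pgf (p i) s) x \<le> monom_at (\<chi> i. exp (a $ i)) x"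
      unfolding monom_at_def using pgf_s by (intro prod_mono) (auto intro: power_mono)
    then show ?thesis
      by (subst pgf_gwi_step[OF s int]) (auto simp: monom_at_exp pgf_def monom intro!: mult_right_mono)
  qed
  have a: "a \<bullet> rvec x = t * ((M *v d) \<bullet> rvec x) + t * \<eta> / 2 * popsize x" for x
    by (simp add: a_def inner_rvec sum_2 popsize_def algebra_simps)
  show ?thesis
  proof (rule that[of "pgf h s + 1" "t * \<eta> / 2"])
    show "pgf h s + 1 > 0"
      by (simp add: pgf_def monom add_nonneg_pos)
    show "t * \<eta> / 2 > 0"
      using t \<eta> by simp
    fix x
    let ?S = "{y. d \<bullet> rvec y - (M *v d) \<bullet> rvec x > \<eta> * popsize x}"
    \<comment> \<open>Normalizes the exponential so that the product is at least one on the
      event.\<close>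
    let ?c = "exp (- (t * ((M *v d) \<bullet> rvec x) + t * \<eta> * popsize x))"
    have "measure_pmf.prob (step x) ?S = measure_pmf.expectation (step x) (indicator ?S)"
      by simp
    also have "\<dots> \<le> measure_pmf.expectation (step x) (\<lambda>y. monom_at s y * ?c)"
    proof (intro integral_mono integrable_mult_left integrable_gwi_step_monom s int integrable_real_indicator)
      fix y
      show "indicator ?S y \<le> monom_at s y * ?c"
      proof (cases "y \<in> ?S")
        case True
        then have "0 \<le> t * (d \<bullet> rvec y - (M *v d) \<bullet> rvec x - \<eta> * popsize x)"
          using t by simp
        then have "0 \<le> t * (d \<bullet> rvec y) - (t * ((M *v d) \<bullet> rvec x) + t * \<eta> * popsize x)"
          by (simp add: algebra_simps)
        then have "1 \<le> exp (t * (d \<bullet> rvec y) - (t * ((M *v d) \<bullet> rvec x) + t * \<eta> * popsize x))"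
          by simp
        then show ?thesis
          using True by (simp add: monom flip: exp_add)
      qed (simp add: monom)
    qed (auto simp: measure_pmf.emeasure_eq_measure)
    also have "\<dots> = pgf (step x) s * ?c"
      by (simp add: pgf_def)
    also have "\<dots> \<le> exp (a \<bullet> rvec x) * pgf h s * ?c"
      by (intro mult_right_mono bound) auto
    also have "\<dots> = pgf h s * exp (- (t * \<eta> / 2) * popsize x)"
      by (simp add: a field_simps flip: exp_add)
    also have "\<dots> \<le> (pgf h s + 1) * exp (- (t * \<eta> / 2) * popsize x)"
      by (intro mult_right_mono) auto
    finally show "measure_pmf.prob (step x) ?S \<le> (pgf h s + 1) * exp (- (t * \<eta> / 2) * popsize x)" .
  qed
qed

proposition step_deviation:
  fixes \<eta> :: real
  assumes \<eta>: "\<eta> > 0"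
  obtains C \<delta> :: real where "C > 0" "\<delta> > 0"
    "\<And>x. measure_pmf.prob (step x) {y. \<bar>d \<bullet> rvec y - (M *v d) \<bullet> rvec x\<bar> > \<eta> * popsize x} \<le> C * exp (- \<delta> * popsize x)"
proof -
  obtain C\<^sub>1 \<delta>\<^sub>1 :: real where 1: "C\<^sub>1 > 0" "\<delta>\<^sub>1 > 0"
    "\<And>x. measure_pmf.prob (step x) {y. d \<bullet> rvec y - (M *v d) \<bullet> rvec x > \<eta> * popsize x} \<le> C\<^sub>1 * exp (- \<delta>\<^sub>1 * popsize x)"
    using step_upper_deviation[OF \<eta>] by blast
  obtain C\<^sub>2 \<delta>\<^sub>2 :: real where 2: "C\<^sub>2 > 0" "\<delta>\<^sub>2 > 0"
    "\<And>x. measure_pmf.prob (step x) {y. (- d) \<bullet> rvec y - (M *v (- d)) \<bullet> rvec x > \<eta> * popsize x} \<le> C\<^sub>2 * exp (- \<delta>\<^sub>2 * popsize x)"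
    using step_upper_deviation[OF \<eta>] by blast
  show ?thesis
  proof (rule that[of "C\<^sub>1 + C\<^sub>2" "min \<delta>\<^sub>1 \<delta>\<^sub>2"])
    fix x
    have neg: "(M *v (- d)) \<bullet> rvec x = - ((M *v d) \<bullet> rvec x)"
      by (simp add: matrix_vector_mult_def inner_rvec sum_2 algebra_simps)
    have "{y. \<bar>d \<bullet> rvec y - (M *v d) \<bullet> rvec x\<bar> > \<eta> * popsize x} \<subseteq>
        {y. d \<bullet> rvec y - (M *v d) \<bullet> rvec x > \<eta> * popsize x} \<union>
        {y. (- d) \<bullet> rvec y - (M *v (- d)) \<bullet> rvec x > \<eta> * popsize x}"
      using neg by (auto simp: abs_if split: if_splits)
    then have "measure_pmf.prob (step x) {y. \<bar>d \<bullet> rvec y - (M *v d) \<bullet> rvec x\<bar> > \<eta> * popsize x} \<le>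
      C\<^sub>1 * exp (- \<delta>\<^sub>1 * popsize x) + C\<^sub>2 * exp (- \<delta>\<^sub>2 * popsize x)"
      by (intro order_trans[OF measure_pmf.finite_measure_mono order_trans[OF measure_Un_le add_mono[OF 1(3) 2(3)]]]) auto
    also have "\<dots> \<le> (C\<^sub>1 + C\<^sub>2) * exp (- min \<delta>\<^sub>1 \<delta>\<^sub>2 * popsize x)"
      by (rule exponential_bound_add[OF 1(1) 2(1)])
    finally show "measure_pmf.prob (step x) {y. \<bar>d \<bullet> rvec y - (M *v d) \<bullet> rvec x\<bar> > \<eta> * popsize x} \<le>
      (C\<^sub>1 + C\<^sub>2) * exp (- min \<delta>\<^sub>1 \<delta>\<^sub>2 * popsize x)" .
  qed (use 1 2 in auto)
qed

text \<open>Off an event of exponentially small probability, one step of the process contracts the ratio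
  \<open>\<bar>w \<bullet> x\<bar> / (u \<bullet> x)\<close> by nearly the factor \<open>\<bar>\<mu>\<bar> / \<rho>\<close>.\<close>

proposition law_direction_deviation:
  assumes w: "M *v w = \<mu> *s w" and u: "M *v u = \<rho> *s u" "\<And>k. u $ k > 0"
    and \<mu>: "\<bar>\<mu>\<bar> < \<rho>" and \<epsilon>: "\<epsilon> > 0"
  obtains k\<^sub>0 :: nat and C \<delta> :: real where "k\<^sub>0 > 0" "C > 0" "\<delta> > 0"
    "\<And>x. measure_pmf.prob (law k\<^sub>0 x) {y. \<bar>w \<bullet> rvec y\<bar> > \<epsilon> * (u \<bullet> rvec y)} \<le> C * exp (- \<delta> * popsize x)"
proof -
  have \<rho>: "\<rho> > 0"
    using \<mu> by linarith
  \<comment> \<open>The midpoint of \<open>\<bar>\<mu>\<bar> / \<rho>\<close> and 1.\<close>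
  define q where "q = (\<bar>\<mu>\<bar> + \<rho>) / (2 * \<rho>)"
  have q: "0 < q" "q < 1" "\<bar>\<mu>\<bar> < q * \<rho>"
    using \<mu> \<rho> by (auto simp: q_def field_simps)
  \<comment> \<open>The error allowed per step, relative to \<open>u \<bullet> rvec x\<close>. The
    three bounds keep \<open>\<rho> - \<eta>\<close> at least \<open>\<rho> / 2\<close>, give
    \<open>\<bar>\<mu>\<bar> \<le> q * (\<rho> - \<eta>)\<close>, and let the additive error fit
    into the increment \<open>(1 - q) * (\<epsilon> / 2)\<close> of the recursion for
    \<open>r\<close>.\<close>
  define \<eta> where "\<eta> = min (\<rho> / 2) (min (q * \<rho> - \<bar>\<mu>\<bar>) ((1 - q) * (\<epsilon> / 2) * (\<rho> / 2)))"
  have \<eta>: "\<eta> > 0" "\<eta> \<le> \<rho> / 2" "\<eta> \<le> q * \<rho> - \<bar>\<mu>\<bar>" "\<eta> \<le> (1 - q) * (\<epsilon> / 2) * (\<rho> / 2)"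
  proof -
    show "\<eta> > 0"
      using q \<rho> \<epsilon> by (simp add: \<eta>_def)
  qed (simp_all only: \<eta>_def min.cobounded1 min.cobounded2 min.coboundedI1 min.coboundedI2)
  define m where "m = min (u $ 1) (u $ 2)"
  have m: "m > 0" "m \<le> u $ k" for k
    using u(2) exhaust_2[of k] by (auto simp: m_def)
  have um: "m * popsize x \<le> u \<bullet> rvec x" for x
    by (rule inner_rvec_ge) (rule m)
  have u0: "0 \<le> u \<bullet> rvec x" for x
    using um[of x] m(1) by (smt (verit) mult_nonneg_nonneg of_nat_0_le_iff)
  obtain C\<^sub>1 \<delta>\<^sub>1 :: real where 1: "C\<^sub>1 > 0" "\<delta>\<^sub>1 > 0"
    "\<And>x. measure_pmf.prob (step x) {y. \<bar>w \<bullet> rvec y - (M *v w) \<bullet> rvec x\<bar> > \<eta> * m * popsize x} \<le> C\<^sub>1 * exp (- \<delta>\<^sub>1 * popsize x)"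
    using step_deviation[of "\<eta> * m" w] \<eta>(1) m(1) by auto
  obtain C\<^sub>2 \<delta>\<^sub>2 :: real where 2: "C\<^sub>2 > 0" "\<delta>\<^sub>2 > 0"
    "\<And>x. measure_pmf.prob (step x) {y. \<bar>u \<bullet> rvec y - (M *v u) \<bullet> rvec x\<bar> > \<eta> * m * popsize x} \<le> C\<^sub>2 * exp (- \<delta>\<^sub>2 * popsize x)"
    using step_deviation[of "\<eta> * m" u] \<eta>(1) m(1) by auto
  define C \<delta> where "C = C\<^sub>1 + C\<^sub>2" and "\<delta> = min \<delta>\<^sub>1 \<delta>\<^sub>2"
  have C: "C > 0" and \<delta>: "\<delta> > 0"
    using 1 2 by (auto simp: C_def \<delta>_def)
  \<comment> \<open>Bounds the ratio for every starting population, since the entries of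
    \<open>u\<close> are at least \<open>m\<close>; this makes \<open>k\<^sub>0\<close>
    uniform.\<close>
  define r\<^sub>0 where "r\<^sub>0 = (\<bar>w $ 1\<bar> + \<bar>w $ 2\<bar>) / m"
  have r0: "0 \<le> r\<^sub>0"
    using m(1) by (simp add: r\<^sub>0_def)
  \<comment> \<open>Iterates of an affine contraction with fixed point
    \<open>\<epsilon> / 2\<close>, which leaves a margin below \<epsilon>.\<close>
  define r where "r n = q ^ n * r\<^sub>0 + (1 - q ^ n) * (\<epsilon> / 2)" for n
  have r_nonneg: "0 \<le> r n" for n
    unfolding r_def using q r0 \<epsilon> by (intro add_nonneg_nonneg mult_nonneg_nonneg) (auto intro: power_le_one)
  have r_Suc: "r (Suc n) = q * r n + (1 - q) * (\<epsilon> / 2)" for n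
    by (simp add: r_def field_simps)
  define bad where "bad n = {y. \<bar>w \<bullet> rvec y\<bar> > r n * (u \<bullet> rvec y)}" for n
  have one_step: "measure_pmf.prob (step x) (bad (Suc n)) \<le> C * exp (- \<delta> * popsize x)" if "x \<notin> bad n" for n x
  proof -
    let ?S = "\<lambda>d. {y. \<bar>d \<bullet> rvec y - (M *v d) \<bullet> rvec x\<bar> > \<eta> * m * popsize x}"
    \<comment> \<open>If neither \<open>w\<close> nor \<open>u\<close> deviates, the numerator is at
      most \<open>(\<bar>\<mu>\<bar> * r n + \<eta>) * (u \<bullet> rvec x)\<close> and the
      denominator at least \<open>(\<rho> - \<eta>) * (u \<bullet> rvec x)\<close>.\<close>
    have "bad (Suc n) \<subseteq> ?S w \<union> ?S u"
    proof (rule subsetI, rule ccontr)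
      fix y assume y: "y \<in> bad (Suc n)" "y \<notin> ?S w \<union> ?S u"
      have um': "\<eta> * m * popsize x \<le> \<eta> * (u \<bullet> rvec x)"
        using mult_left_mono[OF um[of x], of \<eta>] \<eta>(1) by (simp add: mult.assoc)
      have yw: "\<bar>w \<bullet> rvec y - \<mu> * (w \<bullet> rvec x)\<bar> \<le> \<eta> * (u \<bullet> rvec x)"
        and yu: "\<bar>u \<bullet> rvec y - \<rho> * (u \<bullet> rvec x)\<bar> \<le> \<eta> * (u \<bullet> rvec x)"
        using y(2) um' by (auto simp: w u(1) scalar_mult_eq_scaleR)
      have "\<bar>w \<bullet> rvec y\<bar> \<le> \<bar>\<mu>\<bar> * \<bar>w \<bullet> rvec x\<bar> + \<eta> * (u \<bullet> rvec x)"
        using yw by (simp flip: abs_mult)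
      also have "\<bar>\<mu>\<bar> * \<bar>w \<bullet> rvec x\<bar> \<le> \<bar>\<mu>\<bar> * (r n * (u \<bullet> rvec x))"
        using that by (intro mult_left_mono) (auto simp: bad_def)
      also have "\<bar>\<mu>\<bar> * (r n * (u \<bullet> rvec x)) + \<eta> * (u \<bullet> rvec x) = (\<bar>\<mu>\<bar> * r n + \<eta>) * (u \<bullet> rvec x)"
        by (simp add: algebra_simps)
      also have "\<dots> \<le> (r (Suc n) * (\<rho> - \<eta>)) * (u \<bullet> rvec x)"
      proof (intro mult_right_mono u0)
        have "q * \<eta> \<le> 1 * \<eta>"
          using \<eta>(1) q by (intro mult_right_mono) auto
        then have "\<bar>\<mu>\<bar> \<le> q * (\<rho> - \<eta>)"
          using \<eta>(3) by (simp add: algebra_simps)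
        then have "\<bar>\<mu>\<bar> * r n \<le> q * (\<rho> - \<eta>) * r n"
          using r_nonneg by (intro mult_right_mono)
        moreover have "\<eta> \<le> (1 - q) * (\<epsilon> / 2) * (\<rho> - \<eta>)"
          using \<eta>(2) q \<epsilon> by (intro order_trans[OF \<eta>(4)] mult_left_mono) auto
        moreover have "r (Suc n) * (\<rho> - \<eta>) = q * (\<rho> - \<eta>) * r n + (1 - q) * (\<epsilon> / 2) * (\<rho> - \<eta>)"
          unfolding r_Suc by algebra
        ultimately show "\<bar>\<mu>\<bar> * r n + \<eta> \<le> r (Suc n) * (\<rho> - \<eta>)"
          by linarith
      qed
      also have "\<dots> \<le> r (Suc n) * (u \<bullet> rvec y)"
        unfolding mult.assoc using yu r_nonneg by (intro mult_left_mono) (auto simp: algebra_simps)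
      finally show False
        using y(1) by (simp add: bad_def)
    qed
    then have "measure_pmf.prob (step x) (bad (Suc n)) \<le> C\<^sub>1 * exp (- \<delta>\<^sub>1 * popsize x) + C\<^sub>2 * exp (- \<delta>\<^sub>2 * popsize x)"
      by (intro order_trans[OF measure_pmf.finite_measure_mono order_trans[OF measure_Un_le add_mono[OF 1(3) 2(3)]]]) auto
    also have "\<dots> \<le> C * exp (- \<delta> * popsize x)"
      unfolding C_def \<delta>_def by (rule exponential_bound_add[OF 1(1) 2(1)])
    finally show ?thesis .
  qed
  \<comment> \<open>A union bound over the steps: since the population never shrinks, the failure
    probability of each step is controlled by the initial size.\<close>
  have iter: "measure_pmf.prob (law n x) (bad n) \<le> n * (C * exp (- \<delta> * popsize x))" for n x
  proof (induction n)
    case 0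
    have "\<bar>w \<bullet> rvec x\<bar> \<le> (\<bar>w $ 1\<bar> + \<bar>w $ 2\<bar>) * popsize x"
    proof (rule inner_rvec_le)
      show "\<bar>w $ k\<bar> \<le> \<bar>w $ 1\<bar> + \<bar>w $ 2\<bar>" for k
        using exhaust_2[of k] by auto
    qed
    also have "\<dots> = r\<^sub>0 * (m * popsize x)"
      using m(1) by (simp add: r\<^sub>0_def)
    also have "\<dots> \<le> r\<^sub>0 * (u \<bullet> rvec x)"
      by (intro mult_left_mono um r0)
    finally have "x \<notin> bad 0"
      by (simp add: bad_def r_def)
    then show ?case
      by simp
  next
    case (Suc n)
    let ?c = "C * exp (- \<delta> * popsize x)"
    have c: "0 \<le> ?c"
      using C by simp
    have "measure_pmf.prob (law (Suc n) x) (bad (Suc n)) =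
        measure_pmf.expectation (law n x) (\<lambda>z. measure_pmf.prob (step z) (bad (Suc n)))"
      by (simp add: prob_bind_pmf)
    \<comment> \<open>Populations that are already bad are charged with probability one.\<close>
    also have "\<dots> \<le> measure_pmf.expectation (law n x) (\<lambda>z. indicator (bad n) z + ?c)"
    proof (rule integral_mono_AE)
      show "AE z in measure_pmf (law n x). measure_pmf.prob (step z) (bad (Suc n)) \<le> indicator (bad n) z + ?c"
      proof (rule AE_pmfI)
        fix z assume z: "z \<in> set_pmf (law n x)"
        show "measure_pmf.prob (step z) (bad (Suc n)) \<le> indicator (bad n) z + ?c"
        proof (cases "z \<in> bad n")
          case False
          have "C * exp (- \<delta> * popsize z) \<le> ?c"
            using popsize_law[OF z] \<delta> C by (intro mult_left_mono) auto
          then show ?thesis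
            using one_step[OF False] False by simp
        next
          case True
          have "measure_pmf.prob (step z) (bad (Suc n)) \<le> 1 + ?c"
            using c measure_pmf.prob_le_1[of "step z" "bad (Suc n)"] by linarith
          then show ?thesis
            using True by simp
        qed
      qed
    qed (auto intro!: measure_pmf.integrable_const_bound[where B = 1] integrable_real_indicator
        Bochner_Integration.integrable_add simp: measure_pmf.emeasure_eq_measure)
    also have "\<dots> = measure_pmf.prob (law n x) (bad n) + ?c"
      by (subst Bochner_Integration.integral_add)
        (auto intro!: integrable_real_indicator simp: measure_pmf.emeasure_eq_measure)
    also have "\<dots> \<le> n * ?c + ?c"
      using Suc by simp
    finally show ?case
      by (simp add: algebra_simps)
  qed
  have "(\<lambda>n. q ^ n * r\<^sub>0) \<longlonglongrightarrow> 0 * r\<^sub>0"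
    using q by (intro tendsto_mult LIMSEQ_power_zero tendsto_const) auto
  then have "\<forall>\<^sub>F n in sequentially. q ^ n * r\<^sub>0 < \<epsilon> / 2"
    using \<epsilon> by (intro order_tendstoD) auto
  then obtain k where k: "\<And>n. n \<ge> k \<Longrightarrow> q ^ n * r\<^sub>0 < \<epsilon> / 2"
    by (auto simp: eventually_sequentially)
  show ?thesis
  proof (rule that[of "Suc k" "Suc k * C" \<delta>])
    fix x
    have "(1 - q ^ Suc k) * (\<epsilon> / 2) \<le> 1 * (\<epsilon> / 2)"
      using q \<epsilon> by (intro mult_right_mono) auto
    with k[of "Suc k"] have "r (Suc k) \<le> \<epsilon>"
      by (simp add: r_def)
    then have "r (Suc k) * (u \<bullet> rvec y) \<le> \<epsilon> * (u \<bullet> rvec y)" for y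
      by (intro mult_right_mono u0)
    then have "{y. \<bar>w \<bullet> rvec y\<bar> > \<epsilon> * (u \<bullet> rvec y)} \<subseteq> bad (Suc k)"
      unfolding bad_def by (blast intro: le_less_trans)
    then have "measure_pmf.prob (law (Suc k) x) {y. \<bar>w \<bullet> rvec y\<bar> > \<epsilon> * (u \<bullet> rvec y)} \<le>
        measure_pmf.prob (law (Suc k) x) (bad (Suc k))"
      by (intro measure_pmf.finite_measure_mono) auto
    also have "\<dots> \<le> Suc k * C * exp (- \<delta> * popsize x)"
      using iter[of "Suc k" x] by (simp add: mult.assoc)
    finally show "measure_pmf.prob (law (Suc k) x) {y. \<bar>w \<bullet> rvec y\<bar> > \<epsilon> * (u \<bullet> rvec y)} \<le>
        Suc k * C * exp (- \<delta> * popsize x)" .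
  qed (use C \<delta> in auto)
qed

end

section \<open>Passage to the limit\<close>

lemma vec_2_orthogonal_eigenvector:
  fixes M :: "real ^ 2 ^ 2" and v w :: "real ^ 2"
  assumes v: "v v* M = \<rho> *s v" "\<forall>k. v $ k > 0" and w: "v \<bullet> w = 0" "w \<noteq> 0"
  obtains \<mu> where "M *v w = \<mu> *s w"
proof -
  have v0: "v $ 1 > 0" "v $ 2 > 0"
    using v by auto
  have orth: "v $ 1 * w $ 1 + v $ 2 * w $ 2 = 0"
    using w(1) by (simp add: inner_vec_def sum_2)
  \<comment> \<open>The orthogonal complement of a left eigenvector is invariant under
    \<open>M\<close>; in dimension two it is a line, so \<open>w\<close> has to be an
    eigenvector.\<close>
  have "v \<bullet> (M *v w) = (v v* M) \<bullet> w"
    by (rule dot_lmul_matrix[symmetric])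
  also have "\<dots> = 0"
    using w(1) by (simp add: v(1) scalar_mult_eq_scaleR)
  finally have orth': "v $ 1 * (M *v w) $ 1 + v $ 2 * (M *v w) $ 2 = 0"
    by (simp add: inner_vec_def sum_2)
  have w1: "w $ 1 \<noteq> 0"
  proof
    assume "w $ 1 = 0"
    moreover from this have "w $ 2 = 0"
      using orth v0 by simp
    ultimately show False
      using w(2) by (simp add: vec_eq_iff forall_2)
  qed
  let ?\<mu> = "(M *v w) $ 1 / w $ 1"
  have "v $ 2 * ((M *v w) $ 2 * w $ 1) = v $ 2 * ((M *v w) $ 1 * w $ 2)"
    using orth orth' by algebra
  then have "(M *v w) $ 2 * w $ 1 = (M *v w) $ 1 * w $ 2"
    using v0 by simp
  then have "M *v w = ?\<mu> *s w"
    using w1 by (simp add: vec_eq_iff forall_2 field_simps)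
  then show ?thesis
    by (rule that)
qed

lemma mat_power_eigenvector: "M *v z = \<mu> *s z \<Longrightarrow> mat_power M n *v z = \<mu> ^ n *s z"
  by (induction n)
    (simp_all add: matrix_vector_mul_assoc[symmetric] vector_scalar_commute vector_smult_assoc mult.commute)

text \<open>A vector orthogonal to \<open>v\<close> has entries of both signs, so applying the positive matrix
  \<open>M ^ n\<close> involves cancellation.\<close>

lemma second_eigenvalue_less:
  fixes M :: "real ^ 2 ^ 2" and u v w :: "real ^ 2"
  assumes pos: "positively_regular M"
    and v: "\<forall>k. v $ k > 0" and u: "M *v u = \<rho> *s u" "\<forall>k. u $ k > 0" and \<rho>: "\<rho> > 0"
    and w: "v \<bullet> w = 0" "w \<noteq> 0" "M *v w = \<mu> *s w"
  shows "\<bar>\<mu>\<bar> < \<rho>"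
proof -
  obtain n where n: "\<And>i j. mat_power M n $ i $ j > 0"
    using pos by (auto simp: positively_regular_def)
  define N where "N = mat_power M n"
  have N: "N $ i $ j > 0" for i j
    using n by (simp add: N_def)
  have v0: "v $ 1 > 0" "v $ 2 > 0" and u0: "u $ k > 0" for k
    using v u by auto
  have orth: "v $ 1 * w $ 1 = - (v $ 2 * w $ 2)"
    using w(1) by (simp add: inner_vec_def sum_2)
  have "w $ 1 \<noteq> 0 \<or> w $ 2 \<noteq> 0"
    using w(2) by (auto simp: vec_eq_iff forall_2)
  then have signs: "w $ 1 * w $ 2 < 0"
  proof -
    have "v $ 1 * (w $ 1 * w $ 2) = - (v $ 2 * (w $ 2)\<^sup>2)"
      using orth by algebra
    moreover have "w $ 2 \<noteq> 0"
      using orth v0 \<open>w $ 1 \<noteq> 0 \<or> w $ 2 \<noteq> 0\<close> by auto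
    ultimately have "v $ 1 * (w $ 1 * w $ 2) < 0"
      using v0 by simp
    then show ?thesis
      using v0 by (simp add: mult_less_0_iff)
  qed
  \<comment> \<open>The maximum norm of \<open>w\<close> weighted by \<open>u\<close>;
    \<open>i\<close> below is a coordinate at which it is attained.\<close>
  define R where "R = max (\<bar>w $ 1\<bar> / u $ 1) (\<bar>w $ 2\<bar> / u $ 2)"
  have R: "\<bar>w $ k\<bar> \<le> R * u $ k" for k
    using exhaust_2[of k] u0[of k] by (auto simp: R_def pos_divide_le_eq[symmetric])
  obtain i where i: "\<bar>w $ i\<bar> = R * u $ i"
  proof (cases "\<bar>w $ 1\<bar> / u $ 1 \<ge> \<bar>w $ 2\<bar> / u $ 2")
    case True
    then show ?thesis
      using u0[of 1] by (intro that[of 1]) (auto simp: R_def max_def)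
  next
    case False
    then show ?thesis
      using u0[of 2] by (intro that[of 2]) (auto simp: R_def max_def)
  qed
  have Nw: "\<mu> ^ n * w $ i = N $ i $ 1 * w $ 1 + N $ i $ 2 * w $ 2"
    using arg_cong[OF mat_power_eigenvector[OF w(3), of n], of "\<lambda>z. z $ i"]
    by (simp add: matrix_vector_mult_def sum_2 N_def)
  have Nu: "\<rho> ^ n * u $ i = N $ i $ 1 * u $ 1 + N $ i $ 2 * u $ 2"
    using arg_cong[OF mat_power_eigenvector[OF u(1), of n], of "\<lambda>z. z $ i"]
    by (simp add: matrix_vector_mult_def sum_2 N_def)
  have "\<bar>\<mu>\<bar> ^ n * \<bar>w $ i\<bar> = \<bar>N $ i $ 1 * w $ 1 + N $ i $ 2 * w $ 2\<bar>"
    by (simp add: Nw[symmetric] abs_mult power_abs)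
  also have "\<dots> < N $ i $ 1 * \<bar>w $ 1\<bar> + N $ i $ 2 * \<bar>w $ 2\<bar>"
  proof -
    have "w $ 1 > 0 \<and> w $ 2 < 0 \<or> w $ 1 < 0 \<and> w $ 2 > 0"
      using signs by (auto simp: mult_less_0_iff)
    then show ?thesis
    proof (elim disjE conjE)
      assume "w $ 1 > 0" "w $ 2 < 0"
      moreover from this have "N $ i $ 1 * w $ 1 > 0" "N $ i $ 2 * w $ 2 < 0"
        using N by (simp_all add: mult_pos_neg)
      ultimately show ?thesis
        by simp
    next
      assume "w $ 1 < 0" "w $ 2 > 0"
      moreover from this have "N $ i $ 1 * w $ 1 < 0" "N $ i $ 2 * w $ 2 > 0"
        using N by (simp_all add: mult_pos_neg)
      ultimately show ?thesis
        by simp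
    qed
  qed
  also have "\<dots> \<le> N $ i $ 1 * (R * u $ 1) + N $ i $ 2 * (R * u $ 2)"
    using N by (intro add_mono mult_left_mono R) (auto intro: less_imp_le)
  also have "\<dots> = \<rho> ^ n * \<bar>w $ i\<bar>"
    unfolding i using Nu by (simp add: algebra_simps)
  \<comment> \<open>The strict inequality excludes \<open>w $ i = 0\<close>, so the common factor
    cancels.\<close>
  finally have "\<bar>\<mu>\<bar> ^ n < \<rho> ^ n"
    by (simp add: mult_less_cancel_right_disj)
  then show ?thesis
    by (rule power_less_imp_less_base) (use \<rho> in simp)
qed

section \<open>Sums over population vectors\<close>

lemma summable_on_power_popsize:
  fixes \<tau> :: real
  assumes "0 \<le> \<tau>" "\<tau> < 1"
  shows "(\<lambda>y. \<tau> ^ popsize y) summable_on A"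
proof -
  have "(\<lambda>y. \<tau> ^ popsize y) summable_on UNIV"
  proof (rule nonneg_bdd_above_summable_on)
    show "bdd_above (sum (\<lambda>y. \<tau> ^ popsize y) ` {F. F \<subseteq> UNIV \<and> finite F})"
    proof (rule bdd_aboveI2)
      fix F :: "(nat ^ 2) set" assume "F \<in> {F. F \<subseteq> UNIV \<and> finite F}"
      then have F: "finite F"
        by simp
      \<comment> \<open>A finite set lies in a square of side \<open>N\<close>, where the sum is a
        product of two geometric sums.\<close>
      define N where "N = Suc (Max (insert 0 (popsize ` F)))"
      have N: "y $ k < N" if "y \<in> F" for y k
      proof -
        have "popsize y \<le> Max (insert 0 (popsize ` F))"
          using F that by (intro Max_ge) auto
        then show ?thesis
          using nth_le_popsize[of y k] unfolding N_def by linarith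
      qed
      have inj: "inj_on (\<lambda>y :: nat ^ 2. (y $ 1, y $ 2)) F"
        by (auto simp: inj_on_def vec_eq_iff forall_2)
      have "(\<Sum>y\<in>F. \<tau> ^ popsize y) = (\<Sum>(a, b)\<in>(\<lambda>y. (y $ 1, y $ 2)) ` F. \<tau> ^ a * \<tau> ^ b)"
        by (simp add: sum.reindex[OF inj] popsize_def sum_2 power_add)
      also have "\<dots> \<le> (\<Sum>(a, b)\<in>{..<N} \<times> {..<N}. \<tau> ^ a * \<tau> ^ b)"
        using assms N by (intro sum_mono2) auto
      also have "\<dots> = (\<Sum>a<N. \<tau> ^ a) * (\<Sum>b<N. \<tau> ^ b)"
        by (simp add: sum_product sum.cartesian_product)
      also have "\<dots> \<le> (1 / (1 - \<tau>)) * (1 / (1 - \<tau>))"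
      proof -
        have "(\<Sum>a<N. \<tau> ^ a) \<le> 1 / (1 - \<tau>)"
          using sum_le_suminf[of "\<lambda>a. \<tau> ^ a" "{..<N}"] assms by (simp add: suminf_geometric summable_geometric)
        then show ?thesis
          using assms by (intro mult_mono) (auto intro!: sum_nonneg)
      qed
      finally show "(\<Sum>y\<in>F. \<tau> ^ popsize y) \<le> (1 / (1 - \<tau>)) * (1 / (1 - \<tau>))" .
    qed
  qed (use assms in auto)
  then show ?thesis
    by (rule summable_on_subset_banach) simp
qed

lemma infsum_dominated_convergence:
  fixes f :: "nat \<Rightarrow> 'a \<Rightarrow> real"
  assumes f: "\<And>x. x \<in> A \<Longrightarrow> (\<lambda>n. f n x) \<longlonglongrightarrow> g x"
    and bound: "\<And>n x. x \<in> A \<Longrightarrow> \<bar>f n x\<bar> \<le> w x" and w: "w summable_on A"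
  shows "g summable_on A" "(\<lambda>n. \<Sum>\<^sub>\<infinity>x\<in>A. f n x) \<longlonglongrightarrow> (\<Sum>\<^sub>\<infinity>x\<in>A. g x)"
proof -
  have w0: "0 \<le> w x" if "x \<in> A" for x
    using bound[OF that, of 0] by linarith
  have "Infinite_Sum.abs_summable_on w A"
    using w by (rule summable_on_cong[THEN iffD1, rotated]) (simp add: w0)
  then have w': "integrable (count_space A) w"
    unfolding abs_summable_equivalent Infinite_Set_Sum.abs_summable_on_def .
  have g_bound: "\<bar>g x\<bar> \<le> w x" if "x \<in> A" for x
    using tendsto_rabs[OF f[OF that]] bound[OF that] by (intro LIMSEQ_le_const2[where a = "w x"]) auto
  have to_infsum: "g' summable_on A \<and> lebesgue_integral (count_space A) g' = (\<Sum>\<^sub>\<infinity>x\<in>A. g' x)"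
    if "\<And>x. x \<in> A \<Longrightarrow> \<bar>g' x\<bar> \<le> w x" for g' :: "'a \<Rightarrow> real"
  proof -
    have "integrable (count_space A) g'"
      by (rule Bochner_Integration.integrable_bound[OF w']) (use that w0 in \<open>auto simp: AE_count_space\<close>)
    then have abs: "Infinite_Set_Sum.abs_summable_on g' A"
      by (simp add: Infinite_Set_Sum.abs_summable_on_def)
    then have "g' summable_on A"
      unfolding abs_summable_equivalent[symmetric] by (rule abs_summable_summable)
    then show ?thesis
      using infsetsum_infsum[OF abs] by (simp add: infsetsum_def)
  qed
  show "g summable_on A"
    by (rule to_infsum[OF g_bound, THEN conjunct1])
  have "(\<lambda>n. lebesgue_integral (count_space A) (f n)) \<longlonglongrightarrow> lebesgue_integral (count_space A) g"
    by (rule integral_dominated_convergence[OF _ _ w']) (auto simp: AE_count_space f bound)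
  then show "(\<lambda>n. \<Sum>\<^sub>\<infinity>x\<in>A. f n x) \<longlonglongrightarrow> (\<Sum>\<^sub>\<infinity>x\<in>A. g x)"
    by (simp only: to_infsum[OF bound, THEN conjunct2] to_infsum[OF g_bound, THEN conjunct2])
qed

section \<open>Expectations of exponentially decaying weights\<close>

context decaying_gwi
begin

lemma pmf_law_axis_0: "pmf (law n (axis i 1)) 0 = 0"
  using popsize_law[of 0 n "axis i 1"] by (auto simp: pmf_eq_0_set_pmf simp del: One_nat_def)

proposition expectation_law_limit:
  fixes C \<delta> :: real
  assumes g: "\<And>j. j \<noteq> 0 \<Longrightarrow> 0 \<le> g j" "\<And>j. j \<noteq> 0 \<Longrightarrow> g j \<le> C * exp (- \<delta> * popsize j)"
    and \<delta>: "\<delta> > 0"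
  shows "(\<lambda>j. g j * lim (scaled_pmf i j)) summable_on (UNIV - {0})"
    and "(\<lambda>n. measure_pmf.expectation (law n (axis i 1)) g / decay ^ n) \<longlonglongrightarrow>
      (\<Sum>\<^sub>\<infinity>j\<in>UNIV - {0}. g j * lim (scaled_pmf i j))"
proof -
  \<comment> \<open>Half of the decay rate: of the two factors \<open>\<sigma> ^ popsize j\<close>
    one cancels the growth of the bound on \<open>scaled_pmf\<close>, and the other makes the
    majorant summable.\<close>
  define \<sigma> where "\<sigma> = exp (- (\<delta> / 2))"
  have \<sigma>: "0 < \<sigma>" "\<sigma> < 1"
    using \<delta> by (auto simp: \<sigma>_def)
  have exp_\<sigma>: "exp (- \<delta> * popsize j) = \<sigma> ^ popsize j * \<sigma> ^ popsize j" for j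
    by (simp add: \<sigma>_def exp_of_nat_mult[symmetric] exp_add[symmetric])
  obtain C' where C': "C' > 0"
    "\<And>n x j. x \<noteq> 0 \<Longrightarrow> pmf (law n x) j \<le> C' / \<sigma> ^ popsize j * decay ^ n"
    by (rule pmf_law_bound[OF \<sigma>]) (rule that)
  have scaled: "0 \<le> scaled_pmf i j n" "scaled_pmf i j n \<le> C' / \<sigma> ^ popsize j" for j n
    using C'(2)[of "axis i 1" n j] decay_pos by (simp_all add: scaled_pmf_def pos_divide_le_eq axis_eq_0_iff del: One_nat_def)
  have bound: "\<bar>g j * scaled_pmf i j n\<bar> \<le> C * C' * \<sigma> ^ popsize j" if "j \<noteq> 0" for j n
  proof -
    have "\<bar>g j * scaled_pmf i j n\<bar> = g j * scaled_pmf i j n"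
      using g[OF that] scaled by (simp add: abs_mult)
    also have "\<dots> \<le> (C * exp (- \<delta> * popsize j)) * (C' / \<sigma> ^ popsize j)"
      using g[OF that] scaled by (intro mult_mono) auto
    also have "\<dots> = C * C' * \<sigma> ^ popsize j"
      unfolding exp_\<sigma> using \<sigma> by simp
    finally show ?thesis .
  qed
  have lim: "(\<lambda>n. g j * scaled_pmf i j n) \<longlonglongrightarrow> g j * lim (scaled_pmf i j)" for j
    using convergent_scaled_pmf[of i j] by (intro tendsto_mult_left) (simp add: convergent_LIMSEQ_iff)
  have w: "(\<lambda>j. C * C' * \<sigma> ^ popsize j) summable_on (UNIV - {0})"
    using \<sigma> by (intro summable_on_cmult_right summable_on_power_popsize) auto
  note dom = infsum_dominated_convergence[of "UNIV - {0}", OF lim bound w, simplified]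
  show "(\<lambda>j. g j * lim (scaled_pmf i j)) summable_on (UNIV - {0})"
    by (rule dom(1))
  have "(\<Sum>\<^sub>\<infinity>j\<in>UNIV - {0}. g j * scaled_pmf i j n) =
      measure_pmf.expectation (law n (axis i 1)) g / decay ^ n" for n
  proof -
    \<comment> \<open>The bounds on \<open>g\<close> exclude zero. The process never reaches it, so
      changing the value there gives a bounded function with the same expectation.\<close>
    define g' where "g' j = (if j = 0 then 0 else g j)" for j
    have g': "\<bar>g' j\<bar> \<le> \<bar>C\<bar>" for j
    proof (cases "j = 0")
      case False
      have "\<bar>g j\<bar> \<le> \<bar>C\<bar> * exp (- \<delta> * popsize j)"
      proof -
        have "C * exp (- \<delta> * popsize j) \<le> \<bar>C\<bar> * exp (- \<delta> * popsize j)"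
          by (intro mult_right_mono) auto
        then show ?thesis
          using g[OF False] by linarith
      qed
      also have "\<dots> \<le> \<bar>C\<bar> * 1"
        using \<delta> by (intro mult_left_mono) auto
      finally show ?thesis
        using False by (simp add: g'_def)
    qed (simp add: g'_def)
    have "(\<Sum>\<^sub>\<infinity>j\<in>UNIV - {0}. g j * scaled_pmf i j n) =
        (\<Sum>\<^sub>\<infinity>j\<in>UNIV. inverse (decay ^ n) * (pmf (law n (axis i 1)) j * g' j))"
      by (rule infsum_cong_neutral) (auto simp: g'_def scaled_pmf_def divide_inverse mult_ac)
    also have "\<dots> = inverse (decay ^ n) * measure_pmf.expectation (law n (axis i 1)) g'"
      by (simp add: infsum_cmult_right' pmf_infsum_eq_expectation[OF g'])
    also have "measure_pmf.expectation (law n (axis i 1)) g' = measure_pmf.expectation (law n (axis i 1)) g"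
      using pmf_law_axis_0[of n i]
      by (intro integral_cong_AE) (auto simp: AE_measure_pmf_iff g'_def pmf_eq_0_set_pmf)
    finally show ?thesis
      by (simp add: field_simps)
  qed
  then show "(\<lambda>n. measure_pmf.expectation (law n (axis i 1)) g / decay ^ n) \<longlonglongrightarrow>
      (\<Sum>\<^sub>\<infinity>j\<in>UNIV - {0}. g j * lim (scaled_pmf i j))"
    using dom(2) by simp
qed

end

section \<open>Events of the given process in terms of its laws\<close>

lemma
  assumes X: "two_type_GWI \<Omega> p h X"
  shows two_type_GWI_prob: "\<P>(\<omega> in \<Omega>. Q (X j n \<omega>)) = measure_pmf.prob (gwi_law p h n j) {y. Q y}"
    and two_type_GWI_prob_step: "\<P>(\<omega> in \<Omega>. R (X j n \<omega>) (X j (Suc n) \<omega>)) =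
      measure_pmf.expectation (gwi_law p h n j) (\<lambda>x. measure_pmf.prob (gwi_step p h x) {y. R x y})"
    and two_type_GWI_integrable: "integrable \<Omega> (\<lambda>\<omega>. g (X j n \<omega>) :: real) \<longleftrightarrow> integrable (measure_pmf (gwi_law p h n j)) g"
proof -
  interpret prob_space \<Omega>
    using two_type_GWI_markov(1)[OF X] .
  note mX [measurable] = two_type_GWI_markov(2)[OF X]
  note law = two_type_GWI_markov(3)[OF X]
  have "\<P>(\<omega> in \<Omega>. Q (X j n \<omega>)) = measure (distr \<Omega> (count_space UNIV) (X j n)) {y. Q y}"
    by (subst measure_distr[OF mX]) (auto intro!: arg_cong[where f = prob])
  then show "\<P>(\<omega> in \<Omega>. Q (X j n \<omega>)) = measure_pmf.prob (gwi_law p h n j) {y. Q y}"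
    by (simp add: law)
  show "integrable \<Omega> (\<lambda>\<omega>. g (X j n \<omega>)) \<longleftrightarrow> integrable (measure_pmf (gwi_law p h n j)) g"
    unfolding law[symmetric] by (subst integrable_distr_eq[OF mX]) auto
  \<comment> \<open>The joint law of two consecutive generations.\<close>
  define J where "J = bind_pmf (gwi_law p h n j) (\<lambda>x. map_pmf (Pair x) (gwi_step p h x))"
  define V where "V \<omega> = (X j n \<omega>, X j (Suc n) \<omega>)" for \<omega>
  have "random_variable (count_space UNIV \<Otimes>\<^sub>M count_space UNIV) V"
    unfolding V_def by measurable
  then have mV: "random_variable (count_space UNIV) V"
    by (simp add: pair_measure_countable)
  have "distr \<Omega> (count_space UNIV) V = measure_pmf J"
  proof (rule distr_eq_pmfI[OF mV])
    fix z :: "(nat ^ 2) \<times> (nat ^ 2)"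
    obtain x y where z: "z = (x, y)"
      by (cases z)
    have "pmf (map_pmf (Pair x') (gwi_step p h x')) (x, y) = indicator {x} x' * pmf (gwi_step p h x) y" for x'
    proof (cases "x' = x")
      case True
      then show ?thesis
        using pmf_map_inj'[of "Pair x" "gwi_step p h x" y] by (simp add: inj_on_def)
    next
      case False
      then have "(x, y) \<notin> set_pmf (map_pmf (Pair x') (gwi_step p h x'))"
        by auto
      then show ?thesis
        using False by (simp add: pmf_eq_0_set_pmf)
    qed
    then have "pmf J (x, y) = pmf (gwi_law p h n j) x * pmf (gwi_step p h x) y"
      by (simp add: J_def pmf_bind measure_pmf_single)
    moreover have "{\<omega> \<in> space \<Omega>. V \<omega> = z} = {\<omega> \<in> space \<Omega>. X j n \<omega> = x \<and> X j (Suc n) \<omega> = y}"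
      by (auto simp: V_def z)
    ultimately show "prob {\<omega> \<in> space \<Omega>. V \<omega> = z} = pmf J z"
      using two_type_GWI_markov(4)[OF X, of j n x y] by (simp add: z)
  qed
  moreover have "\<P>(\<omega> in \<Omega>. R (X j n \<omega>) (X j (Suc n) \<omega>)) = measure (distr \<Omega> (count_space UNIV) V) {(x, y). R x y}"
    by (subst measure_distr[OF mV]) (auto simp: V_def intro!: arg_cong[where f = prob])
  moreover have "measure_pmf.prob J {(x, y). R x y} =
      measure_pmf.expectation (gwi_law p h n j) (\<lambda>x. measure_pmf.prob (map_pmf (Pair x) (gwi_step p h x)) {(x, y). R x y})"
    by (simp add: J_def prob_bind_pmf)
  moreover have "measure_pmf.prob (map_pmf (Pair x) (gwi_step p h x)) {(x, y). R x y} =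
      measure_pmf.prob (gwi_step p h x) {y. R x y}" for x
    by (simp add: vimage_def)
  ultimately show "\<P>(\<omega> in \<Omega>. R (X j n \<omega>) (X j (Suc n) \<omega>)) =
      measure_pmf.expectation (gwi_law p h n j) (\<lambda>x. measure_pmf.prob (gwi_step p h x) {y. R x y})"
    by simp
qed

section \<open>Assembly of the two limits\<close>

theorem theorem1p1:
  fixes \<Omega> :: "'w measure"
    and p :: "2 \<Rightarrow> (nat ^ 2) pmf"
    and h :: "(nat ^ 2) pmf"
    and X :: "nat ^ 2 \<Rightarrow> nat \<Rightarrow> 'w \<Rightarrow> nat ^ 2"
    and M P\<^sub>0 :: "real ^ 2 ^ 2"
    and u v l :: "real ^ 2"
    and \<rho> \<gamma> \<theta>\<^sub>0 h\<^sub>0 \<epsilon> :: real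
    and i :: 2
  assumes process: "two_type_GWI \<Omega> p h X"
    and f_0: "\<forall>i. offspring_gf p i 0 = 0"
    and mean: "is_mean_matrix p M"
    and pos_reg: "positively_regular M"
    and rho: "maximal_eigenvalue M \<rho>" "\<rho> > 1"
    and left_eigenvector: "v v* M = \<rho> *s v" "\<forall>k. v $ k > 0"
    and right_eigenvector: "M *v u = \<rho> *s u" "\<forall>k. u $ k > 0"
    and normalization: "v \<bullet> u = 1" "u \<bullet> 1 = 1"
    and h_0: "h\<^sub>0 = pmf h 0" "h\<^sub>0 > 0"
    and gamma: "0 < \<gamma>" "\<gamma> < 1"
    and A_limit: "(\<lambda>n. (1 / \<gamma> ^ n) *\<^sub>R mat_power (deriv_matrix_0 p) n) \<longlonglongrightarrow> P\<^sub>0" "P\<^sub>0 \<noteq> 0"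
    and exp_moment: "\<theta>\<^sub>0 > 0"
      "\<forall>i. integrable \<Omega> (\<lambda>\<omega>. exp (\<theta>\<^sub>0 * (1 \<bullet> rvec (X (axis i 1) 1 \<omega>))))"
    and l: "l \<noteq> 0" "l $ 1 \<noteq> l $ 2"
    and eps: "\<epsilon> > 0"
  shows
    "(\<forall>j. j \<noteq> 0 \<longrightarrow> convergent (ratio \<Omega> X (h\<^sub>0 * \<gamma>) i j)) \<and>
     (\<lambda>j. phi \<Omega> X M l j \<epsilon> * r_lim \<Omega> X (h\<^sub>0 * \<gamma>) i j) summable_on (UNIV - {0}) \<and>
     (\<lambda>n. \<P>(\<omega> in \<Omega>.
            \<bar>(l \<bullet> rvec (X (axis i 1) (n + 1) \<omega>)) / (1 \<bullet> rvec (X (axis i 1) n \<omega>))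
              - (l \<bullet> (rvec (X (axis i 1) n \<omega>) v* M)) / (1 \<bullet> rvec (X (axis i 1) n \<omega>))\<bar> > \<epsilon>)
          / (h\<^sub>0 * \<gamma>) ^ n)
       \<longlonglongrightarrow> (\<Sum>\<^sub>\<infinity>j\<in>UNIV - {0}. phi \<Omega> X M l j \<epsilon> * r_lim \<Omega> X (h\<^sub>0 * \<gamma>) i j) \<and>
     (\<exists>k\<^sub>0>0.
        (\<lambda>j. phi_hat \<Omega> X v l j k\<^sub>0 \<epsilon> * r_lim \<Omega> X (h\<^sub>0 * \<gamma>) i j) summable_on (UNIV - {0}) \<and>
        (\<lambda>n. \<P>(\<omega> in \<Omega>.
               \<bar>(l \<bullet> rvec (X (axis i 1) n \<omega>)) / (1 \<bullet> rvec (X (axis i 1) n \<omega>))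
                 - (l \<bullet> v) / (1 \<bullet> v)\<bar> > \<epsilon>)
             / (h\<^sub>0 * \<gamma>) ^ n)
          \<longlonglongrightarrow> (\<Sum>\<^sub>\<infinity>j\<in>UNIV - {0}. phi_hat \<Omega> X v l j k\<^sub>0 \<epsilon> * r_lim \<Omega> X (h\<^sub>0 * \<gamma>) i j)
              / (h\<^sub>0 * \<gamma>) ^ k\<^sub>0)"
proof -
  define N\<^sub>0 where "N\<^sub>0 = UNIV - {0 :: nat ^ 2}"
  have h\<^sub>0: "h\<^sub>0 = pmf h 0"
    by (rule h_0(1))
  have p_0: "pmf (p i) 0 = 0" for i
    using f_0 offspring_gf_eq_pgf[of 0 p i] by (simp add: pgf_0 unit_square_def)
  interpret growing_gwi p h
    by unfold_locales (rule p_0)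
  note prob_X = two_type_GWI_prob[OF process]
  \<comment> \<open>The first generation from one particle is immigration plus a litter. Sizes add
    up, so both parts inherit the exponential moment.\<close>
  have exp_step: "integrable (measure_pmf (pair_pmf h (p i))) (\<lambda>(y, x). exp (\<theta>\<^sub>0 * real (popsize (y + x))))" for i
  proof -
    have "integrable \<Omega> (\<lambda>\<omega>. exp (\<theta>\<^sub>0 * real (popsize (X (axis i 1) 1 \<omega>))))"
      using exp_moment(2) by simp
    then have "integrable (measure_pmf (step (axis i 1))) (\<lambda>y. exp (\<theta>\<^sub>0 * real (popsize y)))"
      using two_type_GWI_integrable[OF process, of "\<lambda>y. exp (\<theta>\<^sub>0 * real (popsize y))" "axis i 1" 1]
      by (simp only: gwi_law_1)
    then show ?thesis
      by (simp add: gwi_step_axis case_prod_unfold del: One_nat_def)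
  qed
  have exp_snd: "integrable (measure_pmf (p i)) (\<lambda>y. exp (\<theta>\<^sub>0 * real (popsize y)))" for i
  proof -
    have "integrable (measure_pmf (pair_pmf h (p i))) (\<lambda>z. exp (\<theta>\<^sub>0 * real (popsize (snd z))))"
      by (rule Bochner_Integration.integrable_bound[OF exp_step[of i]])
        (use exp_moment(1) in \<open>auto simp: popsize_add\<close>)
    then have "integrable (measure_pmf (map_pmf snd (pair_pmf h (p i)))) (\<lambda>y. exp (\<theta>\<^sub>0 * real (popsize y)))"
      by simp
    then show ?thesis
      by (simp only: map_snd_pair_pmf)
  qed
  have exp_fst: "integrable (measure_pmf h) (\<lambda>y. exp (\<theta>\<^sub>0 * real (popsize y)))"
  proof -
    have "integrable (measure_pmf (pair_pmf h (p i))) (\<lambda>z. exp (\<theta>\<^sub>0 * real (popsize (fst z))))"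
      by (rule Bochner_Integration.integrable_bound[OF exp_step[of i]])
        (use exp_moment(1) in \<open>auto simp: popsize_add\<close>)
    then have "integrable (measure_pmf (map_pmf fst (pair_pmf h (p i)))) (\<lambda>y. exp (\<theta>\<^sub>0 * real (popsize y)))"
      by simp
    then show ?thesis
      by (simp only: map_fst_pair_pmf)
  qed
  note square = integrable_popsize_square[OF exp_snd exp_moment(1)]
  have "deriv_matrix_0 p = single_matrix"
    using deriv_matrix_0_eq[OF square] by (simp add: single_matrix_def)
  then interpret decaying_gwi p h \<gamma> P\<^sub>0
    using gamma A_limit(1) h_0 by unfold_locales auto
  interpret light_tailed_gwi p h M \<theta>\<^sub>0
    by unfold_locales (use exp_moment(1) exp_snd exp_fst mean_matrix_eq[OF mean square] in auto)
  have decay: "h\<^sub>0 * \<gamma> = decay"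
    by (simp add: decay_def h\<^sub>0)
  have ratio: "ratio \<Omega> X (h\<^sub>0 * \<gamma>) i j = scaled_pmf i j" for j
    using prob_X[of "\<lambda>y. y = j" "axis i 1"]
    by (simp add: fun_eq_iff ratio_def scaled_pmf_def decay measure_pmf_single del: One_nat_def)
  then have r_lim: "r_lim \<Omega> X (h\<^sub>0 * \<gamma>) i j = lim (scaled_pmf i j)" for j
    by (simp add: r_lim_def)
  have pop_pos: "real (popsize y) > 0" if "y \<in> set_pmf (law n x)" "x \<noteq> 0" for x y n
  proof -
    have "popsize x \<noteq> 0"
      using that(2) by simp
    with popsize_law[OF that(1)] show ?thesis
      by linarith
  qed
  have axis_nonzero: "axis i (1 :: nat) \<noteq> 0"
    by (simp add: axis_eq_0_iff)

  \<comment> \<open>Moving \<open>M\<close> across the inner product makes this the event of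
    \<open>step_deviation\<close>.\<close>
  have phi: "phi \<Omega> X M l j \<epsilon> = measure_pmf.prob (step j) {y. \<bar>l \<bullet> rvec y - (M *v l) \<bullet> rvec j\<bar> > \<epsilon> * popsize j}" for j
    using prob_X[of "\<lambda>y. \<bar>l \<bullet> rvec y - l \<bullet> (rvec j v* M)\<bar> > \<epsilon> * (1 \<bullet> rvec j)" j 1]
    by (simp only: phi_def gwi_law_1 inner_1_rvec inner_commute[of l "_ v* M"] dot_lmul_matrix
        inner_commute[of "rvec j"])
  obtain C\<^sub>1 \<delta>\<^sub>1 :: real where phi_bound: "\<delta>\<^sub>1 > 0" "\<And>j. phi \<Omega> X M l j \<epsilon> \<le> C\<^sub>1 * exp (- \<delta>\<^sub>1 * popsize j)"
    unfolding phi using step_deviation[OF eps, of l] by metis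
  \<comment> \<open>Conditioning on generation \<open>n\<close>, whose size is positive, so that the
    division can be cleared.\<close>
  have phi_prob: "\<P>(\<omega> in \<Omega>.
            \<bar>(l \<bullet> rvec (X (axis i 1) (n + 1) \<omega>)) / (1 \<bullet> rvec (X (axis i 1) n \<omega>))
              - (l \<bullet> (rvec (X (axis i 1) n \<omega>) v* M)) / (1 \<bullet> rvec (X (axis i 1) n \<omega>))\<bar> > \<epsilon>) =
      measure_pmf.expectation (law n (axis i 1)) (\<lambda>j. phi \<Omega> X M l j \<epsilon>)" (is "?P n = _") for n
  proof -
    have "?P n = measure_pmf.expectation (law n (axis i 1)) (\<lambda>x. measure_pmf.prob (step x)
        {y. \<bar>(l \<bullet> rvec y) / (1 \<bullet> rvec x) - (l \<bullet> (rvec x v* M)) / (1 \<bullet> rvec x)\<bar> > \<epsilon>})"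
      unfolding Suc_eq_plus1[symmetric] by (rule two_type_GWI_prob_step[OF process])
    also have "\<dots> = measure_pmf.expectation (law n (axis i 1)) (\<lambda>j. phi \<Omega> X M l j \<epsilon>)"
    proof (intro integral_cong_AE AE_pmfI)
      fix x assume "x \<in> set_pmf (law n (axis i 1))"
      then have x: "real (popsize x) > 0"
        by (rule pop_pos[OF _ axis_nonzero])
      have "(\<bar>(l \<bullet> rvec y) / (1 \<bullet> rvec x) - (l \<bullet> (rvec x v* M)) / (1 \<bullet> rvec x)\<bar> > \<epsilon>) \<longleftrightarrow>
          (\<bar>l \<bullet> rvec y - (M *v l) \<bullet> rvec x\<bar> > \<epsilon> * popsize x)" for y
      proof -
        have "l \<bullet> (rvec x v* M) = (M *v l) \<bullet> rvec x"
          by (simp only: inner_commute[of l] dot_lmul_matrix inner_commute[of "rvec x"])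
        then have "\<bar>(l \<bullet> rvec y) / (1 \<bullet> rvec x) - (l \<bullet> (rvec x v* M)) / (1 \<bullet> rvec x)\<bar> =
            \<bar>l \<bullet> rvec y - (M *v l) \<bullet> rvec x\<bar> / popsize x"
          using x by (simp add: diff_divide_distrib[symmetric])
        then show ?thesis
          using x by (simp only: pos_less_divide_eq)
      qed
      then show "measure_pmf.prob (step x)
        {y. \<bar>(l \<bullet> rvec y) / (1 \<bullet> rvec x) - (l \<bullet> (rvec x v* M)) / (1 \<bullet> rvec x)\<bar> > \<epsilon>} = phi \<Omega> X M l x \<epsilon>"
        unfolding phi by simp
    qed auto
    finally show ?thesis .
  qed
  have part1: "(\<lambda>j. phi \<Omega> X M l j \<epsilon> * r_lim \<Omega> X (h\<^sub>0 * \<gamma>) i j) summable_on N\<^sub>0"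
      "(\<lambda>n. ?P n / (h\<^sub>0 * \<gamma>) ^ n) \<longlonglongrightarrow> (\<Sum>\<^sub>\<infinity>j\<in>N\<^sub>0. phi \<Omega> X M l j \<epsilon> * r_lim \<Omega> X (h\<^sub>0 * \<gamma>) i j)"
    unfolding phi_prob r_lim unfolding decay N\<^sub>0_def
    by (rule expectation_law_limit[OF _ phi_bound(2,1)], simp add: phi)+

  define c where "c = (l \<bullet> v) / (1 \<bullet> v)"
  \<comment> \<open>Subtracting the limit direction from the ratio replaces \<open>l\<close> by
    \<open>w\<close> in the numerator, because \<open>1 \<bullet> rvec y\<close> is the population
    size.\<close>
  define w where "w = l - c *\<^sub>R 1"
  have one_v: "1 \<bullet> v > 0"
    using left_eigenvector(2) by (simp add: inner_vec_def sum_2 add_pos_pos)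
  have vw: "v \<bullet> w = 0"
    using one_v by (simp add: w_def c_def inner_diff_right inner_commute[of v])
  \<comment> \<open>If \<open>w\<close> vanished, both coordinates of \<open>l\<close> would equal
    \<open>c\<close>.\<close>
  have w0: "w \<noteq> 0"
    using l(2) by (auto simp: w_def vec_eq_iff forall_2)
  obtain \<mu> where \<mu>: "M *v w = \<mu> *s w"
    using vec_2_orthogonal_eigenvector[OF left_eigenvector vw w0] .
  have \<mu>_less: "\<bar>\<mu>\<bar> < \<rho>"
    using rho(2) by (intro second_eigenvalue_less[OF pos_reg left_eigenvector(2) right_eigenvector _ vw w0 \<mu>]) auto
  obtain k\<^sub>0 :: nat and C\<^sub>2 \<delta>\<^sub>2 :: real where k\<^sub>0: "k\<^sub>0 > 0" and "C\<^sub>2 > 0" and \<delta>\<^sub>2: "\<delta>\<^sub>2 > 0"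
    and dev: "\<And>x. measure_pmf.prob (law k\<^sub>0 x) {y. \<bar>w \<bullet> rvec y\<bar> > \<epsilon> * (u \<bullet> rvec y)} \<le> C\<^sub>2 * exp (- \<delta>\<^sub>2 * popsize x)"
    by (rule law_direction_deviation[OF \<mu> right_eigenvector(1) right_eigenvector(2)[rule_format] \<mu>_less eps])
      (rule that)
  define S where "S = {y. \<bar>(l \<bullet> rvec y) / (1 \<bullet> rvec y) - (l \<bullet> v) / (1 \<bullet> v)\<bar> > \<epsilon>}"
  have phi_hat: "phi_hat \<Omega> X v l j k\<^sub>0 \<epsilon> = measure_pmf.prob (law k\<^sub>0 j) S" for j
    unfolding phi_hat_def S_def by (rule prob_X)
  \<comment> \<open>The normalization \<open>u \<bullet> 1 = 1\<close> bounds the entries of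
    \<open>u\<close> by one, so a deviation relative to the size is also one relative to
    \<open>u \<bullet> rvec y\<close>.\<close>
  have u_le: "u \<bullet> rvec y \<le> popsize y" for y
  proof -
    have "u $ 1 + u $ 2 = 1"
      using normalization(2) by (simp add: inner_vec_def sum_2)
    then have "\<bar>u $ k\<bar> \<le> 1" for k
      using right_eigenvector(2)[rule_format, of 1] right_eigenvector(2)[rule_format, of 2] exhaust_2[of k] by auto
    then show ?thesis
      using inner_rvec_le[of u 1 y] by simp
  qed
  have phi_hat_bound: "phi_hat \<Omega> X v l j k\<^sub>0 \<epsilon> \<le> C\<^sub>2 * exp (- \<delta>\<^sub>2 * popsize j)" if "j \<noteq> 0" for j
  proof -
    have "measure_pmf.prob (law k\<^sub>0 j) S = measure_pmf.prob (law k\<^sub>0 j) (S \<inter> set_pmf (law k\<^sub>0 j))"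
      by (rule measure_Int_set_pmf[symmetric])
    also have "\<dots> \<le> measure_pmf.prob (law k\<^sub>0 j) {y. \<bar>w \<bullet> rvec y\<bar> > \<epsilon> * (u \<bullet> rvec y)}"
    proof (rule measure_pmf.finite_measure_mono)
      show "S \<inter> set_pmf (law k\<^sub>0 j) \<subseteq> {y. \<bar>w \<bullet> rvec y\<bar> > \<epsilon> * (u \<bullet> rvec y)}"
      proof
        fix y assume y: "y \<in> S \<inter> set_pmf (law k\<^sub>0 j)"
        then have y0: "real (popsize y) > 0"
          using pop_pos[OF _ that] by blast
        have "w \<bullet> rvec y = l \<bullet> rvec y - c * popsize y"
          by (simp add: w_def inner_diff_left)
        moreover have "c * real (popsize y) / popsize y = c"
          by (rule nonzero_mult_div_cancel_right) (use y0 in linarith)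
        ultimately have "(l \<bullet> rvec y) / (1 \<bullet> rvec y) - (l \<bullet> v) / (1 \<bullet> v) = (w \<bullet> rvec y) / popsize y"
          by (simp only: c_def[symmetric] inner_1_rvec diff_divide_distrib)
        then have "\<epsilon> < \<bar>w \<bullet> rvec y\<bar> / popsize y"
          using y by (simp add: S_def)
        then have "\<epsilon> * popsize y < \<bar>w \<bullet> rvec y\<bar>"
          using y0 by (simp only: pos_less_divide_eq)
        moreover have "\<epsilon> * (u \<bullet> rvec y) \<le> \<epsilon> * popsize y"
          using eps by (intro mult_left_mono u_le) auto
        ultimately show "y \<in> {y. \<bar>w \<bullet> rvec y\<bar> > \<epsilon> * (u \<bullet> rvec y)}"
          by simp
      qed
    qed simp
    also have "\<dots> \<le> C\<^sub>2 * exp (- \<delta>\<^sub>2 * popsize j)"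
      by (rule dev)
    finally show ?thesis
      by (simp add: phi_hat)
  qed
  have phi_hat_prob: "\<P>(\<omega> in \<Omega>.
               \<bar>(l \<bullet> rvec (X (axis i 1) n \<omega>)) / (1 \<bullet> rvec (X (axis i 1) n \<omega>))
                 - (l \<bullet> v) / (1 \<bullet> v)\<bar> > \<epsilon>) = measure_pmf.prob (law n (axis i 1)) S" (is "?Q n = _") for n
    unfolding S_def by (rule prob_X)
  \<comment> \<open>The Markov property at time \<open>n\<close>; \<open>phi_hat\<close> now takes
    the place of the weight \<open>phi\<close>.\<close>
  have shift: "?Q (n + k\<^sub>0) = measure_pmf.expectation (law n (axis i 1)) (\<lambda>j. phi_hat \<Omega> X v l j k\<^sub>0 \<epsilon>)" for n
    unfolding phi_hat_prob gwi_law_add prob_bind_pmf phi_hat ..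
  let ?L = "\<Sum>\<^sub>\<infinity>j\<in>N\<^sub>0. phi_hat \<Omega> X v l j k\<^sub>0 \<epsilon> * r_lim \<Omega> X (h\<^sub>0 * \<gamma>) i j"
  have part2: "(\<lambda>j. phi_hat \<Omega> X v l j k\<^sub>0 \<epsilon> * r_lim \<Omega> X (h\<^sub>0 * \<gamma>) i j) summable_on N\<^sub>0"
      "(\<lambda>n. ?Q (n + k\<^sub>0) / (h\<^sub>0 * \<gamma>) ^ n) \<longlonglongrightarrow> ?L"
    unfolding shift r_lim unfolding decay N\<^sub>0_def
    by (rule expectation_law_limit[OF _ phi_hat_bound \<delta>\<^sub>2], simp add: phi_hat, assumption)+
  \<comment> \<open>Passing from the power for time \<open>n\<close> to the one for time
    \<open>n + k\<^sub>0\<close> produces the factor in front of the series.\<close>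
  have "(\<lambda>n. ?Q (n + k\<^sub>0) / (h\<^sub>0 * \<gamma>) ^ n / (h\<^sub>0 * \<gamma>) ^ k\<^sub>0) \<longlonglongrightarrow> ?L / (h\<^sub>0 * \<gamma>) ^ k\<^sub>0"
    using decay_pos by (intro tendsto_divide part2(2) tendsto_const) (simp add: decay)
  then have "(\<lambda>n. ?Q (n + k\<^sub>0) / (h\<^sub>0 * \<gamma>) ^ (n + k\<^sub>0)) \<longlonglongrightarrow> ?L / (h\<^sub>0 * \<gamma>) ^ k\<^sub>0"
    by (simp add: power_add)
  then have "(\<lambda>n. ?Q n / (h\<^sub>0 * \<gamma>) ^ n) \<longlonglongrightarrow> ?L / (h\<^sub>0 * \<gamma>) ^ k\<^sub>0"
    by (rule LIMSEQ_offset)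
  with part1 part2(1) k\<^sub>0 convergent_scaled_pmf ratio show ?thesis
    unfolding N\<^sub>0_def by auto
qed

end
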